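(* Let $q>3$ be a prime power and let $G$ be a group such that $\mathcal{A}_G\cong \mathcal{A}_{\mathrm{GL}(2,q)}$ (isomorphism of graphs). Then $G/Z(G)\cong \mathrm{PGL}(2,q)$, $G'\cong\mathrm{SL}(2,q)$ and $Z(G)$ is of order $q-1$. In particular, if $q$ is even, then $G=G' \times Z(G)$.
   Context: For a non-abelian group $G$ with center $Z(G)$, the non-commuting graph $\mathcal{A}_G$ is the simple graph whose vertex set is $G\setminus Z(G)$, two vertices being joined by an edge if and only if they do not commute. $G'$ denotes the derived (commutator) subgroup of $G$. $\mathrm{GL}(2,q)$, $\mathrm{SL}(2,q)$ and $\mathrm{PGL}(2,q)$ denote, respectively, the general linear, special linear and projective general linear groups of degree 2 over the finite field of order $q$. The equality $G=G'\times Z(G)$ means that $G$ is the internal direct product of its subgroups $G'$ and $Z(G)$. The group $G$ is not assumed to be finite. *)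

theory Defs
  imports
    "HOL-Analysis.Determinants"
    "HOL-Algebra.Generated_Groups"
    "HOL-Number_Theory.Prime_Powers"
    "Graph_Theory.Pair_Digraph"
    "Graph_Theory.Digraph_Isomorphism"
begin

definition group_center :: "('a, 'b) monoid_scheme \<Rightarrow> 'a set" where
  "group_center G = {z \<in> carrier G. \<forall>g \<in> carrier G. z \<otimes>\<^bsub>G\<^esub> g = g \<otimes>\<^bsub>G\<^esub> z}"

(* A simple graph is a pair digraph whose arc relation is symmetric and irreflexive:
   an edge {x, y} is represented by the two arcs (x, y) and (y, x). *)
definition noncommuting_graph :: "('a, 'b) monoid_scheme \<Rightarrow> 'a pair_pre_digraph" where
  "noncommuting_graph G = \<lparr>
     pverts = carrier G - group_center G,
     parcs = {(x, y). x \<in> carrier G - group_center G \<and> y \<in> carrier G - group_center G \<and>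
                      x \<otimes>\<^bsub>G\<^esub> y \<noteq> y \<otimes>\<^bsub>G\<^esub> x}\<rparr>"

lemma pair_bidirected_digraph_noncommuting_graph:
  "pair_bidirected_digraph (noncommuting_graph G)"
  by unfold_locales (auto simp: noncommuting_graph_def symmetric_def sym_def)

(* For pair digraphs, isomorphism in the sense of Graph_Theory is the usual notion of graph
   isomorphism. *)
lemma digraph_iso_with_proj_iff:
  assumes "pair_wf_digraph G" "pair_wf_digraph H"
  shows "digraph_iso (with_proj G) (with_proj H) \<longleftrightarrow>
    (\<exists>f. bij_betw f (pverts G) (pverts H) \<and>
       (\<forall>x \<in> pverts G. \<forall>y \<in> pverts G. (x, y) \<in> parcs G \<longleftrightarrow> (f x, f y) \<in> parcs H))"
    (is "?L \<longleftrightarrow> ?R")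
proof
  assume ?L
  then obtain h where h: "pre_digraph.digraph_isomorphism (with_proj G) h"
    and H: "with_proj H = app_iso h (with_proj G)"
    unfolding digraph_iso_def by blast
  have inj: "inj_on (iso_verts h) (pverts G)"
    using h by (simp add: pre_digraph.digraph_isomorphism_def)
  have v: "pverts H = iso_verts h ` pverts G" and a: "parcs H = iso_arcs h ` parcs G"
    and t: "iso_tail h = fst" and d: "iso_head h = snd"
    using H by (simp_all add: with_proj_def app_iso_def)
  have e: "iso_arcs h (x, y) = (iso_verts h x, iso_verts h y)" if "(x, y) \<in> parcs G" for x y
    using h that t d by (force simp: pre_digraph.digraph_isomorphism_def prod_eq_iff)
  have ends: "x \<in> pverts G \<and> y \<in> pverts G" if "(x, y) \<in> parcs G" for x y
    using pair_wf_digraph.arc_fst_in_verts[OF assms(1) that]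
      pair_wf_digraph.arc_snd_in_verts[OF assms(1) that] by simp
  have "(x, y) \<in> parcs G" if xy: "x \<in> pverts G" "y \<in> pverts G"
    and arc: "(iso_verts h x, iso_verts h y) \<in> parcs H" for x y
  proof -
    obtain u w where uw: "(u, w) \<in> parcs G" "(iso_verts h x, iso_verts h y) = iso_arcs h (u, w)"
      using arc a by auto
    then have "x = u" "y = w"
      using e[OF uw(1)] ends[OF uw(1)] xy inj by (auto dest: inj_onD)
    with uw show ?thesis by simp
  qed
  moreover have "(iso_verts h x, iso_verts h y) \<in> parcs H" if "(x, y) \<in> parcs G" for x y
    using e[OF that] that a by force
  ultimately show ?R
    using inj v by (intro exI[of _ "iso_verts h"]) (auto simp: bij_betw_def)
next
  assume ?R
  then obtain f where f: "bij_betw f (pverts G) (pverts H)"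
    and arcs: "\<And>x y. x \<in> pverts G \<Longrightarrow> y \<in> pverts G \<Longrightarrow>
      (x, y) \<in> parcs G \<longleftrightarrow> (f x, f y) \<in> parcs H"
    by blast
  define h where "h = \<lparr>iso_verts = f, iso_arcs = map_prod f f, iso_head = snd, iso_tail = fst\<rparr>"
  have endsG: "x \<in> pverts G \<and> y \<in> pverts G" if "(x, y) \<in> parcs G" for x y
    using pair_wf_digraph.arc_fst_in_verts[OF assms(1) that]
      pair_wf_digraph.arc_snd_in_verts[OF assms(1) that] by simp
  have endsH: "x \<in> pverts H \<and> y \<in> pverts H" if "(x, y) \<in> parcs H" for x y
    using pair_wf_digraph.arc_fst_in_verts[OF assms(2) that]
      pair_wf_digraph.arc_snd_in_verts[OF assms(2) that] by simp
  have inj: "inj_on f (pverts G)" and im: "f ` pverts G = pverts H"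
    using f by (auto simp: bij_betw_def)
  have "inj_on (map_prod f f) (parcs G)"
    using inj endsG by (auto simp: inj_on_def)
  moreover have "map_prod f f ` parcs G = parcs H"
  proof (intro equalityI subsetI)
    fix e assume "e \<in> map_prod f f ` parcs G"
    then show "e \<in> parcs H" using arcs endsG by auto
  next
    fix e assume e: "e \<in> parcs H"
    obtain u w where uw: "e = (u, w)" by force
    obtain x y where xy: "x \<in> pverts G" "y \<in> pverts G" "u = f x" "w = f y"
      using endsH e uw im by (metis imageE)
    then show "e \<in> map_prod f f ` parcs G"
      using arcs e uw by (auto intro!: rev_image_eqI[of "(x, y)"])
  qed
  ultimately have "pre_digraph.digraph_isomorphism (with_proj G) h"
    and "with_proj H = app_iso h (with_proj G)"
    using inj im wf_digraph_wp_iff[of G] assms(1)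
    by (simp_all add: pre_digraph.digraph_isomorphism_def h_def app_iso_def)
  then show ?L
    unfolding digraph_iso_def by blast
qed

definition GL :: "('f::field ^ 'n ^ 'n) monoid" where
  "GL = \<lparr>carrier = {A. invertible A}, mult = (**), one = mat 1\<rparr>"

definition SL :: "('f::field ^ 'n ^ 'n) monoid" where
  "SL = GL\<lparr>carrier := {A. det A = 1}\<rparr>"

definition scalar_matrices :: "('f::field ^ 'n ^ 'n) set" where
  "scalar_matrices = {mat c | c. c \<noteq> 0}"

definition PGL :: "('f::field ^ 'n ^ 'n) set monoid" where
  "PGL = GL Mod scalar_matrices"

lemma group_GL: "group (GL :: ('f::field ^ 'n ^ 'n) monoid)"
proof (rule groupI)
  fix A :: "'f ^ 'n ^ 'n" assume "A \<in> carrier GL"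
  then show "\<exists>B \<in> carrier GL. B \<otimes>\<^bsub>GL\<^esub> A = \<one>\<^bsub>GL\<^esub>"
    unfolding GL_def invertible_def by auto
qed (auto simp: GL_def matrix_mul_assoc matrix_mul_lid invertible_mult
    intro: exI[of _ "mat 1"] simp: invertible_def[of "mat 1"])

lemma scalar_matrices_normal_GL:
  "(scalar_matrices :: ('f::field ^ 'n ^ 'n) set) \<lhd> GL"
proof -
  have mm: "mat c ** A = (\<chi> i j. c * A $ i $ j)" "A ** mat c = (\<chi> i j. A $ i $ j * c)"
    for c and A :: "'f ^ 'n ^ 'n"
    by (simp_all add: matrix_matrix_mult_def mat_def vec_eq_iff if_distrib if_distribR cong: if_cong)
  have mult: "mat c ** mat d = (mat (c * d) :: 'f ^ 'n ^ 'n)" for c d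
    unfolding mm(1) by (simp add: mat_def vec_eq_iff)
  have comm: "mat c ** A = A ** mat c" for c and A :: "'f ^ 'n ^ 'n"
    by (simp add: mm mult.commute)
  interpret group "GL :: ('f ^ 'n ^ 'n) monoid" by (rule group_GL)
  have inGL: "mat c \<in> carrier (GL :: ('f ^ 'n ^ 'n) monoid)" if "c \<noteq> 0" for c
    using that by (auto simp: GL_def invertible_def mult intro!: exI[of _ "mat (inverse c)"])
  have sub: "subgroup (scalar_matrices :: ('f ^ 'n ^ 'n) set) GL"
  proof (rule subgroupI)
    fix A :: "'f ^ 'n ^ 'n" assume "A \<in> scalar_matrices"
    then obtain c where c: "c \<noteq> 0" "A = mat c" by (auto simp: scalar_matrices_def)
    have "inv\<^bsub>GL\<^esub> A = mat (inverse c)"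
      using c inGL by (intro inv_equality) (auto simp: GL_def mult)
    with c show "inv\<^bsub>GL\<^esub> A \<in> scalar_matrices"
      by (auto simp: scalar_matrices_def)
  next
    fix A B :: "'f ^ 'n ^ 'n" assume "A \<in> scalar_matrices" "B \<in> scalar_matrices"
    then show "A \<otimes>\<^bsub>GL\<^esub> B \<in> scalar_matrices"
      by (auto simp: scalar_matrices_def GL_def mult)
  qed (use inGL in \<open>auto simp: scalar_matrices_def intro: exI[of _ 1]\<close>)
  show ?thesis
    by (rule normalI[OF sub])
      (auto simp: r_coset_def l_coset_def scalar_matrices_def GL_def comm)
qed

definition internal_direct_product ::
    "('a, 'b) monoid_scheme \<Rightarrow> 'a set \<Rightarrow> 'a set \<Rightarrow> bool" where
  "internal_direct_product G H K \<longleftrightarrow>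
     H \<lhd> G \<and> K \<lhd> G \<and> H <#>\<^bsub>G\<^esub> K = carrier G \<and> H \<inter> K = {\<one>\<^bsub>G\<^esub>}"

end

theory Submission
  imports Defs "HOL-Algebra.Multiplicative_Group" "HOL-Algebra.Sylow" "HOL-Computational_Algebra.Polynomial"
begin

text \<open>
  In GL(2,q) a noncentral matrix with \<open>k\<close> eigenvalues has an abelian centralizer of order
  \<open>(q - 1) (q + 1 - k)\<close>. The graph isomorphism transports the counts of these commuting classes to
  \<open>G\<close>, and divisibility of \<open>card G\<close> by the centralizer orders forces the center to have order \<open>q - 1\<close>.
  The \<open>q + 1\<close> centralizers of order \<open>q (q - 1)\<close> are the points of a projective line on which
  \<open>G\<close> acts by conjugation: their Sylow \<open>p\<close>-subgroups act regularly on the other points, so modulo the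
  center \<open>G\<close> is sharply 3-transitive, and the stabilizer \<open>K\<close> of two points is abelian.
  Hence a Sylow \<open>p\<close>-subgroup with the conjugation action of \<open>K\<close> is a field of order \<open>q\<close>, the
  action on the points is that of PGL(2,q), and \<open>G\<close> modulo its center is PGL(2,q). Every unipotent
  element of PGL(2,q) has a unique lift to \<open>G\<close> of \<open>p\<close>-power order; as \<open>K\<close> is abelian,
  these lifts satisfy the relations of SL(2,q) in its Bruhat normal form, which embeds SL(2,q) in \<open>G\<close>.
  The image is normal with abelian quotient and consists of products of commutators, so it is the derived subgroup.
\<close>

section \<open>Uniqueness of finite fields\<close>

text \<open>The central quotient and the order of the center do not determine G: for odd q, the
  product of PGL(2,q) with a cyclic group of order q - 1 agrees with GL(2,q) in both, but its
  derived subgroup is PSL(2,q). What tells the two apart is that commuting is transitive through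
  noncentral elements (\<open>comm_trans\<close>), a property that the graph does see. It is
  decisive twice: it makes the full preimage \<open>K\<close> of the torus abelian, not just its
  image modulo the center, and in \<open>h_minus_one\<close> it keeps the lifted copy of SL(2,q)
  from collapsing to PSL(2,q). The lifts exist without choices because the center has order q - 1,
  prime to p: a relation between p-elements that holds modulo the center holds exactly. The field
  found inside G has a subset of G as carrier, while the matrices have entries in the type
  \<open>'f\<close>; both have order q, and the uniqueness of finite fields is what joins
  them.\<close>

lemma monic_division:
  fixes \<mu> :: "'a::comm_ring_1 poly"
  assumes "lead_coeff \<mu> = 1"
  shows "\<exists>h r. f = \<mu> * h + r \<and> (r = 0 \<or> degree r < degree \<mu>)"
proof (induction "degree f" arbitrary: f rule: less_induct)
  case less
  show ?case
  proof (cases "f = 0 \<or> degree f < degree \<mu>")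
    case True
    then show ?thesis by (intro exI[of _ 0] exI[of _ f]) auto
  next
    case False
    define m where "m = monom (lead_coeff f) (degree f - degree \<mu>)"
    define g where "g = f - \<mu> * m"
    have \<mu>: "\<mu> \<noteq> 0" using assms by auto
    have deg: "degree (\<mu> * m) \<le> degree f"
      using False degree_mult_le[of \<mu> m] degree_monom_le[of "lead_coeff f" "degree f - degree \<mu>"]
      unfolding m_def by linarith
    have cf: "coeff (\<mu> * m) (degree f) = lead_coeff f"
      using False assms unfolding m_def by (simp add: mult.commute[of \<mu>] coeff_monom_mult)
    show ?thesis
    \<comment> \<open>Removing the leading term lowers the degree only if it was positive; in degree
      0 the divisor is 1 itself.\<close>
    proof (cases "degree f = 0")
      case True
      then have "degree \<mu> = 0" using False by simp
      then have "\<mu> = 1" using assms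
        by (metis degree_0_id one_pCons lead_coeff_pCons(2) pCons_0_0 degree_eq_zeroE coeff_pCons_0)
      then show ?thesis by (intro exI[of _ f] exI[of _ 0]) auto
    next
      case pos: False
      have "degree g < degree f"
      proof (rule ccontr)
        assume "\<not> ?thesis"
        moreover have "degree g \<le> degree f" unfolding g_def using deg by (intro degree_diff_le) auto
        ultimately have "degree g = degree f" by simp
        then have "lead_coeff g = 0" unfolding g_def using cf by simp
        then have "g = 0" by simp
        then show False using \<open>degree g = degree f\<close> pos by simp
      qed
      from less[OF this] obtain h r where "g = \<mu> * h + r" "r = 0 \<or> degree r < degree \<mu>" by blast
      then have "f = \<mu> * (h + m) + r" by (simp add: g_def algebra_simps)
      then show ?thesis using \<open>r = 0 \<or> degree r < degree \<mu>\<close> by blast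
    qed
  qed
qed

text \<open>The ring lives on a carrier set, the field to compare it with is a type. Integer
  polynomials map to both, so they serve as a common source.\<close>

lemma (in cring) int_poly_evaluation:
  assumes g: "g \<in> carrier R"
  obtains ev :: "int poly \<Rightarrow> 'a" where
    "\<And>f. ev f \<in> carrier R" "\<And>f h. ev (f + h) = ev f \<oplus> ev h"
    "\<And>f h. ev (f * h) = ev f \<otimes> ev h" "ev 1 = \<one>" "ev [:0, 1:] = g"
    "\<And>c. ev [:c:] = [c] \<cdot> \<one>"
proof -
  define ev where "ev f = fold_coeffs (\<lambda>c a. [c] \<cdot> \<one> \<oplus> g \<otimes> a) f \<zero>"
    for f :: "int poly"
  have cl0: "[c] \<cdot> \<one> \<in> carrier R" for c :: int by (rule add.int_pow_closed) simp
  have ev0: "ev 0 = \<zero>" by (simp add: ev_def)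
  have c0: "[(0::int)] \<cdot> \<one> = \<zero>" by (simp add: add_pow_int_ge)
  have ev_pCons: "ev (pCons c f) = [c] \<cdot> \<one> \<oplus> g \<otimes> ev f" for c f
  proof (cases "c = 0 \<and> f = 0")
    case True then show ?thesis using g by (simp add: ev0 c0)
  qed (auto simp: ev_def)
  have cl: "ev f \<in> carrier R" for f
    by (induction f) (use g cl0 in \<open>auto simp: ev0 ev_pCons\<close>)
  have add: "ev (f + h) = ev f \<oplus> ev h" for f h
  proof (induction f arbitrary: h)
    case 0 then show ?case using cl by (simp add: ev0)
  next
    case (pCons a f)
    show ?case
    proof (cases h)
      case (pCons b h')
      have "ev (pCons a f + h) = ([a] \<cdot> \<one> \<oplus> [b] \<cdot> \<one>) \<oplus> g \<otimes> (ev f \<oplus> ev h')"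
        by (simp add: pCons ev_pCons pCons.IH add.int_pow_mult)
      then show ?thesis using cl cl0 g by (simp add: pCons ev_pCons r_distr a_ac)
    qed
  qed
  have smult: "ev (smult c f) = [c] \<cdot> \<one> \<otimes> ev f" for c f
  proof (induction f)
    case 0 then show ?case using cl0 by (simp add: ev0)
  next
    case (pCons a f)
    have "[(c * a)] \<cdot> \<one> = [c] \<cdot> \<one> \<otimes> ([a] \<cdot> \<one>)"
      using cl0 by (simp add: add_pow_ldistr_int add.int_pow_pow mult.commute)
    then show ?case using cl cl0 g by (simp add: ev_pCons pCons.IH r_distr m_ac)
  qed
  have mult: "ev (f * h) = ev f \<otimes> ev h" for f h
  proof (induction f)
    case 0 then show ?case using cl by (simp add: ev0)
  next
    case (pCons a f)
    then show ?case using cl cl0 g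
      by (simp add: ev_pCons add smult c0 l_distr m_assoc)
  qed
  have c1: "[(1::int)] \<cdot> \<one> = \<one>" by (simp add: add_pow_int_ge)
  have const: "ev [:c:] = [c] \<cdot> \<one>" for c using g cl0 by (simp add: ev_pCons ev0)
  show ?thesis
  proof (rule that[OF cl add mult _ _ const])
    show "ev 1 = \<one>" using const[of 1] c1 by (simp add: one_pCons)
    show "ev [:0, 1:] = g" using g by (simp add: ev_pCons ev0 c0 c1)
  qed
qed


text \<open>A generator \<open>g\<close> of the multiplicative group makes evaluation at
  \<open>g\<close> surjective. Modulo p, the least monic annihilator \<open>\<mu>\<close> of
  \<open>g\<close> divides X^q - X, which vanishes on all of \<open>'f\<close>, so
  \<open>\<mu>\<close> has a root \<open>\<beta>\<close> there. Evaluation at \<open>\<beta>\<close>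
  factors through evaluation at \<open>g\<close>; the induced map is injective because
  \<open>R\<close> is a field, and bijective by counting.\<close>

lemma finite_field_unique:
  fixes R (structure) and p n :: nat
  assumes "field R" and fin: "finite (carrier R)" and "prime p"
    and cardR: "card (carrier R) = p ^ n" and cardf: "CARD('f::{field,finite}) = p ^ n"
  obtains \<phi> :: "'a \<Rightarrow> 'f::{field,finite}" where "bij_betw \<phi> (carrier R) UNIV"
    "\<And>x y. x \<in> carrier R \<Longrightarrow> y \<in> carrier R \<Longrightarrow> \<phi> (x \<oplus> y) = \<phi> x + \<phi> y"
    "\<And>x y. x \<in> carrier R \<Longrightarrow> y \<in> carrier R \<Longrightarrow> \<phi> (x \<otimes> y) = \<phi> x * \<phi> y"
proof -
  interpret field R by fact
  let ?q = "p ^ n"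
  have q2: "?q \<ge> 2"
  proof -
    have "card {0, 1 :: 'f} \<le> CARD('f)" by (rule card_mono) auto
    then show ?thesis using cardf by simp
  qed
  obtain g where g: "g \<in> carrier (mult_of R)"
    and gen: "carrier (mult_of R) = {g [^] i | i::nat. i \<in> UNIV}"
    using finite_field_mult_group_has_gen[OF fin] by blast
  have gR: "g \<in> carrier R" using g by simp
  obtain ev :: "int poly \<Rightarrow> 'a" where cl: "\<And>f. ev f \<in> carrier R"
    and add: "\<And>f h. ev (f + h) = ev f \<oplus> ev h" and mult: "\<And>f h. ev (f * h) = ev f \<otimes> ev h"
    and one: "ev 1 = \<one>" and X: "ev [:0, 1:] = g" and const: "\<And>c. ev [:c:] = [c] \<cdot> \<one>"
    using int_poly_evaluation[OF gR] by metis
  have zero: "ev 0 = \<zero>" using add[of 0 0] cl[of 0] by (simp add: add.r_cancel_one')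
  have diff: "ev (f - h) = \<zero> \<longleftrightarrow> ev f = ev h" for f h
    using add[of "f - h" h] cl by (metis diff_add_cancel l_zero add.r_cancel_one)
  have powX: "ev ([:0, 1:] ^ i) = g [^] i" for i
  proof (induction i)
    case (Suc i) then show ?case by (simp add: mult X del: mult_pCons_left) (metis gR m_comm nat_pow_closed)
  qed (simp add: one)
  have surj: "\<exists>f. ev f = x" if x: "x \<in> carrier R" for x
  proof (cases "x = \<zero>")
    case False
    then have "x \<in> carrier (mult_of R)" using x by simp
    then obtain i :: nat where "x = g [^] i" using gen by blast
    then show ?thesis using powX by metis
  qed (use zero in blast)
  \<comment> \<open>By Lagrange q kills the additive group, and without zero divisors so does its
    prime factor p.\<close>
  have p0: "ev [:int p:] = \<zero>"
  proof -
    have "[Coset.order (add_monoid R)] \<cdot> \<one> = \<zero>"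
      using add.pow_order_eq_1[of \<one>] by simp
    then have "[int ?q] \<cdot> \<one> = \<zero>" using cardR
      by (simp add: add_pow_int_ge Coset.order_def nat_power_eq)
    then have q0: "ev [:int ?q:] = \<zero>" by (simp only: const)
    have "ev [:int (p ^ k):] = \<zero> \<Longrightarrow> ev [:int p:] = \<zero>" for k
    proof (induction k)
      case 0 then show ?case using one by (simp add: one_pCons)
    next
      case (Suc k)
      have "ev [:int (p ^ Suc k):] = ev [:int p:] \<otimes> ev [:int (p ^ k):]"
        unfolding mult[symmetric] by (simp add: mult.commute)
      then show ?case using Suc cl integral by metis
    qed
    then show ?thesis using q0 by blast
  qed
  have pdvd: "ev f = \<zero>" if "\<And>i. int p dvd coeff f i" for f
  proof -
    have "f = [:int p:] * map_poly (\<lambda>c. c div int p) f"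
      using that by (simp add: poly_eq_iff coeff_map_poly)
    then have "ev f = ev [:int p:] \<otimes> ev (map_poly (\<lambda>c. c div int p) f)" by (metis mult)
    then show ?thesis using p0 cl by simp
  qed
  define T :: "int poly" where "T = [:0, 1:] ^ ?q - [:0, 1:]"
  have T: "lead_coeff T = 1" "degree T = ?q"
  proof -
    have T': "T = monom 1 ?q + (- monom 1 1)" by (simp add: T_def monom_altdef)
    have "degree (- monom 1 1 :: int poly) < degree (monom 1 ?q :: int poly)"
      using q2 by (simp add: degree_monom_eq)
    then show "degree T = ?q" unfolding T' by (subst degree_add_eq_left) (auto simp: degree_monom_eq)
    then show "lead_coeff T = 1" using q2 by (simp add: T')
  qed
  have evT: "ev T = \<zero>"
  proof -
    have "g [^] Coset.order (mult_of R) = \<one>"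
      using group.pow_order_eq_1[OF field_mult_group g] by (simp add: nat_pow_mult_of)
    then have "g [^] (?q - 1) = \<one>" using fin cardR by (simp add: order_mult_of Coset.order_def)
    then have "g [^] Suc (?q - 1) = g" using gR by simp
    moreover have "Suc (?q - 1) = ?q" using q2 by simp
    ultimately have "g [^] ?q = g" by metis
    then show ?thesis unfolding T_def diff powX X .
  qed
  obtain \<mu> where \<mu>: "lead_coeff \<mu> = 1" "ev \<mu> = \<zero>"
    and least: "\<And>f. lead_coeff f = 1 \<Longrightarrow> ev f = \<zero> \<Longrightarrow> degree \<mu> \<le> degree f"
    using ex_has_least_nat[of "\<lambda>f. lead_coeff f = 1 \<and> ev f = \<zero>" T degree] T(1) evT by blast
  \<comment> \<open>Otherwise \<open>r\<close>, cut off above its last coefficient prime to p and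
    made monic there, would be a monic annihilator of smaller degree than
    \<open>\<mu>\<close>.\<close>
  have small: "int p dvd coeff r i"
    if r: "ev r = \<zero>" "r = 0 \<or> degree r < degree \<mu>" for r i
  proof (rule ccontr)
    assume i: "\<not> ?thesis"
    define N where "N = (GREATEST i. \<not> int p dvd coeff r i)"
    have bound: "\<And>i. \<not> int p dvd coeff r i \<Longrightarrow> i \<le> degree r"
      by (metis le_degree dvd_0_right)
    have N: "\<not> int p dvd coeff r N" unfolding N_def
      using GreatestI_nat[of "\<lambda>i. \<not> int p dvd coeff r i" i "degree r"] i bound by blast
    have Nmax: "int p dvd coeff r j" if "N < j" for j
      using Greatest_le_nat[of "\<lambda>i. \<not> int p dvd coeff r i" j "degree r"] that bound
      unfolding N_def by force
    have "coprime (coeff r N) (int p)"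
      using N \<open>prime p\<close> by (metis coprime_commute prime_imp_coprime prime_nat_int_transfer)
    then obtain c l where l: "coeff r N * c + int p * l = 1"
      using bezout_int[of "coeff r N" "int p"] by (auto simp: mult.commute coprime_iff_gcd_eq_1)
    \<comment> \<open>\<open>s\<close> is \<open>c\<close> times \<open>r\<close> without the terms
      beyond \<open>N\<close>, its leading coefficient corrected to 1 by the Bezout relation. All
      corrections have coefficients divisible by p, so they evaluate to 0.\<close>
    define s where "s = [:c:] * r + ([:int p:] * monom l N - (\<Sum>j\<in>{N<..degree r}. [:c:] * monom (coeff r j) j))"
    have csum: "(\<Sum>k\<in>{N<..degree r}. c * (if k = j then coeff r k else 0))
        = (if j \<in> {N<..degree r} then c * coeff r j else 0)" for j
      by (simp add: if_distrib cong: if_cong)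
    have cs: "coeff s j = (if j < N then c * coeff r j else if j = N then 1 else 0)" for j
      using l coeff_eq_0[of r j]
      by (auto simp: s_def coeff_sum coeff_monom csum algebra_simps not_less)
    have "degree s = N"
      by (rule antisym, rule degree_le) (auto simp: cs intro: le_degree)
    have "ev ([:int p:] * monom l N - (\<Sum>j\<in>{N<..degree r}. [:c:] * monom (coeff r j) j)) = \<zero>"
    proof (rule pdvd)
      fix j
      show "int p dvd coeff ([:int p:] * monom l N - (\<Sum>j\<in>{N<..degree r}. [:c:] * monom (coeff r j) j)) j"
        using Nmax[of j] by (auto simp: coeff_sum coeff_monom csum intro!: dvd_diff dvd_mult)
    qed
    then have "ev s = \<zero>" unfolding s_def add mult using r(1) cl by simp
    moreover have "lead_coeff s = 1" using \<open>degree s = N\<close> cs by simp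
    ultimately have "degree \<mu> \<le> N" using least \<open>degree s = N\<close> by metis
    then show False using r(2) bound[OF N] N by auto
  qed
  have of_p: "of_int (int p) = (0::'f)"
  proof -
    \<comment> \<open>Translation by 1 permutes the field, so adding 1 to each of the q summands
      leaves the sum unchanged.\<close>
    have "(\<Sum>y\<in>(UNIV :: 'f set). y + 1) = (\<Sum>y\<in>UNIV. y)"
      by (rule sum.reindex_bij_witness[of _ "\<lambda>y. y - 1" "\<lambda>y. y + 1"]) auto
    then have "(of_nat ?q :: 'f) = 0" using cardf by (simp add: sum.distrib)
    then show ?thesis by simp
  qed
  define M :: "int poly \<Rightarrow> 'f poly" where "M = map_poly of_int"
  have cM: "coeff (M f) i = of_int (coeff f i)" for f i by (simp add: M_def coeff_map_poly)
  have M: "M (f + h) = M f + M h" "M (f * h) = M f * M h" "M (f - h) = M f - M h" "M 1 = 1" for f h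
    by (simp_all add: poly_eq_iff cM coeff_mult coeff_1)
  have MX: "M [:0, 1:] = [:0, 1:]" by (simp add: M_def map_poly_pCons)
  have M0: "M r = 0" if "ev r = \<zero>" "r = 0 \<or> degree r < degree \<mu>" for r
    unfolding poly_eq_iff cM using small[OF that] of_p by (metis coeff_0 dvdE mult_zero_left of_int_mult)
  have MT: "poly (M T) \<beta> = 0" for \<beta>
  proof -
    have "M ([:0, 1:] ^ k) = [:0, 1:] ^ k" for k by (induction k) (simp_all only: power_0 power_Suc M MX)
    then have "poly (M T) \<beta> = \<beta> ^ CARD('f) - \<beta>" by (simp add: T_def M MX cardf poly_power)
    moreover have "\<beta> ^ CARD('f) = \<beta>"
    proof (cases "\<beta> = 0")
      case True then show ?thesis by simp
    next
      case False
      have "(\<Prod>y\<in>UNIV-{0}. \<beta> * y) = \<beta> ^ (CARD('f) - 1) * \<Prod>(UNIV-{0})"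
        by (simp add: prod.distrib)
      moreover have "(\<Prod>y\<in>UNIV-{0}. \<beta> * y) = \<Prod>(UNIV-{0})"
        by (rule prod.reindex_bij_witness[of _ "\<lambda>y. y / \<beta>" "\<lambda>y. \<beta> * y"]) (use False in auto)
      ultimately have "\<beta> ^ (CARD('f) - 1) = 1" by simp
      then have "\<beta> ^ Suc (CARD('f) - 1) = \<beta>" by (metis power_Suc mult.right_neutral)
      moreover have "Suc (CARD('f) - 1) = CARD('f)" using q2 cardf by simp
      ultimately show ?thesis by metis
    qed
    ultimately show ?thesis by simp
  qed
  obtain h r where hr: "T = \<mu> * h + r" "r = 0 \<or> degree r < degree \<mu>"
    using monic_division[OF \<mu>(1)] by blast
  have "ev r = \<zero>"
  proof -
    have "ev T = \<zero> \<oplus> ev r" using hr(1) cl \<mu>(2) by (simp add: add mult)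
    then show ?thesis using evT cl by simp
  qed
  then have MT': "M T = M \<mu> * M h" using hr M0 by (simp add: M)
  have "\<exists>\<beta>. poly (M \<mu>) \<beta> = 0"
  proof (rule ccontr)
    assume "\<not> ?thesis"
    \<comment> \<open>The cofactor \<open>h\<close> would have all q field elements as roots, but it
      is monic of degree q - \<open>degree \<mu>\<close>, less than q.\<close>
    then have "poly (M h) \<beta> = 0" for \<beta> using MT[of \<beta>] MT' by auto
    then have all: "{\<beta>. poly (M h) \<beta> = 0} = UNIV" by auto
    have "degree \<mu> \<noteq> 0"
    proof
      assume "degree \<mu> = 0"
      then obtain a where "\<mu> = [:a:]" by (rule degree_eq_zeroE)
      then have "\<mu> = 1" using \<mu>(1) by (simp add: one_pCons)
      then show False using \<mu>(2) one by simp
    qed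
    have "degree \<mu> \<le> ?q" using least[OF T(1) evT] T(2) by simp
    then have *: "degree (- r) < degree T \<or> - r = 0" using hr(2) T by auto
    have Th: "\<mu> * h = T + (- r)" using hr(1) by simp
    have deg: "degree (\<mu> * h) = ?q" unfolding Th
      using * T degree_add_eq_left[of "- r" T] by auto
    moreover have "lead_coeff (\<mu> * h) = 1" using * T unfolding deg unfolding Th
      by (auto simp: coeff_eq_0)
    ultimately
    have h: "lead_coeff h = 1" "degree \<mu> + degree h = ?q"
      using \<mu>(1) degree_mult_eq[of \<mu> h] lead_coeff_mult[of \<mu> h] by (cases "\<mu> * h = 0"; auto)+
    then have nz: "M h \<noteq> 0" using cM[of h "degree h"] by auto
    have "degree (M h) \<le> degree h" by (rule degree_le) (simp add: cM coeff_eq_0)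
    then have "CARD('f) \<le> degree h" using card_poly_roots_bound[OF nz] all by simp
    then show False using h(2) \<open>degree \<mu> \<noteq> 0\<close> cardf by simp
  qed
  then obtain \<beta> where \<beta>: "poly (M \<mu>) \<beta> = 0" by blast
  define E where "E f = poly (M f) \<beta>" for f
  have E: "E (f + h) = E f + E h" "E (f * h) = E f * E h" "E (f - h) = E f - E h" "E 1 = 1" for f h
    by (simp_all add: E_def M)
  have E0: "E f = 0" if "ev f = \<zero>" for f
  proof -
    obtain h r where hr: "f = \<mu> * h + r" "r = 0 \<or> degree r < degree \<mu>"
      using monic_division[OF \<mu>(1)] by blast
    have "ev f = \<zero> \<oplus> ev r" using hr(1) cl \<mu>(2) by (simp add: add mult)
    then have "M r = 0" using that cl M0 hr(2) by simp
    then show ?thesis using \<beta> by (simp add: E_def hr(1) M)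
  qed
  have wd: "E f = E h" if "ev f = ev h" for f h
    using E0[of "f - h"] that by (simp add: diff E)
  define \<phi> where "\<phi> x = E (SOME f. ev f = x)" for x
  have \<phi>: "\<phi> (ev f) = E f" for f
    unfolding \<phi>_def by (rule wd) (rule someI, rule refl)
  have inj: "inj_on \<phi> (carrier R)"
  proof (rule inj_onI)
    fix x y assume xy: "x \<in> carrier R" "y \<in> carrier R" "\<phi> x = \<phi> y"
    obtain f h where fh: "x = ev f" "y = ev h" using surj xy by metis
    have Eu: "E (f - h) = 0" using xy(3) by (simp add: fh \<phi> E)
    show "x = y"
    proof (rule ccontr)
      assume "x \<noteq> y"
      then have "ev (f - h) \<noteq> \<zero>" using fh by (simp add: diff)
      then obtain v where "ev (f - h) \<otimes> ev v = \<one>" using cl surj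
        by (metis field_Units DiffI Units_inv_closed Units_r_inv singletonD)
      then have "ev ((f - h) * v) = ev 1" by (simp add: mult one)
      then have "E (f - h) * E v = 1" using wd E by metis
      then show False using Eu by simp
    qed
  qed
  have bij: "bij_betw \<phi> (carrier R) UNIV"
    unfolding bij_betw_def
  proof
    show "\<phi> ` carrier R = UNIV"
      by (rule card_subset_eq) (use card_image[OF inj] cardR cardf in auto)
  qed fact
  show ?thesis
  proof (rule that[OF bij])
    fix x y assume "x \<in> carrier R" "y \<in> carrier R"
    then obtain f h where fh: "x = ev f" "y = ev h" using surj by metis
    show "\<phi> (x \<oplus> y) = \<phi> x + \<phi> y" "\<phi> (x \<otimes> y) = \<phi> x * \<phi> y"
      unfolding fh add[symmetric] mult[symmetric] \<phi> E by simp_all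
  qed
qed

section \<open>Commuting matrices in GL(2,q)\<close>

definition mat2 :: "'f \<Rightarrow> 'f \<Rightarrow> 'f \<Rightarrow> 'f \<Rightarrow> 'f ^ 2 ^ 2" where
  "mat2 a b c d = (\<chi> i j. if i = 1 then (if j = 1 then a else b) else (if j = 1 then c else d))"

lemma mat2_nth [simp]:
  "mat2 a b c d $ 1 $ 1 = a" "mat2 a b c d $ 1 $ 2 = b" "mat2 a b c d $ 2 $ 1 = c" "mat2 a b c d $ 2 $ 2 = d"
  by (simp_all add: mat2_def)

lemma mat2_eta: "mat2 (A $ 1 $ 1) (A $ 1 $ 2) (A $ 2 $ 1) (A $ 2 $ 2) = A"
  by (simp add: vec_eq_iff forall_2)

lemma mat2_cases: obtains a b c d where "A = mat2 a b c d"
  by (metis mat2_eta)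

lemma mat2_eq_iff [simp]: "mat2 a b c d = mat2 a' b' c' d' \<longleftrightarrow> a = a' \<and> b = b' \<and> c = c' \<and> d = d'"
  by (simp add: vec_eq_iff forall_2)

lemma mat2_mult [simp]:
  fixes a :: "'f::semiring_1"
  shows "mat2 a b c d ** mat2 a' b' c' d'
    = mat2 (a * a' + b * c') (a * b' + b * d') (c * a' + d * c') (c * b' + d * d')"
  by (simp add: vec_eq_iff forall_2 matrix_matrix_mult_def sum_2)

lemma det_mat2 [simp]: "det (mat2 a b c d) = a * d - b * (c :: 'f::comm_ring_1)"
  by (simp add: det_2)

lemma mat_eq_mat2: "(mat c :: 'f::zero ^ 2 ^ 2) = mat2 c 0 0 c"
  by (simp add: vec_eq_iff forall_2 mat_def)

lemma GL_simps [simp]: "mult GL = (**)" "one GL = mat 1" "A \<in> carrier GL \<longleftrightarrow> invertible A"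
  by (simp_all add: GL_def)

lemma invertible_mat2 [simp]: "invertible (mat2 a b c d) \<longleftrightarrow> a * d - b * c \<noteq> (0 :: 'f::field)"
  by (simp add: invertible_det_nz)

text \<open>The triple (b, c, a - d) describes a matrix modulo scalar matrices; the three equations
  say that the cross product of the two triples vanishes.\<close>

lemma mat2_commute_iff:
  fixes a :: "'f::field"
  shows "mat2 a b c d ** mat2 a' b' c' d' = mat2 a' b' c' d' ** mat2 a b c d \<longleftrightarrow>
    b * c' = b' * c \<and> (a - d) * b' = (a' - d') * b \<and> (a - d) * c' = (a' - d') * c"
  by (simp add: algebra_simps) (auto simp: algebra_simps)

lemma center_GL: "group_center (GL :: ('f::field ^ 2 ^ 2) monoid) = scalar_matrices"
proof (intro equalityI subsetI)
  fix A :: "'f ^ 2 ^ 2" assume A: "A \<in> group_center GL"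
  obtain a b c d where [simp]: "A = mat2 a b c d" by (rule mat2_cases)
  have comm: "A ** B = B ** A" if "invertible B" for B :: "'f ^ 2 ^ 2"
    using A that by (simp add: group_center_def)
  have "b = 0" "c = 0" "a = d"
    using comm[of "mat2 1 1 0 1"] comm[of "mat2 1 0 1 1"] by simp_all
  moreover have "a * d - b * c \<noteq> 0" using A by (simp add: group_center_def)
  ultimately show "A \<in> scalar_matrices" by (auto simp: scalar_matrices_def mat_eq_mat2)
next
  fix A :: "'f ^ 2 ^ 2" assume "A \<in> scalar_matrices"
  then obtain s where "s \<noteq> 0" "A = mat2 s 0 0 s" by (auto simp: scalar_matrices_def mat_eq_mat2)
  then show "A \<in> group_center GL"
  proof -
    assume s: "s \<noteq> 0" "A = mat2 s 0 0 s"
    have "A ** B = B ** A" for B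
      by (rule mat2_cases[of B]) (simp only: s mat2_commute_iff diff_self mult_zero_left mult_zero_right)
    moreover have "invertible A" using s by simp
    ultimately show ?thesis by (simp add: group_center_def)
  qed
qed

lemma card_scalar_matrices:
  "card (scalar_matrices :: ('f::{field,finite} ^ 2 ^ 2) set) = CARD('f) - 1"
proof -
  have sm: "scalar_matrices = (\<lambda>c. mat2 c 0 0 c :: 'f ^ 2 ^ 2) ` (UNIV - {0})"
    by (auto simp: scalar_matrices_def mat_eq_mat2)
  moreover have "inj_on (\<lambda>c. mat2 c 0 0 c :: 'f ^ 2 ^ 2) (UNIV - {0})" by (auto simp: inj_on_def)
  moreover have "card (UNIV - {0 :: 'f}) = CARD('f) - 1" by (rule card_Diff_singleton) simp
  ultimately show ?thesis unfolding sm by (simp only: card_image)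
qed

text \<open>The first row is any nonzero vector, the second any vector off the line that it
  spans.\<close>

lemma card_GL2:
  "card (carrier (GL :: ('f::{field,finite} ^ 2 ^ 2) monoid)) = (CARD('f)^2 - 1) * (CARD('f)^2 - CARD('f))"
proof -
  let ?q = "CARD('f)"
  define row where "row = (\<lambda>(a::'f, b::'f). {(c, d). a * d - b * c \<noteq> 0})"
  define T where "T = (SIGMA r : (UNIV :: ('f \<times> 'f) set) - {(0, 0)}. row r)"
  have row: "card (row r) = ?q^2 - ?q" if r: "r \<noteq> (0, 0)" for r
  proof -
    obtain a b where ab: "r = (a, b)" by force
    have "{(c, d). a * d - b * c = 0} = (\<lambda>t. (t * a, t * b)) ` UNIV"
    proof (intro equalityI subsetI)
      fix p assume "p \<in> {(c, d). a * d - b * c = 0}"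
      then obtain c d where p: "p = (c, d)" "a * d = b * c" by auto
      show "p \<in> (\<lambda>t. (t * a, t * b)) ` UNIV"
      proof (cases "a = 0")
        case True
        then show ?thesis using p r ab by (intro image_eqI[of _ _ "d / b"]) auto
      next
        case False
        then show ?thesis using p by (intro image_eqI[of _ _ "c / a"]) (auto simp: field_simps)
      qed
    qed (auto simp: algebra_simps)
    moreover have "inj (\<lambda>t. (t * a, t * b))" using r ab by (auto simp: inj_on_def)
    ultimately have "card {(c, d). a * d - b * c = 0} = ?q" by (simp add: card_image)
    moreover have "row r = UNIV - {(c, d). a * d - b * c = 0}" by (auto simp: row_def ab)
    moreover have "card ((UNIV :: ('f \<times> 'f) set) - {(c, d). a * d - b * c = 0}) = CARD('f \<times> 'f) - card {(c, d). a * d - b * c = 0}"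
      by (rule card_Diff_subset) auto
    ultimately show ?thesis by (simp add: power2_eq_square)
  qed
  have "carrier GL = (\<lambda>((a, b), (c, d)). mat2 a b c d) ` T"
  proof (intro equalityI subsetI)
    fix A :: "'f ^ 2 ^ 2" assume A: "A \<in> carrier GL"
    obtain a b c d where [simp]: "A = mat2 a b c d" by (rule mat2_cases)
    show "A \<in> (\<lambda>((a, b), (c, d)). mat2 a b c d) ` T"
      using A by (intro image_eqI[of _ _ "((a, b), (c, d))"]) (auto simp: T_def row_def)
  qed (auto simp: T_def row_def)
  moreover have "inj_on (\<lambda>((a, b), (c, d)). mat2 a b c d) T" by (auto simp: inj_on_def)
  ultimately have "card (carrier (GL :: ('f ^ 2 ^ 2) monoid)) = card T" by (simp add: card_image)
  also have "\<dots> = (\<Sum>r\<in>(UNIV :: ('f \<times> 'f) set) - {(0, 0)}. ?q^2 - ?q)" unfolding T_def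
    using row by simp
  also have "\<dots> = card ((UNIV :: ('f \<times> 'f) set) - {(0, 0)}) * (?q^2 - ?q)" by simp
  also have "card ((UNIV :: ('f \<times> 'f) set) - {(0, 0)}) = ?q^2 - 1"
    by (subst card_Diff_singleton) (simp_all add: power2_eq_square)
  finally show ?thesis .
qed

section \<open>Commuting classes and eigenvalues\<close>

abbreviation noncentral :: "('a, 'b) monoid_scheme \<Rightarrow> 'a set" where
  "noncentral G \<equiv> carrier G - group_center G"

text \<open>This is the complement of the neighbourhood of \<open>x\<close> in the noncommuting
  graph, so its size is a graph invariant, which the order of the centralizer is not a
  priori.\<close>

definition comm_class :: "('a, 'b) monoid_scheme \<Rightarrow> 'a \<Rightarrow> 'a set" where
  "comm_class G x = {y \<in> noncentral G. x \<otimes>\<^bsub>G\<^esub> y = y \<otimes>\<^bsub>G\<^esub> x}"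

definition eigenvalues :: "'f::field ^ 2 ^ 2 \<Rightarrow> 'f set" where
  "eigenvalues A = {\<kappa>. (A $ 1 $ 1 - \<kappa>) * (A $ 2 $ 2 - \<kappa>) - A $ 1 $ 2 * A $ 2 $ 1 = 0}"

lemma noncentral_GL_mat2:
  "mat2 a b c d \<in> noncentral GL \<longleftrightarrow> a * d - b * c \<noteq> (0 :: 'f::field) \<and> \<not> (b = 0 \<and> c = 0 \<and> a = d)"
  unfolding center_GL by (auto simp: scalar_matrices_def mat_eq_mat2)

text \<open>Triples with vanishing cross product are parallel: the second matrix is
  \<open>\<beta>\<close> times the first plus a scalar matrix, with \<open>\<beta> = 0\<close> if it
  is itself scalar.\<close>

lemma commuting_mat2_multiple:
  fixes a :: "'f::field"
  assumes "\<not> (b = 0 \<and> c = 0 \<and> a = d)"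
    and cm: "mat2 a b c d ** mat2 a' b' c' d' = mat2 a' b' c' d' ** mat2 a b c d"
  obtains \<beta> where "b' = \<beta> * b" "c' = \<beta> * c" "a' - d' = \<beta> * (a - d)"
proof -
  note cm = cm[unfolded mat2_commute_iff]
  consider "b \<noteq> 0" | "b = 0" "c \<noteq> 0" | "b = 0" "c = 0" "a - d \<noteq> 0" using assms(1) by auto
  then show ?thesis
  proof cases
    case 1 then show ?thesis using cm by (intro that[of "b' / b"]) (auto simp: field_simps)
  next
    case 2 then show ?thesis using cm by (intro that[of "c' / c"]) (auto simp: field_simps)
  next
    case 3 then show ?thesis using cm by (intro that[of "(a' - d') / (a - d)"]) (auto simp: field_simps)
  qed
qed

text \<open>Modulo scalars both \<open>A\<close> and \<open>C\<close> are multiples of the nonscalar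
  \<open>B\<close>, hence parallel to each other.\<close>

lemma GL2_commute_trans:
  fixes A B C :: "'f::field ^ 2 ^ 2"
  assumes "A ** B = B ** A" "B ** C = C ** B" "B \<in> noncentral GL"
  shows "A ** C = C ** A"
proof -
  obtain a b c d where A: "A = mat2 a b c d" by (rule mat2_cases)
  obtain a' b' c' d' where B: "B = mat2 a' b' c' d'" by (rule mat2_cases)
  obtain a'' b'' c'' d'' where C: "C = mat2 a'' b'' c'' d''" by (rule mat2_cases)
  have nc: "\<not> (b' = 0 \<and> c' = 0 \<and> a' = d')" using assms(3) unfolding B noncentral_GL_mat2 by blast
  obtain k where k: "b = k * b'" "c = k * c'" "a - d = k * (a' - d')"
    using commuting_mat2_multiple[OF nc assms(1)[symmetric, unfolded A B]] .
  obtain l where l: "b'' = l * b'" "c'' = l * c'" "a'' - d'' = l * (a' - d')"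
    using commuting_mat2_multiple[OF nc assms(2)[unfolded B C]] .
  show ?thesis unfolding A C mat2_commute_iff k l by (simp add: mult_ac)
qed

text \<open>What commutes with \<open>A\<close> and is not scalar has the form \<beta> (A -
  \<kappa>) with \<beta> nonzero; it is invertible exactly if \<kappa> is no eigenvalue, and
  \<beta>, \<kappa> are unique because \<open>A\<close> is not scalar.\<close>

lemma card_comm_class_GL2:
  fixes A :: "'f::{field,finite} ^ 2 ^ 2"
  assumes "A \<in> noncentral GL"
  shows "card (comm_class GL A) = (CARD('f) - 1) * (CARD('f) - card (eigenvalues A))"
proof -
  obtain a b c d where [simp]: "A = mat2 a b c d" by (rule mat2_cases)
  have nc: "\<not> (b = 0 \<and> c = 0 \<and> a = d)" using assms
    unfolding \<open>A = _\<close> noncentral_GL_mat2 by simp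
  define F where "F = (\<lambda>(\<beta>, \<kappa>). mat2 (\<beta> * (a - \<kappa>)) (\<beta> * b) (\<beta> * c) (\<beta> * (d - \<kappa>)))"
  have "comm_class GL A = F ` ((UNIV - {0}) \<times> (UNIV - eigenvalues A))"
  proof (intro equalityI subsetI)
    fix B assume B: "B \<in> comm_class GL A"
    obtain a' b' c' d' where [simp]: "B = mat2 a' b' c' d'" by (rule mat2_cases)
    have nz: "a' * d' - b' * c' \<noteq> 0" "\<not> (b' = 0 \<and> c' = 0 \<and> a' = d')"
      and cm: "mat2 a b c d ** mat2 a' b' c' d' = mat2 a' b' c' d' ** mat2 a b c d"
      using B unfolding comm_class_def \<open>B = _\<close> \<open>A = _\<close> mem_Collect_eq noncentral_GL_mat2 GL_simps
      by blast+
    obtain \<beta> where \<beta>: "b' = \<beta> * b" "c' = \<beta> * c" "a' - d' = \<beta> * (a - d)"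
      using commuting_mat2_multiple[OF nc cm] .
    have "\<beta> \<noteq> 0" using \<beta> nz(2) by auto
    define \<kappa> where "\<kappa> = a - a' / \<beta>"
    have a': "a' = \<beta> * (a - \<kappa>)" using \<open>\<beta> \<noteq> 0\<close> by (simp add: \<kappa>_def)
    have "d' = a' - \<beta> * (a - d)" by (simp flip: \<beta>(3))
    then have d': "d' = \<beta> * (d - \<kappa>)" by (simp add: a' algebra_simps)
    have "\<kappa> \<notin> eigenvalues A"
    proof
      assume "\<kappa> \<in> eigenvalues A"
      then have "(a - \<kappa>) * (d - \<kappa>) - b * c = 0" by (simp add: eigenvalues_def)
      then have "\<beta> * \<beta> * ((a - \<kappa>) * (d - \<kappa>) - b * c) = 0" by simp
      then show False using nz(1) unfolding a' d' \<beta>(1,2) by (simp add: algebra_simps)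
    qed
    then show "B \<in> F ` ((UNIV - {0}) \<times> (UNIV - eigenvalues A))"
      using \<open>\<beta> \<noteq> 0\<close> \<beta> a' d'
        by (intro image_eqI[of _ _ "(\<beta>, \<kappa>)"]) (auto simp: F_def)
  next
    fix B assume "B \<in> F ` ((UNIV - {0}) \<times> (UNIV - eigenvalues A))"
    then obtain \<beta> \<kappa> where \<beta>: "\<beta> \<noteq> 0" "\<kappa> \<notin> eigenvalues A"
      and B: "B = mat2 (\<beta> * (a - \<kappa>)) (\<beta> * b) (\<beta> * c) (\<beta> * (d - \<kappa>))"
        by (auto simp: F_def)
    have "(a - \<kappa>) * (d - \<kappa>) - b * c \<noteq> 0" using \<beta>(2) by (simp add: eigenvalues_def)
    then have "\<beta> * \<beta> * ((a - \<kappa>) * (d - \<kappa>) - b * c) \<noteq> 0" using \<beta>(1) by simp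
    then have 1: "\<beta> * (a - \<kappa>) * (\<beta> * (d - \<kappa>)) - \<beta> * b * (\<beta> * c) \<noteq> 0" by (simp add: algebra_simps)
    have 2: "\<not> (\<beta> * b = 0 \<and> \<beta> * c = 0 \<and> \<beta> * (a - \<kappa>) = \<beta> * (d - \<kappa>))" using nc \<beta>(1) by auto
    show "B \<in> comm_class GL A"
      unfolding comm_class_def B mem_Collect_eq noncentral_GL_mat2 GL_simps \<open>A = _\<close> mat2_commute_iff
      using 1 2 by (simp add: algebra_simps)
  qed
  moreover have "inj_on F ((UNIV - {0}) \<times> (UNIV - eigenvalues A))"
  proof (rule inj_onI)
    fix p p' assume p: "p \<in> (UNIV - {0}) \<times> (UNIV - eigenvalues A)"
      "p' \<in> (UNIV - {0}) \<times> (UNIV - eigenvalues A)" "F p = F p'"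
    obtain \<beta> \<kappa> \<beta>' \<kappa>' where pp: "p = (\<beta>, \<kappa>)" "p' = (\<beta>', \<kappa>')"
      by fastforce
    have nz: "\<beta> \<noteq> 0" "\<beta>' \<noteq> 0"
      and eq: "F (\<beta>, \<kappa>) = F (\<beta>', \<kappa>')" using p unfolding pp by auto
    have e: "\<beta> * (a - \<kappa>) = \<beta>' * (a - \<kappa>')" "\<beta> * b = \<beta>' * b" "\<beta> * c = \<beta>' * c" "\<beta> * (d - \<kappa>) = \<beta>' * (d - \<kappa>')"
      using eq by (simp_all add: F_def)
    have "\<beta> * (a - d) = \<beta> * (a - \<kappa>) - \<beta> * (d - \<kappa>)" by (simp add: algebra_simps)
    also have "\<dots> = \<beta>' * (a - d)" unfolding e(1,4) by (simp add: algebra_simps)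
    finally have "\<beta> * (a - d) = \<beta>' * (a - d)" .
    then have "\<beta> = \<beta>'" using e nc by auto
    then show "p = p'" using e(1) nz pp by simp
  qed
  ultimately show ?thesis by (simp add: card_image card_cartesian_product card_Diff_subset)
qed

lemma card_eigenvalues: "card (eigenvalues (A :: 'f::{field,finite} ^ 2 ^ 2)) \<le> 2"
proof -
  obtain a b c d where [simp]: "A = mat2 a b c d" by (rule mat2_cases)
  have "eigenvalues A = {x. poly [:a * d - b * c, - (a + d), 1:] x = 0}"
    by (auto simp: eigenvalues_def algebra_simps)
  then show ?thesis using card_poly_roots_bound[of "[:a * d - b * c, - (a + d), 1:]"] by simp
qed

text \<open>The map from pairs of roots to (sum, product) is symmetric, so on a finite set it is not
  surjective either. A missed pair gives a polynomial without roots, and its companion matrix is the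
  witness; the product is nonzero since every (s, 0) is hit by itself.\<close>

lemma ex_no_eigenvalues: "\<exists>A \<in> noncentral GL. eigenvalues (A :: 'f::{field,finite} ^ 2 ^ 2) = {}"
proof -
  define S where "S = (\<lambda>(s::'f, t::'f). (s + t, s * t))"
  have "\<not> inj S"
  proof
    assume "inj S"
    moreover have "S (0, 1) = S (1, 0)" by (simp add: S_def)
    ultimately have "(0::'f, 1::'f) = (1, 0)" by (rule injD)
    then show False by simp
  qed
  then have "\<not> surj S" using finite_UNIV_surj_inj[of S] finite by blast
  then obtain s t where st: "(s, t) \<notin> range S" by auto
  let ?A = "mat2 0 (- t) 1 s :: 'f ^ 2 ^ 2"
  have "t \<noteq> 0" using st by (force simp: S_def image_iff)
  have "eigenvalues ?A = {}"
  proof (rule ccontr)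
    assume "eigenvalues ?A \<noteq> {}"
    then obtain x where "(0 - x) * (s - x) + t = 0" by (auto simp: eigenvalues_def)
    then have "t = x * (s - x)" by (simp add: algebra_simps)
    then have "S (x, s - x) = (s, t)" by (simp add: S_def)
    then show False using st by (metis rangeI)
  qed
  moreover have "?A \<in> noncentral GL" unfolding noncentral_GL_mat2 using \<open>t \<noteq> 0\<close> by simp
  ultimately show ?thesis by blast
qed

text \<open>Such matrices are a nonzero scalar plus a nonzero nilpotent matrix, and the nilpotent
  matrices form the cone \<open>N\<close> with q^2 elements. This form works in every
  characteristic.\<close>

lemma card_one_eigenvalue:
  "card {A \<in> noncentral GL. card (eigenvalues (A :: 'f::{field,finite} ^ 2 ^ 2)) = 1}
    = (CARD('f) + 1) * (CARD('f) - 1)^2" (is "card ?S = _")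
proof -
  let ?q = "CARD('f)"
  define N where "N = {(x, y, z). x * x + y * z = (0::'f)}"
  have "N = (\<lambda>(x, y). (x, y, - (x * x / y))) ` (UNIV \<times> (UNIV - {0})) \<union> (\<lambda>z. (0, 0, z)) ` UNIV" (is "_ = ?X \<union> ?Y")
  proof (intro equalityI subsetI)
    fix p assume p: "p \<in> N"
    obtain x y z where [simp]: "p = (x, y, z)" by (metis prod_cases3)
    show "p \<in> ?X \<union> ?Y"
    proof (cases "y = 0")
      case True
      then show ?thesis using p by (auto simp: N_def)
    next
      case False
      have "y * z = - (x * x)" using p by (simp add: N_def add_eq_0_iff)
      then have "z = - (x * x / y)" using False by (simp add: field_simps)
      then have "p \<in> ?X" using False by (intro image_eqI[of _ _ "(x, y)"]) auto
      then show ?thesis by blast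
    qed
  qed (auto simp: N_def split: if_splits)
  moreover have "?X \<inter> ?Y = {}" by auto
  moreover have "card ?X = ?q * (?q - 1)"
    by (subst card_image) (auto simp: inj_on_def card_cartesian_product)
  moreover have "card ?Y = ?q" by (subst card_image) (auto simp: inj_on_def)
  ultimately have "card N = ?q * (?q - 1) + ?q" by (simp add: card_Un_disjoint)
  then have "card N = ?q * ?q" by (cases ?q) simp_all
  moreover have "(0, 0, 0) \<in> N" by (simp add: N_def)
  ultimately have cN: "card (N - {(0, 0, 0)}) = ?q * ?q - 1" by (simp add: card_Diff_singleton)
  define F where "F = (\<lambda>(l, x, y, z). mat2 (l + x) y z (l - x) :: 'f ^ 2 ^ 2)"
  have eig: "eigenvalues (F (l, x, y, z)) = {l}" if "(x, y, z) \<in> N" for l x y z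
  proof -
    have "(l + x - m) * (l - x - m) - y * z = (l - m) * (l - m) - (x * x + y * z)" for m
      by (simp add: algebra_simps)
    moreover have "x * x + y * z = 0" using that by (simp add: N_def)
    ultimately have "(l + x - m) * (l - x - m) - y * z = (l - m) * (l - m)" for m by (simp only: diff_zero)
    then show ?thesis by (simp only: eigenvalues_def F_def prod.case mat2_nth) auto
  qed
  have "?S = F ` ((UNIV - {0}) \<times> (N - {(0, 0, 0)}))"
  proof (intro equalityI subsetI)
    fix A assume A: "A \<in> ?S"
    obtain a b c d where [simp]: "A = mat2 a b c d" by (rule mat2_cases)
    obtain l where l: "eigenvalues A = {l}" using A by (auto simp: card_1_singleton_iff)
    then have e1: "(a - l) * (d - l) - b * c = 0" by (auto simp: eigenvalues_def)
    \<comment> \<open>\<open>a + d - l\<close> is the second root of the characteristic polynomial;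
      as it lies in the field, it must be \<open>l\<close> again.\<close>
    have "(a - (a + d - l)) * (d - (a + d - l)) - b * c = (a - l) * (d - l) - b * c"
      by (simp add: algebra_simps)
    then have "a + d - l \<in> eigenvalues A" using e1 by (simp add: eigenvalues_def)
    then have d: "d = l + l - a" using l by (simp add: algebra_simps)
    have nz: "a * d - b * c \<noteq> 0" "\<not> (b = 0 \<and> c = 0 \<and> a = d)"
      using A unfolding \<open>A = _\<close> mem_Collect_eq noncentral_GL_mat2 by auto
    have n: "(a - l, b, c) \<in> N" using e1 d by (auto simp: N_def algebra_simps)
    have "l \<noteq> 0" using nz(1) e1 by auto
    moreover have "(a - l, b, c) \<noteq> (0, 0, 0)" using nz(2) d by auto
    ultimately show "A \<in> F ` ((UNIV - {0}) \<times> (N - {(0, 0, 0)}))"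
      using n d by (intro image_eqI[of _ _ "(l, a - l, b, c)"]) (auto simp: F_def)
  next
    fix A assume "A \<in> F ` ((UNIV - {0}) \<times> (N - {(0, 0, 0)}))"
    then obtain l x y z where A: "A = F (l, x, y, z)" and l: "l \<noteq> 0"
      and n: "(x, y, z) \<in> N" "(x, y, z) \<noteq> (0, 0, 0)"
      by auto
    have "(l + x) * (l - x) - y * z = l * l - (x * x + y * z)" by (simp add: algebra_simps)
    moreover have "x * x + y * z = 0" using n(1) by (simp add: N_def)
    ultimately have "(l + x) * (l - x) - y * z \<noteq> 0" using l by simp
    moreover have "\<not> (y = 0 \<and> z = 0 \<and> l + x = l - x)" using n by (auto simp: N_def)
    ultimately have "A \<in> noncentral GL" unfolding A F_def prod.case noncentral_GL_mat2 by blast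
    then show "A \<in> ?S" using eig[OF n(1)] A by simp
  qed
  moreover have "inj_on F ((UNIV - {0}) \<times> (N - {(0, 0, 0)}))"
  proof (rule inj_onI)
    fix p p' assume p: "p \<in> (UNIV - {0}) \<times> (N - {(0, 0, 0)})" "p' \<in> (UNIV - {0}) \<times> (N - {(0, 0, 0)})" "F p = F p'"
    obtain l x y z l' x' y' z' where pp: "p = (l, x, y, z)" "p' = (l', x', y', z')" by (metis prod_cases4)
    have "{l} = {l'}" using eig p unfolding pp by (metis DiffD1 mem_Sigma_iff)
    then show "p = p'" using p(3) unfolding pp F_def by simp
  qed
  ultimately have "card ?S = (?q - 1) * (?q * ?q - 1)"
    by (simp add: card_image card_cartesian_product cN)
  also have "?q * ?q - 1 = (?q + 1) * (?q - 1)" by (cases ?q) simp_all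
  finally show ?thesis by (simp only: power2_eq_square mult.assoc mult.commute[of "?q - 1" "(?q + 1) * (?q - 1)"])
qed

section \<open>The order of the group and of its center\<close>

text \<open>With \<open>q - 1 = m z\<close>, the last divisibility becomes \<open>1 + m q dvd m^3 - 2 m^2 + 1\<close>.
  The cofactor is congruent to \<open>1 - m\<close> modulo \<open>m^2\<close>, hence too large unless \<open>m = 1\<close>.\<close>

lemma center_order_arith:
  fixes q z :: nat
  assumes q: "q > 3" and z: "z > 0"
    and dvd1: "z dvd (q - 1) * q" and dvd2: "z dvd (q - 1) * (q - 1)"
    and dvd3: "z + (q - 1) * q dvd (q^2 - 1) * (q^2 - q) - (q - 1) + z"
  shows "z = q - 1"
proof -
  have "(q - 1) * q - (q - 1) * (q - 1) = (q - 1) * (q - (q - 1))" by (simp only: right_diff_distrib')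
  also have "\<dots> = q - 1" using q by simp
  finally have "z dvd q - 1" using dvd_diff_nat[OF dvd1 dvd2] by simp
  then obtain m' where m': "q - 1 = z * m'" by (auto simp: dvd_def)
  define m Z Q where "m = int m'" and "Z = int z" and "Q = int q"
  have "q = z * m' + 1" using m' q by simp
  then have Q: "Q = Z * m + 1" unfolding m_def Z_def Q_def by (metis of_nat_mult of_nat_add of_nat_1)
  have Z: "Z > 0" using z by (simp add: Z_def)
  have m: "m > 0" using m' q by (cases "m' = 0") (auto simp: m_def)
  have "int ((q^2 - 1) * (q^2 - q) - (q - 1) + z) = (Q^2 - 1) * (Q^2 - Q) - (Q - 1) + Z"
  proof -
    have a: "1 \<le> q^2" "q \<le> q^2" using q by (auto simp: power2_eq_square)
    have "1 * (q - 1) \<le> (q^2 - 1) * (q^2 - q)"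
    proof (rule mult_le_mono)
      have "4 * 4 \<le> q * q" using q by (intro mult_le_mono) auto
      then show "1 \<le> q^2 - 1" by (simp add: power2_eq_square)
      have "q^2 - q = q * (q - 1)" by (simp add: power2_eq_square right_diff_distrib')
      then show "q - 1 \<le> q^2 - q" using q by simp
    qed
    then show ?thesis using a q by (simp add: Q_def Z_def of_nat_diff)
  qed
  also have "\<dots> = Z * (1 + m * (Q^3 - Q - 1))"
    unfolding Q by (simp add: algebra_simps power2_eq_square power3_eq_cube)
  finally have e1: "int ((q^2 - 1) * (q^2 - q) - (q - 1) + z) = Z * (1 + m * (Q^3 - Q - 1))" .
  have e2: "int (z + (q - 1) * q) = Z * (1 + m * Q)"
    using q by (simp add: Z_def[symmetric] Q_def[symmetric] of_nat_diff) (simp add: Q algebra_simps)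
  have "int (z + (q - 1) * q) dvd int ((q^2 - 1) * (q^2 - q) - (q - 1) + z)"
    using dvd3 by (simp only: of_nat_dvd_iff)
  then have d: "1 + m * Q dvd 1 + m * (Q^3 - Q - 1)" unfolding e1 e2 using Z by simp
  \<comment> \<open>Modulo \<open>1 + m * Q\<close> the product \<open>m * Q\<close> is -1.
    Multiplying by \<open>m^2\<close> makes every \<open>Q\<close> meet an \<open>m\<close>, so that
    \<open>Q\<close> can be eliminated.\<close>
  have "m^3 - 2 * m^2 + 1 = (1 + m * Q) * ((m * Q)^2 - m * Q + 1 - m^2) - m^2 * (1 + m * (Q^3 - Q - 1))"
    by (simp add: algebra_simps power2_eq_square power3_eq_cube)
  then have "1 + m * Q dvd m^3 - 2 * m^2 + 1" using d by (metis dvd_diff dvd_mult dvd_triv_left)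
  then obtain k where k: "m^3 - 2 * m^2 + 1 = (1 + m * Q) * k" by (auto simp: dvd_def)
  have "m = 1"
  proof (rule ccontr)
    assume "m \<noteq> 1"
    then have m2: "m \<ge> 2" using m by simp
    have "m^3 - 2 * m^2 + 1 = m * m * (m - 2) + 1" by (simp add: algebra_simps power2_eq_square power3_eq_cube)
    moreover have "m * m * (m - 2) \<ge> 0" using m2 by simp
    ultimately have "(1 + m * Q) * k > 0" using k by linarith
    have mQ: "1 + m * Q \<ge> 1 + m + m * m"
    proof -
      have "m * m * 1 \<le> m * m * Z" using Z m by (intro mult_left_mono) auto
      then show ?thesis unfolding Q by (simp add: algebra_simps)
    qed
    moreover have "m * m \<ge> 0" by simp
    ultimately have "1 + m * Q > 0" using m by linarith
    then have kp: "k > 0" using \<open>(1 + m * Q) * k > 0\<close> zero_less_mult_pos[of "1 + m * Q" k] by blast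
    \<comment> \<open>Modulo \<open>m * m\<close> the equation becomes (1 + m) k = 1, and the
      inverse of 1 + m is 1 - m.\<close>
    define X where "X = m - 2 - Z * k"
    have "(1 + m) * k = m * m * X + 1"
      using k unfolding Q X_def by (simp add: algebra_simps power2_eq_square power3_eq_cube)
    moreover have "k = (1 - m) * ((1 + m) * k) + m * m * k" by (simp add: algebra_simps)
    ultimately have "k + m - 1 = (1 - m) * (m * m * X + 1) + m * m * k + m - 1" by simp
    also have "\<dots> = m * m * ((1 - m) * X + k)" by (simp add: algebra_simps)
    finally have "m * m dvd k + m - 1" by simp
    then have "m * m \<le> k + m - 1" using kp m by (intro zdvd_imp_le) auto
    then have "m * m - m + 1 \<le> k" by simp
    then have "(1 + m + m * m) * (m * m - m + 1) \<le> (1 + m * Q) * k"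
      using mQ m m2 kp \<open>1 + m * Q > 0\<close> by (intro mult_mono) auto
    then have le: "m * (m * (m * m)) + 3 * (m * m) \<le> m * (m * m)"
      using k by (simp add: algebra_simps power2_eq_square power3_eq_cube)
    have "m * (m * m) \<le> m * (m * (m * m))" using m by (intro mult_left_mono) auto
    moreover have "m * m > 0" using m by simp
    ultimately show False using le by linarith
  qed
  then show ?thesis using m' by (simp add: m_def)
qed

section \<open>Counting with subgroups and centralizers\<close>

context group
begin

lemmas subgroup_closed = subgroup.m_closed subgroup.m_inv_closed

text \<open>The fibres of \<open>f\<close> on \<open>K\<close> are the left cosets of
  \<open>N\<close>. As \<open>f\<close> is any function, this covers orbits of conjugation, orbits
  on points and images of homomorphisms alike.\<close>

lemma card_image_subgroup:
  assumes K: "subgroup K G" and N: "subgroup N G" "N \<subseteq> K" and fin: "finite K"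
    and f: "\<And>g h. g \<in> K \<Longrightarrow> h \<in> K \<Longrightarrow> f g = f h \<longleftrightarrow> inv g \<otimes> h \<in> N"
  shows "card K = card (f ` K) * card N"
proof -
  have KG: "K \<subseteq> carrier G" using K by (rule subgroup.subset)
  have fib: "card {x \<in> K. f x = f g} = card N" if g: "g \<in> K" for g
  proof -
    have "{x \<in> K. f x = f g} = (\<lambda>n. g \<otimes> n) ` N"
    proof (intro equalityI subsetI)
      fix x assume x: "x \<in> {x \<in> K. f x = f g}"
      then have "inv g \<otimes> x \<in> N" using f[OF g, of x] by simp
      moreover have "x = g \<otimes> (inv g \<otimes> x)" using x g KG
        by (simp add: inv_solve_left subsetD flip: m_assoc)
      ultimately show "x \<in> (\<lambda>n. g \<otimes> n) ` N" by blast
    next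
      fix x assume "x \<in> (\<lambda>n. g \<otimes> n) ` N"
      then obtain n where n: "n \<in> N" "x = g \<otimes> n" by blast
      have nK: "n \<in> K" using n N by blast
      then have xK: "x \<in> K" using n K g by (simp add: subgroup_closed)
      have "inv g \<otimes> x = n" using n g nK KG by (simp add: subsetD flip: m_assoc)
      then show "x \<in> {x \<in> K. f x = f g}" using f[OF g xK] n xK by simp
    qed
    moreover have "inj_on (\<lambda>n. g \<otimes> n) N"
      using g KG N inj_on_cmult[of g] by (meson inj_on_subset subsetD subset_trans)
    ultimately show ?thesis by (simp add: card_image)
  qed
  have "card K = (\<Sum>y\<in>f ` K. \<Sum>x\<in>{x. x \<in> K \<and> f x = y}. 1)"
    using sum.image_gen[OF fin, of "\<lambda>_. 1::nat" f] by simp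
  also have "\<dots> = (\<Sum>y\<in>f ` K. card N)" by (rule sum.cong) (auto simp: fib[simplified])
  finally show ?thesis by simp
qed

lemma card_subgroup_dvd:
  assumes "subgroup H G" "subgroup K G" "H \<subseteq> K" "finite K"
  shows "card H dvd card K"
proof -
  interpret K: group "G\<lparr>carrier := K\<rparr>" using assms(2) by (rule subgroup_imp_group)
  have "subgroup H (G\<lparr>carrier := K\<rparr>)" using assms by (simp add: subgroup_incl)
  then have "card (rcosets\<^bsub>G\<lparr>carrier := K\<rparr>\<^esub> H) * card H = card K"
    using K.lagrange by (simp add: Coset.order_def)
  then show ?thesis by (metis dvd_triv_right)
qed

definition centralizer :: "'a \<Rightarrow> 'a set" where
  "centralizer x = {y \<in> carrier G. x \<otimes> y = y \<otimes> x}"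

lemma commute_inv:
  assumes "x \<in> carrier G" "a \<in> carrier G" "x \<otimes> a = a \<otimes> x"
  shows "x \<otimes> inv a = inv a \<otimes> x"
proof -
  have "inv a \<otimes> x = inv a \<otimes> (x \<otimes> a) \<otimes> inv a" using assms(1,2)
    by (simp add: m_assoc)
  also have "\<dots> = x \<otimes> inv a" using assms by (simp flip: m_assoc)
  finally show ?thesis by simp
qed

lemma commute_mult:
  assumes "x \<in> carrier G" "a \<in> carrier G" "b \<in> carrier G" "x \<otimes> a = a \<otimes> x" "x \<otimes> b = b \<otimes> x"
  shows "x \<otimes> (a \<otimes> b) = a \<otimes> b \<otimes> x"
proof -
  have "x \<otimes> (a \<otimes> b) = a \<otimes> x \<otimes> b" using assms(1-3)
    by (simp only: assms(4)[symmetric] m_assoc)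
  also have "\<dots> = a \<otimes> (b \<otimes> x)" using assms(1-3) by (simp only: assms(5)[symmetric] m_assoc)
  finally show ?thesis using assms(1-3) by (simp add: m_assoc)
qed

lemma subgroup_centralizer: "x \<in> carrier G \<Longrightarrow> subgroup (centralizer x) G"
  unfolding centralizer_def
  by (rule subgroupI) (blast intro: one_closed l_one r_one inv_closed m_closed commute_inv commute_mult trans[OF r_one l_one[symmetric]])+

lemma subgroup_center: "subgroup (group_center G) G"
proof (rule subgroupI)
  fix a b assume a: "a \<in> group_center G"
  then show "inv a \<in> group_center G"
    by (auto simp: group_center_def intro!: commute_inv[symmetric, OF _ _ sym])
  assume b: "b \<in> group_center G"
  have "a \<otimes> b \<otimes> g = g \<otimes> (a \<otimes> b)" if g: "g \<in> carrier G" for g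
  proof -
    have ab: "a \<in> carrier G" "b \<in> carrier G" "a \<otimes> g = g \<otimes> a" "b \<otimes> g = g \<otimes> b"
      using a b g by (auto simp: group_center_def)
    show ?thesis using commute_mult[OF g ab(1,2) ab(3)[symmetric] ab(4)[symmetric]] by simp
  qed
  then show "a \<otimes> b \<in> group_center G" using a b unfolding group_center_def
    by (blast intro: m_closed)
qed (auto simp: group_center_def)

lemma centralizer_eq_comm_class:
  "x \<in> noncentral G \<Longrightarrow> centralizer x = group_center G \<union> comm_class G x"
  by (auto simp: centralizer_def comm_class_def group_center_def)

end

text \<open>This is all that is kept of the graph isomorphism. The three centralizer orders belong
  to two, one and no eigenvalues; those of the middle type are the scalar multiples of nontrivial
  unipotent matrices.\<close>

locale gl2_type = group G for G (structure) +
  fixes q :: nat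
  assumes q_gt: "q > 3" and fin [simp]: "finite (carrier G)"
    and card_G: "card (carrier G) = q * (q - 1)^2 * (q + 1)"
    and card_Z: "card (group_center G) = q - 1"
    and comm_trans: "\<And>x y w. \<lbrakk>x \<in> carrier G; y \<in> noncentral G; w \<in> carrier G; x \<otimes> y = y \<otimes> x;
      y \<otimes> w = w \<otimes> y\<rbrakk> \<Longrightarrow> x \<otimes> w = w \<otimes> x"
    and card_centralizer_cases: "\<And>x. x \<in> noncentral G \<Longrightarrow>
      card (centralizer x) = (q - 1)^2 \<or> card (centralizer x) = q * (q - 1) \<or>
      card (centralizer x) = (q - 1) * (q + 1)"
    and card_unipotent_type: "card {x \<in> noncentral G. card (centralizer x) = q * (q - 1)} = (q + 1) * (q - 1)^2"

section \<open>Transport of the class counts along the graph isomorphism\<close>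

lemma noncommuting_graph_isoE:
  assumes "digraph_iso (with_proj (noncommuting_graph G)) (with_proj (noncommuting_graph H))"
  obtains f where "bij_betw f (noncentral G) (noncentral H)"
    "\<And>x y. x \<in> noncentral G \<Longrightarrow> y \<in> noncentral G \<Longrightarrow>
      x \<otimes>\<^bsub>G\<^esub> y = y \<otimes>\<^bsub>G\<^esub> x \<longleftrightarrow> f x \<otimes>\<^bsub>H\<^esub> f y = f y \<otimes>\<^bsub>H\<^esub> f x"
proof -
  interpret G: pair_bidirected_digraph "noncommuting_graph G" by (rule pair_bidirected_digraph_noncommuting_graph)
  interpret H: pair_bidirected_digraph "noncommuting_graph H" by (rule pair_bidirected_digraph_noncommuting_graph)
  obtain f where f: "bij_betw f (noncentral G) (noncentral H)"
    and e: "\<And>x y. x \<in> noncentral G \<Longrightarrow> y \<in> noncentral G \<Longrightarrow>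
      (x, y) \<in> parcs (noncommuting_graph G) \<longleftrightarrow> (f x, f y) \<in> parcs (noncommuting_graph H)"
    using assms unfolding digraph_iso_with_proj_iff[OF G.pair_wf_digraph_axioms H.pair_wf_digraph_axioms]
    by (auto simp: noncommuting_graph_def)
  show ?thesis
  proof (rule that[OF f])
    fix x y assume xy: "x \<in> noncentral G" "y \<in> noncentral G"
    moreover have "f x \<in> noncentral H" "f y \<in> noncentral H" using f xy by (auto simp: bij_betw_def)
    ultimately show "x \<otimes>\<^bsub>G\<^esub> y = y \<otimes>\<^bsub>G\<^esub> x \<longleftrightarrow> f x \<otimes>\<^bsub>H\<^esub> f y = f y \<otimes>\<^bsub>H\<^esub> f x"
      using e[OF xy] by (auto simp: noncommuting_graph_def)
  qed
qed

text \<open>A centralizer is its commuting class together with the center. The graph gives the class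
  sizes, so the order of the center is the only unknown in all centralizer orders and in the order
  of \<open>G\<close>.\<close>

lemma gl2_type_if_graph_iso:
  fixes G (structure)
  assumes "group G" and q: "CARD('f::{field,finite}) = q" "q > 3"
    and iso: "digraph_iso (with_proj (noncommuting_graph G))
           (with_proj (noncommuting_graph (GL :: ('f::{field,finite} ^ 2 ^ 2) monoid)))"
  shows "gl2_type G q"
proof -
  interpret group G by fact
  let ?H = "GL :: ('f ^ 2 ^ 2) monoid"
  let ?z = "card (group_center G)"
  obtain f where f: "bij_betw f (noncentral G) (noncentral ?H)"
    and comm: "\<And>x y. x \<in> noncentral G \<Longrightarrow> y \<in> noncentral G \<Longrightarrow>
      x \<otimes> y = y \<otimes> x \<longleftrightarrow> f x ** f y = f y ** f x"
    using noncommuting_graph_isoE[OF iso] by (metis GL_simps(1))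
  have finH: "finite (carrier ?H)" by simp
  have fH: "f x \<in> noncentral ?H" if "x \<in> noncentral G" for x
    using f that unfolding bij_betw_def by blast
  have fsurj: "\<exists>x \<in> noncentral G. f x = y" if "y \<in> noncentral ?H" for y
  proof -
    have "y \<in> f ` noncentral G" using that bij_betw_imp_surj_on[OF f] by simp
    then show ?thesis unfolding image_iff by metis
  qed
  have cls: "card (comm_class G x) = card (comm_class ?H (f x))" if x: "x \<in> noncentral G" for x
  proof (rule bij_betw_same_card)
    have "f ` comm_class G x = comm_class ?H (f x)"
    proof (intro equalityI subsetI)
      fix y assume "y \<in> comm_class ?H (f x)"
      then have y: "y \<in> noncentral ?H" "f x ** y = y ** f x" unfolding comm_class_def GL_simps by auto
      obtain w where w: "w \<in> noncentral G" "f w = y" using fsurj[OF y(1)] by blast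
      then have "w \<in> comm_class G x" using comm[OF x w(1)] y by (simp add: comm_class_def)
      then show "y \<in> f ` comm_class G x" using w by blast
    next
      fix y assume "y \<in> f ` comm_class G x"
      then obtain w where w: "w \<in> noncentral G" "x \<otimes> w = w \<otimes> x" "y = f w"
        unfolding comm_class_def by blast
      then show "y \<in> comm_class ?H (f x)" using fH[OF w(1)] comm[OF x w(1)] by (simp add: comm_class_def)
    qed
    moreover have "comm_class G x \<subseteq> noncentral G" by (auto simp: comm_class_def)
    ultimately show "bij_betw f (comm_class G x) (comm_class ?H (f x))"
      using f by (metis bij_betw_subset)
  qed
  have finN: "finite (noncentral G)" using f finH by (metis bij_betw_finite finite_Diff)
  obtain A where A: "A \<in> noncentral ?H" "eigenvalues A = {}" using ex_no_eigenvalues by blast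
  obtain a where a: "a \<in> noncentral G" "f a = A" using fsurj[OF A(1)] by blast
  have "(q + 1) * (q - 1)^2 \<noteq> 0" using q by simp
  then have "card {A \<in> noncentral ?H. card (eigenvalues A) = 1} \<noteq> 0"
    unfolding card_one_eigenvalue q(1) .
  then have "{A \<in> noncentral ?H. card (eigenvalues A) = 1} \<noteq> {}" by (metis card.empty)
  then obtain B where B: "B \<in> noncentral ?H" "card (eigenvalues B) = 1" by blast
  obtain b where b: "b \<in> noncentral G" "f b = B" using fsurj[OF B(1)] by blast
  \<comment> \<open>Finiteness of \<open>G\<close>: the graph bounds only the noncentral elements,
    but these contain the coset of the center through \<open>a\<close>.\<close>
  have "inj_on (\<lambda>z. a \<otimes> z) (group_center G)" using a by (auto simp: inj_on_def group_center_def)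
  moreover have "(\<lambda>z. a \<otimes> z) ` group_center G \<subseteq> noncentral G"
  proof clarify
    fix z assume z: "z \<in> group_center G"
    then have zG: "z \<in> carrier G" by (simp add: group_center_def)
    have "a \<otimes> z \<notin> group_center G"
    proof
      assume "a \<otimes> z \<in> group_center G"
      then have "a \<otimes> z \<otimes> inv z \<in> group_center G"
        using subgroup_center z by (simp add: subgroup_closed)
      then show False using a zG by (simp add: m_assoc)
    qed
    then show "a \<otimes> z \<in> noncentral G" using a zG by simp
  qed
  ultimately have finZ: "finite (group_center G)" using finN by (metis finite_subset inj_on_finite)
  have ZG: "group_center G \<subseteq> carrier G" by (auto simp: group_center_def)
  have finG: "finite (carrier G)" using finZ finN ZG by (metis Diff_partition finite_UnI)
  have zpos: "?z > 0" using finZ subgroup.one_closed[OF subgroup_center] by (auto simp: card_gt_0_iff)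
  have cC: "card (centralizer x) = ?z + card (comm_class G x)" if "x \<in> noncentral G" for x
  proof -
    have "group_center G \<inter> comm_class G x = {}" by (auto simp: comm_class_def)
    moreover have "finite (comm_class G x)"
      using finN by (rule rev_finite_subset) (auto simp: comm_class_def)
    ultimately show ?thesis using finZ by (simp add: centralizer_eq_comm_class[OF that] card_Un_disjoint)
  qed
  have cH: "card (comm_class G x) = (q - 1) * (q - card (eigenvalues (f x)))" if "x \<in> noncentral G" for x
    using cls[OF that] card_comm_class_GL2[OF fH[OF that]] q(1) by simp
  have zdvd: "?z dvd card (comm_class G x)" if x: "x \<in> noncentral G" for x
  proof -
    have "group_center G \<subseteq> centralizer x" using x by (auto simp: centralizer_def group_center_def)
    then have "?z dvd card (centralizer x)"
      using x finG by (intro card_subgroup_dvd subgroup_center subgroup_centralizer)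
        (auto intro: finite_subset[of _ "carrier G"] simp: centralizer_def)
    then show ?thesis using cC[OF x] by (simp add: dvd_add_right_iff)
  qed
  have cN: "card (noncentral G) = (q^2 - 1) * (q^2 - q) - (q - 1)"
  proof -
    have "card (noncentral G) = card (noncentral ?H)" using f by (rule bij_betw_same_card)
    also have "\<dots> = card (carrier ?H) - card (group_center ?H)"
      by (rule card_Diff_subset) (auto simp: group_center_def)
    finally show ?thesis unfolding center_GL by (simp add: card_scalar_matrices card_GL2 q(1) del: GL_simps)
  qed
  have cG: "card (carrier G) = (q^2 - 1) * (q^2 - q) - (q - 1) + ?z"
    using cN finG ZG by (metis card_Diff_subset card_mono finZ le_add_diff_inverse2)
  \<comment> \<open>The order of the center divides the sizes of the classes of \<open>b\<close>
    (one eigenvalue) and \<open>a\<close> (none), and the centralizer order of \<open>a\<close>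
    divides that of \<open>G\<close>.\<close>
  have "?z = q - 1"
  proof (rule center_order_arith)
    show "q > 3" "?z > 0" by fact+
    show "?z dvd (q - 1) * q" using zdvd[OF a(1)] cH[OF a(1)] a A by simp
    show "?z dvd (q - 1) * (q - 1)" using zdvd[OF b(1)] cH[OF b(1)] b B by simp
    have "card (centralizer a) dvd card (carrier G)"
      using a finG by (intro card_subgroup_dvd subgroup_centralizer subgroup_self) (auto simp: centralizer_def)
    then show "?z + (q - 1) * q dvd (q^2 - 1) * (q^2 - q) - (q - 1) + ?z"
      using cC[OF a(1)] cH[OF a(1)] a A cG by simp
  qed
  have cC': "card (centralizer x) = (q - 1) * (q + 1 - card (eigenvalues (f x)))" if x: "x \<in> noncentral G"
    for x
  proof -
    have "card (eigenvalues (f x)) \<le> q" using card_eigenvalues[of "f x"] q(2) by linarith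
    then show ?thesis unfolding cC[OF x] cH[OF x] \<open>?z = q - 1\<close> by (simp add: Suc_diff_le)
  qed
  show ?thesis
  proof unfold_locales
    show "q > 3" "finite (carrier G)" "?z = q - 1" by fact+
    \<comment> \<open>Subtraction is truncated; the difference counts the noncentral elements, of
      which there are some.\<close>
    have "q - 1 \<le> (q^2 - 1) * (q^2 - q)"
      using cN finN a q(2) by (metis a(1) card_gt_0_iff diff_is_0_eq' empty_iff less_or_eq_imp_le nat_le_linear neq0_conv zero_less_iff_neq_zero)
    then have "card (carrier G) = (q^2 - 1) * (q^2 - q)" using cG \<open>?z = q - 1\<close> by simp
    also have "q^2 - q = q * (q - 1)" by (simp add: power2_eq_square right_diff_distrib')
    also have "q^2 - 1 = (q + 1) * (q - 1)" using q by (cases q) (simp_all add: power2_eq_square)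
    finally show "card (carrier G) = q * (q - 1)^2 * (q + 1)" by (simp only: power2_eq_square mult_ac)
  next
    fix x y w assume h: "x \<in> carrier G" "y \<in> noncentral G" "w \<in> carrier G" "x \<otimes> y = y \<otimes> x"
      "y \<otimes> w = w \<otimes> y"
    show "x \<otimes> w = w \<otimes> x"
    proof (cases "x \<in> group_center G \<or> w \<in> group_center G")
      case True
      then show ?thesis using h by (auto simp: group_center_def)
    next
      case False
      then have xw: "x \<in> noncentral G" "w \<in> noncentral G" using h by auto
      have "f x ** f y = f y ** f x" "f y ** f w = f w ** f y" using comm xw h by blast+
      then show ?thesis using GL2_commute_trans fH[OF h(2)] comm[OF xw] by blast
    qed
  next
    fix x assume x: "x \<in> noncentral G"
    have "card (eigenvalues (f x)) = 0 \<or> card (eigenvalues (f x)) = 1 \<or> card (eigenvalues (f x)) = 2"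
      using card_eigenvalues[of "f x"] by linarith
    then show "card (centralizer x) = (q - 1)^2 \<or> card (centralizer x) = q * (q - 1) \<or>
      card (centralizer x) = (q - 1) * (q + 1)"
      unfolding cC'[OF x] by (elim disjE) (simp_all only: power2_eq_square, simp_all add: mult.commute)
  next
    have "(q - 1) * (q + 1 - card (eigenvalues (f x))) = q * (q - 1) \<longleftrightarrow> card (eigenvalues (f x)) = 1" for x
      using q(2) card_eigenvalues[of "f x"] by (auto simp: mult.commute[of q])
    then have "{x \<in> noncentral G. card (centralizer x) = q * (q - 1)}
        = {x \<in> noncentral G. card (eigenvalues (f x)) = 1}" using cC' by auto
    moreover have "f ` {x \<in> noncentral G. card (eigenvalues (f x)) = 1} = {A \<in> noncentral ?H. card (eigenvalues A) = 1}"
      using fH fsurj by (auto simp: image_iff)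
    moreover have "card (f ` {x \<in> noncentral G. card (eigenvalues (f x)) = 1}) = card {x \<in> noncentral G. card (eigenvalues (f x)) = 1}"
      by (rule card_image) (use f in \<open>auto simp: bij_betw_def inj_on_def\<close>)
    ultimately show "card {x \<in> noncentral G. card (centralizer x) = q * (q - 1)} = (q + 1) * (q - 1)^2"
      using card_one_eigenvalue[where 'f='f] unfolding q(1) by argo
  qed
qed

section \<open>The Sylow p-subgroups as points\<close>

context group
begin

definition conj :: "'a \<Rightarrow> 'a \<Rightarrow> 'a" where
  "conj g x = g \<otimes> x \<otimes> inv g"

lemma inv_mult_cancel:
  assumes "g \<in> carrier G" "x \<in> carrier G"
  shows "inv g \<otimes> (g \<otimes> x) = x" "g \<otimes> (inv g \<otimes> x) = x"
  using assms by (simp_all flip: m_assoc)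

lemma conj_closed [simp, intro]: "g \<in> carrier G \<Longrightarrow> x \<in> carrier G \<Longrightarrow> conj g x \<in> carrier G"
  by (simp add: conj_def)

lemma conj_mult: "g \<in> carrier G \<Longrightarrow> x \<in> carrier G \<Longrightarrow> y \<in> carrier G \<Longrightarrow>
    conj g (x \<otimes> y) = conj g x \<otimes> conj g y"
  by (simp add: conj_def m_assoc inv_mult_cancel)

lemma conj_conj: "g \<in> carrier G \<Longrightarrow> h \<in> carrier G \<Longrightarrow> x \<in> carrier G \<Longrightarrow>
    conj g (conj h x) = conj (g \<otimes> h) x"
  by (simp add: conj_def m_assoc inv_mult_group)

lemma conj_one [simp]: "x \<in> carrier G \<Longrightarrow> conj \<one> x = x" "g \<in> carrier G \<Longrightarrow> conj g \<one> = \<one>"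
  by (simp_all add: conj_def)

lemma conj_inv_cancel [simp]:
  assumes "g \<in> carrier G" "x \<in> carrier G"
  shows "conj (inv g) (conj g x) = x" "conj g (conj (inv g) x) = x"
  using assms by (simp_all add: conj_conj)

lemma conj_eq_iff [simp]: "g \<in> carrier G \<Longrightarrow> x \<in> carrier G \<Longrightarrow> y \<in> carrier G \<Longrightarrow>
    conj g x = conj g y \<longleftrightarrow> x = y"
  by (metis conj_inv_cancel(1))

lemma conj_pow: "g \<in> carrier G \<Longrightarrow> x \<in> carrier G \<Longrightarrow> conj g (x [^] (k::nat)) = conj g x [^] k"
  by (induction k) (simp_all add: conj_mult)

lemma conj_fix_iff: "g \<in> carrier G \<Longrightarrow> x \<in> carrier G \<Longrightarrow> conj g x = x \<longleftrightarrow> g \<otimes> x = x \<otimes> g"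
  by (simp add: conj_def inv_solve_right')

lemma conj_eq_conj_iff:
  assumes "g \<in> carrier G" "h \<in> carrier G" "x \<in> carrier G"
  shows "conj g x = conj h x \<longleftrightarrow> inv g \<otimes> h \<in> centralizer x"
proof -
  have "conj g x = conj h x \<longleftrightarrow> x = conj (inv g) (conj h x)"
    using assms by (metis conj_inv_cancel conj_closed inv_closed)
  also have "\<dots> \<longleftrightarrow> conj (inv g \<otimes> h) x = x" using assms by (auto simp: conj_conj)
  also have "\<dots> \<longleftrightarrow> inv g \<otimes> h \<in> centralizer x"
    using assms by (auto simp: conj_fix_iff centralizer_def)
  finally show ?thesis .
qed

definition act :: "'a \<Rightarrow> 'a set \<Rightarrow> 'a set" where
  "act g C = conj g ` C"

lemma act_act: "g \<in> carrier G \<Longrightarrow> h \<in> carrier G \<Longrightarrow> C \<subseteq> carrier G \<Longrightarrow> act g (act h C) = act (g \<otimes> h) C"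
  unfolding act_def image_image by (rule image_cong) (auto simp: conj_conj)

lemma act_one [simp]: "C \<subseteq> carrier G \<Longrightarrow> act \<one> C = C"
  unfolding act_def by (auto simp: image_iff subsetD)

lemma act_eq_iff:
  assumes "g \<in> carrier G" "h \<in> carrier G" "C \<subseteq> carrier G" "D \<subseteq> carrier G"
  shows "act g C = act h D \<longleftrightarrow> act (inv h \<otimes> g) C = D"
proof
  assume "act g C = act h D"
  then have "act (inv h) (act g C) = act (inv h) (act h D)" by simp
  then show "act (inv h \<otimes> g) C = D" using assms by (simp add: act_act)
next
  assume "act (inv h \<otimes> g) C = D"
  then have "act h (act (inv h \<otimes> g) C) = act h D" by simp
  then show "act g C = act h D" using assms by (simp add: act_act inv_mult_cancel)
qed

lemma act_inv_eq:
  assumes "g \<in> carrier G" "C \<subseteq> carrier G" "act g C = D"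
  shows "act (inv g) D = C"
  using act_act[of "inv g" g C] assms by simp

lemma act_centralizer:
  assumes "g \<in> carrier G" "x \<in> carrier G"
  shows "act g (centralizer x) = centralizer (conj g x)"
proof (intro equalityI subsetI)
  fix y assume "y \<in> act g (centralizer x)"
  then obtain w where w: "w \<in> carrier G" "x \<otimes> w = w \<otimes> x" "y = conj g w"
    by (auto simp: act_def centralizer_def)
  then show "y \<in> centralizer (conj g x)" using assms by (simp add: centralizer_def flip: conj_mult)
next
  fix y assume "y \<in> centralizer (conj g x)"
  then have y: "y \<in> carrier G" "conj g x \<otimes> y = y \<otimes> conj g x" by (auto simp: centralizer_def)
  have "x \<otimes> conj (inv g) y = conj (inv g) (conj g x \<otimes> y)" using assms y(1) by (simp add: conj_mult)
  also have "\<dots> = conj (inv g) (y \<otimes> conj g x)" by (simp only: y(2))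
  also have "\<dots> = conj (inv g) y \<otimes> x" using assms y(1) by (simp add: conj_mult)
  finally have "conj (inv g) y \<in> centralizer x" using assms y(1) by (simp add: centralizer_def)
  moreover have "y = conj g (conj (inv g) y)" using assms y(1) by simp
  ultimately show "y \<in> act g (centralizer x)" unfolding act_def by (rule image_eqI[rotated])
qed

lemma noncentral_conj:
  assumes "g \<in> carrier G" "x \<in> noncentral G"
  shows "conj g x \<in> noncentral G"
proof -
  have "conj g x \<notin> group_center G"
  proof
    assume "conj g x \<in> group_center G"
    then have c: "conj g x \<otimes> g = g \<otimes> conj g x" using assms by (simp add: group_center_def)
    moreover have "conj g x \<otimes> g = g \<otimes> x" using assms by (simp add: conj_def m_assoc)
    ultimately have "inv g \<otimes> (g \<otimes> x) = inv g \<otimes> (g \<otimes> conj g x)" by simp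
    then have "x = conj g x" using assms by (simp add: inv_mult_cancel)
    then show False using assms \<open>conj g x \<in> group_center G\<close> by simp
  qed
  then show ?thesis using assms by simp
qed

lemma coprime_pow_eq_one:
  assumes "x \<in> carrier G" "x [^] (a::nat) = \<one>" "x [^] (b::nat) = \<one>" "coprime a b"
  shows "x = \<one>"
proof -
  have "ord x dvd 1" using assms by (metis pow_eq_id coprime_common_divisor_nat dvd_refl)
  then show ?thesis using ord_eq_1[OF assms(1)] by simp
qed

lemma subgroup_pow_card:
  assumes "subgroup H G" "x \<in> H"
  shows "x [^] card H = \<one>"
proof -
  interpret H: group "G\<lparr>carrier := H\<rparr>" using assms(1) by (rule subgroup_imp_group)
  show ?thesis using H.pow_order_eq_1[of x] assms(2) by (simp add: Coset.order_def flip: nat_pow_consistent)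
qed

end

locale gl2_geometry = gl2_type G q for G (structure) and q +
  fixes p n :: nat
  assumes prime_p: "prime p" and q_eq: "q = p ^ n"
begin

abbreviation Z where "Z \<equiv> group_center G"

text \<open>Since q is the full p-part of the order of \<open>G\<close>, these are the elements of
  p-power order.\<close>

definition p_elements :: "'a set" where
  "p_elements = {u \<in> carrier G. u [^] q = \<one>}"

text \<open>In GL(2,q) such a centralizer belongs to a unipotent matrix, whose unique eigenline is a
  point of the projective line.\<close>

definition points :: "'a set set" where
  "points = centralizer ` {x \<in> noncentral G. card (centralizer x) = q * (q - 1)}"

definition U :: "'a set \<Rightarrow> 'a set" where
  "U C = C \<inter> p_elements"

lemma coprime_q: "coprime q (q - 1)" "coprime q (q + 1)" "coprime q ((q - 1)^2)" "coprime q ((q - 1) * (q + 1))"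
  "coprime q ((q - 1)^2 * (q + 1))"
proof -
  show 1: "coprime q (q - 1)" using q_gt coprime_diff_one_right_nat[of q] by simp
  show 2: "coprime q (q + 1)" by simp
  show "coprime q ((q - 1)^2)" "coprime q ((q - 1) * (q + 1))" "coprime q ((q - 1)^2 * (q + 1))"
    using 1 2 by (simp_all only: coprime_mult_right_iff coprime_power_right_iff simp_thms)
qed

lemma finite_subset_carrier: "S \<subseteq> carrier G \<Longrightarrow> finite S"
  using fin finite_subset by blast

lemma Z_carrier: "Z \<subseteq> carrier G"
  by (auto simp: group_center_def)

lemma Z_commute: "z \<in> Z \<Longrightarrow> g \<in> carrier G \<Longrightarrow> z \<otimes> g = g \<otimes> z"
  by (auto simp: group_center_def)

text \<open>The center has order q - 1, prime to p, so each of its cosets contains at most one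
  p-element. All later uniqueness of lifts rests on this.\<close>

lemma p_element_eq:
  assumes "u \<in> p_elements" "v \<in> p_elements" "c \<in> Z" "v = u \<otimes> c"
  shows "u = v" "c = \<one>"
proof -
  have *: "u \<in> carrier G" "v \<in> carrier G" "c \<in> carrier G" "u [^] q = \<one>" "v [^] q = \<one>"
    using assms Z_carrier by (auto simp: p_elements_def)
  have "u \<otimes> c = c \<otimes> u" using Z_commute[OF assms(3)] * by simp
  then have "v [^] q = u [^] q \<otimes> c [^] q" unfolding assms(4) using * by (intro pow_mult_distrib) auto
  then have "c [^] q = \<one>" using * by simp
  moreover have "c [^] (q - 1) = \<one>" using subgroup_pow_card[OF subgroup_center assms(3)] card_Z by simp
  ultimately show "c = \<one>" using coprime_pow_eq_one *(3) coprime_q(1) by blast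
  then show "u = v" using assms(4) * by simp
qed

lemma one_p_element: "\<one> \<in> p_elements"
  by (simp add: p_elements_def)

lemma p_element_noncentral: "u \<in> p_elements \<Longrightarrow> u \<noteq> \<one> \<Longrightarrow> u \<in> noncentral G"
  using p_element_eq(2)[OF one_p_element, of u u] unfolding p_elements_def by auto

lemma p_elements_conj: "u \<in> p_elements \<Longrightarrow> g \<in> carrier G \<Longrightarrow> conj g u \<in> p_elements"
  by (auto simp: p_elements_def simp flip: conj_pow)

lemma centralizer_eq:
  assumes "x \<in> noncentral G" "y \<in> noncentral G" "x \<otimes> y = y \<otimes> x"
  shows "centralizer y = centralizer x"
proof -
  have x: "x \<in> carrier G" "y \<in> carrier G" using assms by auto
  have "w \<otimes> x = x \<otimes> w \<longleftrightarrow> w \<otimes> y = y \<otimes> w"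
    if "w \<in> carrier G" for w
    using comm_trans[OF that assms(1) x(2) _ assms(3)]
      comm_trans[OF that assms(2) x(1) _ assms(3)[symmetric]] by blast
  moreover have "x \<otimes> w = w \<otimes> x \<longleftrightarrow> w \<otimes> x = x \<otimes> w" "y \<otimes> w = w \<otimes> y \<longleftrightarrow> w \<otimes> y = y \<otimes> w" for w
    by (rule eq_commute)+
  ultimately show ?thesis unfolding centralizer_def by blast
qed

lemma centralizer_commute:
  assumes "x \<in> noncentral G" "a \<in> centralizer x" "b \<in> centralizer x"
  shows "a \<otimes> b = b \<otimes> a"
proof -
  have "a \<in> carrier G" "x \<otimes> a = a \<otimes> x" "b \<in> carrier G" "x \<otimes> b = b \<otimes> x"
    using assms unfolding centralizer_def by blast+
  then show ?thesis using comm_trans[of a x b] assms(1) by presburger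
qed

lemma pointsE:
  assumes "C \<in> points"
  obtains x where "x \<in> noncentral G" "card (centralizer x) = q * (q - 1)" "C = centralizer x"
  using assms by (auto simp: points_def)

lemma point_props:
  assumes "C \<in> points"
  shows "subgroup C G" "C \<subseteq> carrier G" "card C = q * (q - 1)" "Z \<subseteq> C"
    "\<And>a b. a \<in> C \<Longrightarrow> b \<in> C \<Longrightarrow> a \<otimes> b = b \<otimes> a"
proof -
  obtain x where x: "x \<in> noncentral G" "card (centralizer x) = q * (q - 1)" "C = centralizer x"
    using assms by (rule pointsE)
  show "subgroup C G" using x subgroup_centralizer by simp
  show "C \<subseteq> carrier G" "card C = q * (q - 1)" "Z \<subseteq> C"
    using x by (auto simp: centralizer_def group_center_def)
  show "\<And>a b. a \<in> C \<Longrightarrow> b \<in> C \<Longrightarrow> a \<otimes> b = b \<otimes> a"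
      unfolding x(3) by (rule centralizer_commute[OF x(1)])
qed

text \<open>By transitivity of commuting, any noncentral member determines the point; hence distinct
  points meet only in the center.\<close>

lemma point_eq_centralizer:
  assumes "C \<in> points" "y \<in> C" "y \<notin> Z"
  shows "C = centralizer y"
proof -
  obtain x where x: "x \<in> noncentral G" "C = centralizer x" using assms pointsE by metis
  then show ?thesis using centralizer_eq[of x y] assms by (auto simp: centralizer_def)
qed

lemma points_eqI: "C \<in> points \<Longrightarrow> D \<in> points \<Longrightarrow> y \<in> C \<Longrightarrow> y \<in> D \<Longrightarrow> y \<notin> Z \<Longrightarrow> C = D"
  using point_eq_centralizer[of C y] point_eq_centralizer[of D y] by simp

text \<open>The elements with centralizer \<open>C\<close> are those of \<open>C - Z\<close>, which
  are (q - 1)^2 in number; the count of all elements of this type does the rest.\<close>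

lemma card_points: "card points = q + 1"
proof -
  let ?T = "{x \<in> noncentral G. card (centralizer x) = q * (q - 1)}"
  have finT: "finite ?T" by (rule finite_subset_carrier) blast
  have fib: "card {x. x \<in> ?T \<and> centralizer x = C} = (q - 1)^2" if C: "C \<in> points" for C
  proof -
    have "{x. x \<in> ?T \<and> centralizer x = C} = C - Z"
    proof (intro equalityI subsetI)
      fix x assume "x \<in> C - Z"
      then have "x \<in> carrier G" "x \<notin> Z" "centralizer x = C"
        using point_eq_centralizer[OF C, of x] point_props(2)[OF C] by auto
      then show "x \<in> {x. x \<in> ?T \<and> centralizer x = C}" using point_props(3)[OF C] by simp
    next
      fix x assume x: "x \<in> {x. x \<in> ?T \<and> centralizer x = C}"
      then have "x \<in> noncentral G" "centralizer x = C" by blast+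
      moreover from this have "x \<in> centralizer x" unfolding centralizer_def by blast
      ultimately show "x \<in> C - Z" by blast
    qed
    moreover have "card (C - Z) = q * (q - 1) - (q - 1)"
      using point_props[OF C] card_Z finite_subset_carrier Z_carrier by (subst card_Diff_subset) auto
    moreover have "q * (q - 1) - (q - 1) = (q - 1)^2"
      by (simp add: power2_eq_square diff_mult_distrib)
    ultimately show ?thesis by simp
  qed
  have "card ?T = (\<Sum>C\<in>points. \<Sum>x\<in>{x. x \<in> ?T \<and> centralizer x = C}. 1)"
    using sum.image_gen[OF finT, of "\<lambda>_. 1::nat" centralizer] by (simp add: points_def)
  also have "\<dots> = (\<Sum>C\<in>points. (q - 1)^2)" by (rule sum.cong) (use fib in auto)
  finally have "(q + 1) * (q - 1)^2 = card points * (q - 1)^2" using card_unipotent_type by simp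
  then show ?thesis unfolding mult_cancel2 using q_gt by auto
qed

lemma finite_points: "finite points"
  by (rule card_ge_0_finite) (simp add: card_points)

text \<open>A Sylow p-subgroup \<open>H\<close> of \<open>C\<close> meets each coset of
  \<open>Z\<close> at most once, so by counting \<open>C\<close> is the product of \<open>H\<close>
  and \<open>Z\<close>, and \<open>H\<close> contains every p-element of \<open>C\<close>.\<close>

lemma U_props:
  assumes C: "C \<in> points"
  shows "subgroup (U C) G" "card (U C) = q" "\<And>c. c \<in> C \<Longrightarrow> \<exists>u\<in>U C. \<exists>z\<in>Z. c = u \<otimes> z"
proof -
  note P = point_props[OF C]
  interpret C: group "G\<lparr>carrier := C\<rparr>" using P(1) by (rule subgroup_imp_group)
  have "\<exists>H. subgroup H (G\<lparr>carrier := C\<rparr>) \<and> card H = p ^ n"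
    using P prime_p q_eq finite_subset_carrier C.is_group
      by (intro sylow_thm[of p _ n "q - 1"]) (auto simp: Coset.order_def)
  then obtain H where H: "subgroup H (G\<lparr>carrier := C\<rparr>)" "card H = q" using q_eq by blast
  have HC: "H \<subseteq> C" using subgroup.subset[OF H(1)] by simp
  have HG: "subgroup H G" using H(1) P(1) by (rule incl_subgroup[rotated])
  have Hp: "H \<subseteq> p_elements"
    using subgroup_pow_card[OF HG] H(2) HC P(2) by (auto simp: p_elements_def)
  have inj: "inj_on (\<lambda>(h, z). h \<otimes> z) (H \<times> Z)"
  proof (rule inj_onI, clarify)
    fix h z h' z' assume h: "h \<in> H" "h' \<in> H" "z \<in> Z" "z' \<in> Z"
      and e: "h \<otimes> z = h' \<otimes> z'"
    have car: "h \<in> carrier G" "h' \<in> carrier G" "z \<in> carrier G" "z' \<in> carrier G"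
      using h HC P(2) Z_carrier by auto
    have "h' = h' \<otimes> z' \<otimes> inv z'" using car by (simp add: m_assoc)
    also have "\<dots> = h \<otimes> (z \<otimes> inv z')" using car by (simp add: m_assoc flip: e)
    finally have "h' = h \<otimes> (z \<otimes> inv z')" .
    moreover have "z \<otimes> inv z' \<in> Z"
      using h subgroup_center by (simp add: subgroup_closed)
    ultimately have "h = h'" using p_element_eq(1)[of h h'] h Hp by blast
    then show "h = h' \<and> z = z'" using e car by (metis inv_mult_cancel(1))
  qed
  have "(\<lambda>(h, z). h \<otimes> z) ` (H \<times> Z) = C"
  proof (rule card_subset_eq)
    show "finite C" using P(2) finite_subset_carrier by simp
    show "(\<lambda>(h, z). h \<otimes> z) ` (H \<times> Z) \<subseteq> C" using HC P(1,4)
      by (auto intro: subgroup.m_closed)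
    show "card ((\<lambda>(h, z). h \<otimes> z) ` (H \<times> Z)) = card C"
      using card_image[OF inj] H(2) card_Z P(3) by (simp add: card_cartesian_product)
  qed
  then have dec: "\<exists>h\<in>H. \<exists>z\<in>Z. c = h \<otimes> z" if "c \<in> C" for c using that by auto
  have "U C = H"
  proof (intro equalityI subsetI)
    fix u assume "u \<in> U C"
    then have u: "u \<in> C" "u \<in> p_elements" by (auto simp: U_def)
    then obtain h z where "h \<in> H" "z \<in> Z" "u = h \<otimes> z" using dec by blast
    with u(2) show "u \<in> H" using p_element_eq(1)[of h u z] Hp by auto
  qed (use HC Hp in \<open>auto simp: U_def\<close>)
  then show "subgroup (U C) G" "card (U C) = q" "\<And>c. c \<in> C \<Longrightarrow> \<exists>u\<in>U C. \<exists>z\<in>Z. c = u \<otimes> z"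
    using HG H dec by auto
qed

lemma act_point:
  assumes "C \<in> points" "g \<in> carrier G"
  shows "act g C \<in> points"
proof -
  obtain x where x: "x \<in> noncentral G" "card (centralizer x) = q * (q - 1)" "C = centralizer x"
    using assms by (elim pointsE)
  have "inj_on (conj g) (centralizer x)" using assms(2) by (auto simp: inj_on_def centralizer_def)
  then have "card (act g C) = q * (q - 1)" using x by (simp add: act_def card_image)
  moreover have "act g C = centralizer (conj g x)" using x assms by (simp add: act_centralizer)
  ultimately show ?thesis using noncentral_conj[OF assms(2) x(1)] by (auto simp: points_def)
qed

lemma U_act: "C \<in> points \<Longrightarrow> g \<in> carrier G \<Longrightarrow> u \<in> U C \<Longrightarrow> conj g u \<in> U (act g C)"
  using p_elements_conj by (auto simp: U_def act_def)

lemma U_carrier: "C \<in> points \<Longrightarrow> u \<in> U C \<Longrightarrow> u \<in> carrier G"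
  using point_props(2) by (auto simp: U_def)

lemma act_self:
  assumes "C \<in> points" "c \<in> C"
  shows "act c C = C"
proof -
  have "conj c x = x" if "x \<in> C" for x
    using that assms point_props[OF assms(1)] conj_fix_iff[of c x] by auto
  then show ?thesis by (simp add: act_def)
qed

lemma act_center: "C \<in> points \<Longrightarrow> z \<in> Z \<Longrightarrow> act z C = C"
  using act_self point_props(4) by blast

text \<open>Otherwise the stabilizer \<open>S\<close> of \<open>D\<close> in \<open>U C\<close> normalizes \<open>U D\<close>, and the product of both has order
  \<open>q * card S\<close>, more than the \<open>p\<close>-part of the order of \<open>G\<close>.\<close>

lemma U_fix_unique:
  assumes C: "C \<in> points" and D: "D \<in> points" and u: "u \<in> U C" "u \<noteq> \<one>"
    and fix_D: "act u D = D"
  shows "D = C"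
proof (rule ccontr)
  assume ne: "D \<noteq> C"
  define S where "S = {s \<in> U C. act s D = D}"
  note UC = U_props[OF C] and UD = U_props[OF D]
  have DG: "D \<subseteq> carrier G" using point_props[OF D] by simp
  have UDG: "U D \<subseteq> carrier G" "U C \<subseteq> carrier G" using U_carrier C D by auto
  have SG: "S \<subseteq> carrier G" using UDG by (auto simp: S_def)
  have subS: "subgroup S G"
  proof (rule subgroupI)
    show "S \<subseteq> carrier G" by fact
    show "S \<noteq> {}" using u fix_D by (auto simp: S_def)
    fix a b assume a: "a \<in> S"
    then show "inv a \<in> S" using SG DG act_inv_eq[of a D D] subgroup.m_inv_closed[OF UC(1), of a]
      by (auto simp: S_def)
    assume b: "b \<in> S"
    then show "a \<otimes> b \<in> S" using a SG DG act_act[of a b D] subgroup.m_closed[OF UC(1), of a b]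
      by (auto simp: S_def)
  qed
  have cS: "conj s v \<in> U D" if "s \<in> S" "v \<in> U D" for s v
    using U_act[OF D, of s v] that SG by (auto simp: S_def)
  define M where "M = (\<lambda>(v, s). v \<otimes> s) ` (U D \<times> S)"
  \<comment> \<open>A coincidence yields an element common to \<open>U D\<close> and
    \<open>U C\<close>; distinct points meet in \<open>Z\<close>, where 1 is the only
    p-element.\<close>
  have "inj_on (\<lambda>(v, s). v \<otimes> s) (U D \<times> S)"
  proof (rule inj_onI, clarify)
    fix v s v' s' assume h: "v \<in> U D" "v' \<in> U D" "s \<in> S" "s' \<in> S"
      and e: "v \<otimes> s = v' \<otimes> s'"
    have car: "v \<in> carrier G" "v' \<in> carrier G" "s \<in> carrier G" "s' \<in> carrier G" using h UDG SG
      by auto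
    have "inv v' \<otimes> v = inv v' \<otimes> (v \<otimes> s) \<otimes> inv s" using car by (simp add: m_assoc)
    also have "\<dots> = s' \<otimes> inv s" unfolding e using car by (simp add: inv_mult_cancel)
    finally have e': "inv v' \<otimes> v = s' \<otimes> inv s" .
    have "inv v' \<otimes> v \<in> U D" using h UD(1) by (simp add: subgroup_closed)
    moreover have "s' \<otimes> inv s \<in> U C"
      using h subS subgroup.m_closed[OF subS, of s' "inv s"] subgroup.m_inv_closed[OF subS, of s]
      by (simp add: S_def)
    ultimately have "inv v' \<otimes> v = \<one>"
      using points_eqI[OF C D, of "inv v' \<otimes> v"] ne p_element_noncentral e' unfolding U_def by auto
    then have "v = v'" using car by (metis inv_mult_cancel(2) r_one)
    then show "v = v' \<and> s = s'" using e car by (metis inv_mult_cancel(1))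
  qed
  then have "card M = q * card S" using UD(2) by (simp add: M_def card_image card_cartesian_product)
  moreover have subM: "subgroup M G"
  proof (rule subgroupI)
    show "M \<subseteq> carrier G" using UDG SG by (auto simp: M_def)
    show "M \<noteq> {}" using u fix_D subgroup.one_closed[OF UD(1)] by (auto simp: M_def S_def)
    fix a b assume "a \<in> M"
    then obtain v s where a: "a = v \<otimes> s" "v \<in> U D" "s \<in> S" by (auto simp: M_def)
    have car: "v \<in> carrier G" "s \<in> carrier G" using a UDG SG by auto
    have "inv a = conj (inv s) (inv v) \<otimes> inv s" using a car by (simp add: inv_mult_group conj_def m_assoc)
    moreover have "inv s \<in> S" "inv v \<in> U D" using a subS UD(1) by (simp_all add: subgroup_closed)
    ultimately show "inv a \<in> M" using cS by (auto simp: M_def)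
    assume "b \<in> M"
    then obtain v' s' where b: "b = v' \<otimes> s'" "v' \<in> U D" "s' \<in> S" by (auto simp: M_def)
    have car': "v' \<in> carrier G" "s' \<in> carrier G" using b UDG SG by auto
    have "a \<otimes> b = (v \<otimes> conj s v') \<otimes> (s \<otimes> s')"
      using car car' by (simp add: a b conj_def m_assoc inv_mult_cancel)
    moreover have "v \<otimes> conj s v' \<in> U D" "s \<otimes> s' \<in> S"
      using a b cS UD(1) subS by (simp_all add: subgroup_closed)
    ultimately show "a \<otimes> b \<in> M" by (auto simp: M_def)
  qed
  moreover have "card M dvd card (carrier G)"
    using subM by (intro card_subgroup_dvd subgroup_self fin) (auto dest: subgroup.subset)
  ultimately have "q * card S dvd q * ((q - 1)^2 * (q + 1))" by (simp only: card_G mult.assoc)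
  then have "card S dvd (q - 1)^2 * (q + 1)" using q_gt unfolding nat_mult_dvd_cancel_disj by auto
  moreover have "card S dvd q"
    using card_subgroup_dvd[OF subS UC(1)] finite_subset_carrier[OF UDG(2)] UC(2) by (auto simp: S_def)
  ultimately have "card S = 1" using coprime_q(5) by (metis coprime_common_divisor_nat nat_dvd_1_iff_1)
  moreover have "card {\<one>, u} \<le> card S"
    using u fix_D subgroup.one_closed[OF subS] finite_subset_carrier[OF SG] by (intro card_mono) (auto simp: S_def)
  ultimately show False using u by simp
qed

text \<open>\<open>U C\<close> has order q and moves each of the q points other than
  \<open>C\<close> freely, so its orbit of \<open>D\<close> is all of them.\<close>

lemma U_transitive:
  assumes C: "C \<in> points" and D: "D \<in> points" "D \<noteq> C" and E: "E \<in> points" "E \<noteq> C"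
  shows "\<exists>u\<in>U C. act u D = E"
proof -
  have DG: "D \<subseteq> carrier G" "C \<subseteq> carrier G" using point_props D C by auto
  have inj: "inj_on (\<lambda>u. act u D) (U C)"
  proof (rule inj_onI)
    fix u v assume uv: "u \<in> U C" "v \<in> U C" "act u D = act v D"
    have car: "u \<in> carrier G" "v \<in> carrier G" using uv U_carrier C by auto
    have "act (inv v \<otimes> u) D = D" using uv car DG by (simp add: act_eq_iff)
    moreover have "inv v \<otimes> u \<in> U C" using uv U_props(1)[OF C] by (simp add: subgroup_closed)
    ultimately have "inv v \<otimes> u = \<one>" using U_fix_unique C D by blast
    then show "u = v" using car by (metis inv_mult_cancel(2) r_one)
  qed
  have "(\<lambda>u. act u D) ` U C = points - {C}"
  proof (rule card_subset_eq)
    show "finite (points - {C})" using finite_points by simp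
    show "(\<lambda>u. act u D) ` U C \<subseteq> points - {C}"
    proof clarify
      fix u assume u: "u \<in> U C"
      then have uG: "u \<in> carrier G" "u \<in> C" using U_carrier C by (auto simp: U_def)
      have "act u D \<noteq> C"
      proof
        assume "act u D = C"
        then have "act u D = act u C" using act_self[OF C uG(2)] by simp
        then show False using D uG DG by (simp add: act_eq_iff)
      qed
      then show "act u D \<in> points - {C}" using act_point D uG by simp
    qed
    show "card ((\<lambda>u. act u D) ` U C) = card (points - {C})"
      using card_image[OF inj] U_props(2)[OF C] card_points C by simp
  qed
  then have "E \<in> (\<lambda>u. act u D) ` U C" using E by simp
  then show ?thesis by auto
qed

end

section \<open>The stabilizer of two points\<close>

text \<open>The frame of the projective line: \<open>P\<close> will be infinity, \<open>Q\<close>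
  the origin and \<open>e\<close> the unit of the field.\<close>

locale gl2_frame = gl2_geometry G q p n for G (structure) and q p n +
  fixes P Q :: "'a set" and e :: 'a
  assumes P: "P \<in> points" and Q: "Q \<in> points" and PQ: "P \<noteq> Q"
    and e: "e \<in> U P" "e \<noteq> \<one>"
begin

text \<open>In GL(2,q) this is the split torus of diagonal matrices, scalars included.\<close>

definition K :: "'a set" where
  "K = {k \<in> carrier G. act k P = P \<and> act k Q = Q}"

lemma points_carrier: "D \<in> points \<Longrightarrow> D \<subseteq> carrier G"
  by (rule point_props(2))

lemmas PC = points_carrier[OF P] and QC = points_carrier[OF Q]

lemma e_carrier: "e \<in> carrier G"
  using U_carrier[OF P e(1)] .

lemma K_carrier: "K \<subseteq> carrier G"
  by (auto simp: K_def)

lemma subgroup_K: "subgroup K G"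
proof (rule subgroupI)
  show "K \<noteq> {}" using PC QC by (auto simp: K_def intro!: exI[of _ \<one>])
  fix a b assume a: "a \<in> K"
  then show "inv a \<in> K" using act_inv_eq PC QC by (auto simp: K_def)
  assume "b \<in> K"
  then show "a \<otimes> b \<in> K" using a PC QC act_act[of a b P] act_act[of a b Q] by (auto simp: K_def)
qed (rule K_carrier)

lemma Z_subset_K: "Z \<subseteq> K"
  using act_center P Q Z_carrier by (auto simp: K_def)

lemma Z_subset_centralizer: "g \<in> carrier G \<Longrightarrow> Z \<subseteq> centralizer g"
proof
  fix z assume "g \<in> carrier G" "z \<in> Z"
  then show "z \<in> centralizer g" using Z_commute[of z g] Z_carrier unfolding centralizer_def by auto
qed

lemma pair_transitive:
  assumes D: "D \<in> points" and E: "E \<in> points" and DE: "D \<noteq> E"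
  shows "\<exists>g \<in> carrier G. act g P = D \<and> act g Q = E"
proof -
  have "\<exists>g \<in> carrier G. act g P = D"
  proof (cases "D = P")
    case True
    then show ?thesis using PC by (intro bexI[of _ \<one>]) auto
  next
    case False
    have "\<not> points \<subseteq> {P, D}"
    proof
      assume "points \<subseteq> {P, D}"
      then have "card points \<le> card {P, D}" by (intro card_mono) auto
      also have "\<dots> \<le> 2" by (rule card_2_iff[THEN iffD2, THEN eq_imp_le]) (use False in auto)
      finally show False using card_points q_gt by simp
    qed
    \<comment> \<open>\<open>U F\<close> fixes \<open>F\<close> and is transitive on the other
      points, so moving \<open>P\<close> to \<open>D\<close> calls for a third point.\<close>
    then obtain F where F: "F \<in> points" "F \<noteq> P" "F \<noteq> D" by blast
    then obtain u where "u \<in> U F" "act u P = D" using U_transitive[OF F(1) P _ D] by blast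
    then show ?thesis using U_carrier F(1) by blast
  qed
  then obtain g where g: "g \<in> carrier G" "act g P = D" by blast
  define E' where "E' = act (inv g) E"
  have E': "E' \<in> points" using E g act_point by (simp add: E'_def)
  have gE': "act g E' = E" using E g points_carrier by (simp add: E'_def act_act)
  have "E' \<noteq> P" using gE' g DE by auto
  then obtain u where u: "u \<in> U P" "act u Q = E'" using U_transitive[OF P Q _ E'] PQ by blast
  have uG: "u \<in> carrier G" and uP: "act u P = P" using u U_carrier P act_self by (auto simp: U_def)
  show ?thesis
  proof (intro bexI conjI)
    show "act (g \<otimes> u) P = D" using act_act[OF g(1) uG PC] uP g by simp
    show "act (g \<otimes> u) Q = E" using act_act[OF g(1) uG QC] u gE' by simp
    show "g \<otimes> u \<in> carrier G" using g uG by simp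
  qed
qed

text \<open>\<open>K\<close> is the stabilizer of an ordered pair of distinct points, and
  \<open>G\<close> is transitive on these q (q + 1) pairs.\<close>

lemma card_K: "card K = (q - 1)^2"
proof -
  define f where "f g = (act g P, act g Q)" for g
  have "card (carrier G) = card (f ` carrier G) * card K"
  proof (rule card_image_subgroup)
    fix g h assume "g \<in> carrier G" "h \<in> carrier G"
    then show "f g = f h \<longleftrightarrow> inv g \<otimes> h \<in> K"
      using act_eq_iff[of h g P P] act_eq_iff[of h g Q Q] PC QC by (auto simp: f_def K_def)
  qed (use subgroup_self subgroup_K K_carrier in auto)
  moreover have "f ` carrier G = points \<times> points - (\<lambda>D. (D, D)) ` points"
  proof (intro equalityI subsetI)
    fix x assume "x \<in> f ` carrier G"
    then obtain g where g: "g \<in> carrier G" "x = (act g P, act g Q)" by (auto simp: f_def)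
    have "act g P \<noteq> act g Q" using g(1) PQ PC QC by (simp add: act_eq_iff)
    then show "x \<in> points \<times> points - (\<lambda>D. (D, D)) ` points" using g P Q act_point by auto
  next
    fix x assume "x \<in> points \<times> points - (\<lambda>D. (D, D)) ` points"
    then obtain D E where x: "x = (D, E)" "D \<in> points" "E \<in> points" "D \<noteq> E" by auto
    then show "x \<in> f ` carrier G" using pair_transitive[of D E] by (auto simp: f_def)
  qed
  moreover have "card (points \<times> points - (\<lambda>D. (D, D)) ` points) = (q + 1) * (q + 1) - (q + 1)"
    using finite_points card_points
    by (subst card_Diff_subset) (auto simp: card_cartesian_product card_image inj_on_def)
  ultimately have "q * (q - 1)^2 * (q + 1) = ((q + 1) * (q + 1) - (q + 1)) * card K" using card_G by simp
  also have "(q + 1) * (q + 1) - (q + 1) = q * (q + 1)" by simp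
  finally have "(q * (q + 1)) * (q - 1)^2 = (q * (q + 1)) * card K" by (simp only: mult_ac)
  then show ?thesis unfolding mult_cancel1 using q_gt by auto
qed

lemma K_conj_U: "k \<in> K \<Longrightarrow> u \<in> U P \<Longrightarrow> conj k u \<in> U P"
  using U_act[OF P, of k u] by (auto simp: K_def)

text \<open>Commuting with \<open>u\<close> puts \<open>k\<close> into \<open>P\<close>, so
  \<open>k\<close> is a product of some \<open>v\<close> in \<open>U P\<close> and a central
  element; since \<open>k\<close> fixes \<open>Q\<close>, so does \<open>v\<close>, which is
  therefore 1.\<close>

lemma K_fix_U:
  assumes k: "k \<in> K" and u: "u \<in> U P" "u \<noteq> \<one>" and fix_u: "conj k u = u"
  shows "k \<in> Z"
proof -
  have kG: "k \<in> carrier G" using k K_carrier by auto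
  have uG: "u \<in> carrier G" using u U_carrier P by auto
  have "u \<in> P" "u \<notin> Z" using u p_element_noncentral by (auto simp: U_def)
  then have "P = centralizer u" using point_eq_centralizer P by blast
  then have "k \<in> P" using fix_u kG uG by (simp add: conj_fix_iff centralizer_def)
  then obtain v z where v: "v \<in> U P" "z \<in> Z" "k = v \<otimes> z" using U_props(3)[OF P] by blast
  have vz: "v \<in> carrier G" "z \<in> carrier G" using v U_carrier P Z_carrier by auto
  have "act v Q = act v (act z Q)" using act_center[OF Q v(2)] by simp
  also have "\<dots> = Q" using k v vz QC by (simp add: act_act K_def)
  finally have "v = \<one>" using U_fix_unique[OF P Q v(1)] PQ by blast
  then show ?thesis using v vz by simp
qed

lemma card_UP_nontrivial: "card (U P - {\<one>}) = q - 1"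
  using U_props(2)[OF P] subgroup.one_closed[OF U_props(1)[OF P]] by (simp add: card_Diff_singleton)

lemma card_conj_e:
  assumes H: "subgroup H G" "H \<subseteq> K" "Z \<subseteq> H"
  shows "card H = card ((\<lambda>g. conj g e) ` H) * card Z"
proof (rule card_image_subgroup[OF H(1) subgroup_center H(3)])
  show "finite H" using H(2) K_carrier finite_subset_carrier by blast
  fix g h assume gh: "g \<in> H" "h \<in> H"
  then have gG: "g \<in> carrier G" "h \<in> carrier G" using H(2) K_carrier by auto
  have "inv g \<otimes> h \<in> K" using gh H by (simp add: subgroup_closed subsetD)
  then have "inv g \<otimes> h \<in> centralizer e \<Longrightarrow> inv g \<otimes> h \<in> Z"
    using K_fix_U[of "inv g \<otimes> h" e] e e_carrier gG by (simp add: centralizer_def conj_fix_iff)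
  then show "conj g e = conj h e \<longleftrightarrow> inv g \<otimes> h \<in> Z"
    using conj_eq_conj_iff[OF gG e_carrier] Z_subset_centralizer[OF e_carrier] by blast
qed

text \<open>Modulo the center, \<open>K\<close> has order q - 1 and acts freely on the q - 1
  nontrivial elements of \<open>U P\<close>.\<close>

lemma K_transitive:
  assumes v: "v \<in> U P" "v \<noteq> \<one>"
  shows "\<exists>k \<in> K. conj k e = v"
proof -
  have "card K = card ((\<lambda>k. conj k e) ` K) * card Z"
    using card_conj_e[OF subgroup_K] Z_subset_K by simp
  then have "(q - 1) * (q - 1) = card ((\<lambda>k. conj k e) ` K) * (q - 1)"
    by (simp only: card_K card_Z power2_eq_square)
  then have c: "card ((\<lambda>k. conj k e) ` K) = q - 1" unfolding mult_cancel2 using q_gt by auto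
  have "(\<lambda>k. conj k e) ` K = U P - {\<one>}"
  proof (rule card_subset_eq)
    show "finite (U P - {\<one>})" using U_carrier P finite_subset_carrier[of "U P"] by auto
    show "(\<lambda>k. conj k e) ` K \<subseteq> U P - {\<one>}"
    proof clarify
      fix k assume k: "k \<in> K"
      then have kG: "k \<in> carrier G" using K_carrier by auto
      have "conj k e \<noteq> conj k \<one>" using kG e e_carrier by (subst conj_eq_iff) auto
      then show "conj k e \<in> U P - {\<one>}" using K_conj_U[OF k e(1)] kG by simp
    qed
  qed (simp add: c card_UP_nontrivial)
  then have "v \<in> (\<lambda>k. conj k e) ` K" using v by simp
  then show ?thesis by auto
qed

text \<open>A unique \<open>u\<close> in \<open>U P\<close> takes \<open>Q\<close> to
  \<open>D\<close>. If \<open>k\<close> fixes \<open>D\<close>, its conjugate of \<open>u\<close>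
  does the same, so \<open>k\<close> commutes with \<open>u\<close>.\<close>

lemma K_fix_third:
  assumes k: "k \<in> K" and D: "D \<in> points" "D \<noteq> P" "D \<noteq> Q" "act k D = D"
  shows "k \<in> Z"
proof -
  obtain u where u: "u \<in> U P" "act u Q = D" using U_transitive[OF P Q _ D(1,2)] PQ by blast
  have car: "u \<in> carrier G" "k \<in> carrier G" using u U_carrier P k K_carrier by auto
  have "u \<noteq> \<one>" using u D(3) QC by auto
  have "act k (act u Q) = act (conj k u) (act k Q)"
    using car QC by (simp add: act_act conj_def m_assoc)
  then have "act u Q = act (conj k u) Q" using k D u by (simp add: K_def)
  then have "act (inv u \<otimes> conj k u) Q = Q" using car QC act_eq_iff[of "conj k u" u Q Q] by simp
  moreover have "inv u \<otimes> conj k u \<in> U P" using K_conj_U[OF k u(1)] u U_props(1)[OF P]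
    by (simp add: subgroup_closed)
  ultimately have "inv u \<otimes> conj k u = \<one>" using U_fix_unique[OF P Q] PQ by blast
  then have "conj k u = u" using car by (metis inv_mult_cancel(2) r_one conj_closed)
  then show ?thesis using K_fix_U[OF k u(1) \<open>u \<noteq> \<one>\<close>] by simp
qed

text \<open>A noncentral \<open>k\<close> in \<open>K\<close> fixes only \<open>P\<close> and
  \<open>Q\<close>, so its centralizer permutes these two and meets \<open>K\<close> in index at
  most 2. Of the three possible centralizer orders only (q - 1)^2 survives: q (q - 1) would make
  \<open>k\<close> fix a single point, and (q - 1) (q + 1) fails by divisibility.\<close>

lemma centralizer_K_cases:
  assumes k: "k \<in> K" "k \<notin> Z"
  shows "K \<subseteq> centralizer k \<or> (q - 1)^2 = 2 * card (centralizer k \<inter> K)"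
proof -
  have kG: "k \<in> carrier G" using k K_carrier by auto
  then have kN: "k \<in> noncentral G" using k by simp
  let ?M = "centralizer k"
  let ?N = "?M \<inter> K"
  have M: "subgroup ?M G" "?M \<subseteq> carrier G" using subgroup_centralizer kG by (auto simp: centralizer_def)
  have N: "subgroup ?N G" using M subgroup_K by (simp add: subgroups_Inter_pair)
  have fixed: "D = P \<or> D = Q" if "D \<in> points" "act k D = D" for D
    using K_fix_third[OF k(1) that(1) _ _ that(2)] k(2) by blast
  have perm: "act g D = P \<or> act g D = Q" if g: "g \<in> ?M" and D: "D = P \<or> D = Q" for g D
  proof -
    have gG: "g \<in> carrier G" "k \<otimes> g = g \<otimes> k" using g by (auto simp: centralizer_def)
    have DC: "D \<subseteq> carrier G" "D \<in> points" "act k D = D" using D PC QC P Q k by (auto simp: K_def)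
    have "act k (act g D) = act g (act k D)"
      by (simp only: act_act[OF kG gG(1) DC(1)] act_act[OF gG(1) kG DC(1)] gG(2))
    then show ?thesis using fixed[of "act g D"] DC act_point gG by simp
  qed
  have "card ?M = card ((\<lambda>g. act g P) ` ?M) * card ?N"
  proof (rule card_image_subgroup)
    fix g h assume gh: "g \<in> ?M" "h \<in> ?M"
    then have gG: "g \<in> carrier G" "h \<in> carrier G" by (auto simp: centralizer_def)
    have ig: "inv g \<otimes> h \<in> ?M" using gh M(1) by (simp add: subgroup_closed)
    have "act (inv g \<otimes> h) P = P \<Longrightarrow> act (inv g \<otimes> h) Q = Q"
      using perm[OF ig, of Q] act_eq_iff[of "inv g \<otimes> h" "inv g \<otimes> h" Q P] gG PC QC PQ by auto
    then show "act g P = act h P \<longleftrightarrow> inv g \<otimes> h \<in> ?N"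
      using act_eq_iff[of h g P P] gG PC ig by (auto simp: K_def)
  qed (use M N finite_subset_carrier in auto)
  moreover have "(\<lambda>g. act g P) ` ?M \<subseteq> {P, Q}" using perm by blast
  then have "card ((\<lambda>g. act g P) ` ?M) \<le> card {P, Q}" by (intro card_mono) auto
  then have "card ((\<lambda>g. act g P) ` ?M) \<le> 2" using PQ by simp
  moreover have "card ?M > 0" using M finite_subset_carrier subgroup.one_closed[OF M(1)]
    by (auto simp: card_gt_0_iff)
  ultimately have c: "card ?M = card ?N \<or> card ?M = 2 * card ?N"
    by (metis One_nat_def Suc_1 le_SucE le_zero_eq mult_1 mult_0 less_irrefl)
  have Ndvd: "card ?N dvd (q - 1) * (q - 1)"
    using card_subgroup_dvd[OF N subgroup_K] card_K K_carrier finite_subset_carrier by (simp add: power2_eq_square)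
  consider "card ?M = (q - 1)^2" | "card ?M = q * (q - 1)" | "card ?M = (q - 1) * (q + 1)"
    using card_centralizer_cases[OF kN] by blast
  then show ?thesis
  proof cases
    case 1
    show ?thesis
    proof (cases "card ?M = card ?N")
      case True
      then have "?N = K" using 1 card_K K_carrier finite_subset_carrier by (intro card_subset_eq) auto
      then show ?thesis by blast
    qed (use c 1 in auto)
  next
    case 2
    then have D: "?M \<in> points" using kN by (auto simp: points_def)
    have "k \<in> ?M" using kG by (simp add: centralizer_def)
    then obtain v z where v: "v \<in> U ?M" "z \<in> Z" "k = v \<otimes> z" using U_props(3)[OF D] by blast
    have vz: "v \<in> carrier G" "z \<in> carrier G" using v U_carrier D Z_carrier by auto
    have "v \<noteq> \<one>" using v vz k by auto
    have "act v E = E" if E: "E = P \<or> E = Q" for E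
    proof -
      have "act v E = act v (act z E)" using act_center[OF _ v(2), of E] E P Q by auto
      also have "\<dots> = E" using k(1) v vz PC QC E by (auto simp: act_act K_def)
      finally show ?thesis .
    qed
    then have "act v P = P" "act v Q = Q" by blast+
    then have "P = ?M" "Q = ?M"
      using U_fix_unique[OF D P v(1) \<open>v \<noteq> \<one>\<close>] U_fix_unique[OF D Q v(1) \<open>v \<noteq> \<one>\<close>] by blast+
    then have "P = Q" by (rule trans[OF _ sym])
    then show ?thesis using PQ by contradiction
  next
    case 3
    obtain t where t: "(q - 1) * (q - 1) = card ?N * t" using Ndvd by (auto simp: dvd_def)
    have "(q - 1) * (q + 1) = card ?N \<or> (q - 1) * (q + 1) = 2 * card ?N" using c 3 by simp
    then have "(q - 1) * ((q + 1) * t) = (q - 1) * (q - 1) \<or> (q - 1) * ((q + 1) * t) = (q - 1) * (2 * (q - 1))"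
    proof (elim disjE)
      assume h: "(q - 1) * (q + 1) = card ?N"
      have "(q - 1) * ((q + 1) * t) = (q - 1) * (q - 1)" unfolding t by (simp only: mult.assoc[symmetric] h)
      then show ?thesis by blast
    next
      assume h: "(q - 1) * (q + 1) = 2 * card ?N"
      have "(q - 1) * ((q + 1) * t) = 2 * (card ?N * t)" by (simp only: mult.assoc[symmetric] h)
      also have "\<dots> = (q - 1) * (2 * (q - 1))" unfolding t[symmetric] by (simp only: mult_ac)
      finally show ?thesis by blast
    qed
    then have *: "(q + 1) * t = q - 1 \<or> (q + 1) * t = 2 * (q - 1)" unfolding mult_cancel1 using q_gt by auto
    \<comment> \<open>\<open>t = 1\<close> would force q = 3, and for \<open>t \<ge> 2\<close> the
      left-hand side is too large.\<close>
    consider "t = 0" | "t = 1" | "t \<ge> 2" by linarith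
    then show ?thesis
    proof cases
      case 3
      then have "(q + 1) * 2 \<le> (q + 1) * t" by (rule mult_le_mono2)
      moreover obtain s where s: "s = (q + 1) * t" by blast
      ultimately show ?thesis using * q_gt unfolding s[symmetric] by auto
    qed (use * q_gt in auto)
  qed
qed

text \<open>If \<open>K\<close> centralizes none of its noncentral elements, the centralizers of any two noncommuting ones
  have index 2 in \<open>K\<close> and meet in \<open>Z\<close>. This leaves only \<open>q = 5\<close>, where an element of \<open>K\<close>
  conjugating \<open>e\<close> to its square has order 4 modulo \<open>Z\<close>.\<close>

lemma K_commute:
  assumes "a \<in> K" "b \<in> K"
  shows "a \<otimes> b = b \<otimes> a"
proof (cases "\<exists>k \<in> K - Z. K \<subseteq> centralizer k")
  case True
  then obtain k where k: "k \<in> K" "k \<notin> Z" "K \<subseteq> centralizer k" by blast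
  then have "k \<in> noncentral G" using K_carrier by auto
  then show ?thesis using centralizer_commute k assms by blast
next
  case False
  have half: "(q - 1)^2 = 2 * card (centralizer k \<inter> K)" if "k \<in> K" "k \<notin> Z" for k
    using centralizer_K_cases[OF that] False that by blast
  have finK: "finite K" using finite_subset_carrier K_carrier by blast
  have sub: "subgroup (centralizer k \<inter> K) G" if "k \<in> K" for k
    using subgroup_centralizer subgroup_K that K_carrier by (auto simp: subgroups_Inter_pair)
  have "\<not> K \<subseteq> Z"
  proof
    assume "K \<subseteq> Z"
    then have "card K \<le> card Z" using Z_carrier finite_subset_carrier by (intro card_mono) auto
    then have "(q - 1) * (q - 1) \<le> (q - 1) * 1" using card_K card_Z by (simp add: power2_eq_square)
    then show False using q_gt by simp
  qed
  then obtain k where k: "k \<in> K" "k \<notin> Z" by blast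
  then obtain l where l: "l \<in> K" "l \<notin> centralizer k" using False by blast
  have kl: "k \<in> noncentral G" "l \<in> carrier G" using k l K_carrier by auto
  have "l \<notin> Z"
  proof
    assume "l \<in> Z"
    then have "k \<otimes> l = l \<otimes> k" using Z_commute[of l k] kl by simp
    then show False using l kl by (simp add: centralizer_def)
  qed
  \<comment> \<open>The centralizer of \<open>l\<close> has index 2 in \<open>K\<close>, so
    \<open>l\<close> has two conjugates under \<open>K\<close>. As the centralizers of
    \<open>k\<close> and \<open>l\<close> meet in \<open>Z\<close>, at most 2 (q - 1) elements of
    \<open>K\<close> commute with \<open>k\<close>; but half of all (q - 1)^2 do, so q is at most
    5.\<close>
  have card_img: "card K = card ((\<lambda>g. conj g l) ` K) * card (centralizer l \<inter> K)"
  proof (rule card_image_subgroup[OF subgroup_K sub[OF l(1)] _ finK])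
    fix g h assume gh: "g \<in> K" "h \<in> K"
    have "inv g \<otimes> h \<in> K" using gh subgroup_K by (simp add: subgroup_closed)
    then show "conj g l = conj h l \<longleftrightarrow> inv g \<otimes> h \<in> centralizer l \<inter> K"
      using conj_eq_conj_iff[of g h l] gh kl K_carrier by auto
  qed auto
  have meet: "y \<in> Z" if y: "y \<in> centralizer k" "y \<in> centralizer l" for y
  proof (rule ccontr)
    assume "y \<notin> Z"
    then have yN: "y \<in> noncentral G" using y by (auto simp: centralizer_def)
    have "k \<otimes> y = y \<otimes> k" "l \<otimes> y = y \<otimes> l" using y by (auto simp: centralizer_def)
    then have "k \<otimes> l = l \<otimes> k" using comm_trans[of k y l] yN kl by simp
    then show False using l kl by (simp add: centralizer_def)
  qed
  have card_N: "card (centralizer k \<inter> K) = card ((\<lambda>g. conj g l) ` (centralizer k \<inter> K)) * card Z"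
  proof (rule card_image_subgroup[OF sub[OF k(1)] subgroup_center])
    show "Z \<subseteq> centralizer k \<inter> K" using Z_subset_K Z_subset_centralizer kl by blast
    show "finite (centralizer k \<inter> K)" using finK by simp
    fix g h assume gh: "g \<in> centralizer k \<inter> K" "h \<in> centralizer k \<inter> K"
    then have gG: "g \<in> carrier G" "h \<in> carrier G" using K_carrier by auto
    have "inv g \<otimes> h \<in> centralizer k"
      using gh subgroup_centralizer[of k] kl by (simp add: subgroup_closed)
    moreover have "inv g \<otimes> h \<in> Z \<Longrightarrow> inv g \<otimes> h \<in> centralizer l"
      using Z_commute[of "inv g \<otimes> h" l] kl gG by (simp add: centralizer_def)
    ultimately show "conj g l = conj h l \<longleftrightarrow> inv g \<otimes> h \<in> Z"
      using conj_eq_conj_iff[OF gG kl(2)] meet by blast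
  qed
  have "card (centralizer l \<inter> K) > 0" using half[OF l(1) \<open>l \<notin> Z\<close>] q_gt
    by (cases "card (centralizer l \<inter> K)") auto
  moreover have "card ((\<lambda>g. conj g l) ` K) * card (centralizer l \<inter> K) = 2 * card (centralizer l \<inter> K)"
    using card_img half[OF l(1) \<open>l \<notin> Z\<close>] card_K by simp
  ultimately have "card ((\<lambda>g. conj g l) ` K) = 2" by simp
  moreover have "card ((\<lambda>g. conj g l) ` (centralizer k \<inter> K)) \<le> card ((\<lambda>g. conj g l) ` K)"
    using finK by (intro card_mono) auto
  ultimately have "card (centralizer k \<inter> K) \<le> 2 * (q - 1)" using card_N card_Z by simp
  then have "(q - 1) * (q - 1) \<le> (q - 1) * 4" using half[OF k] by (simp add: power2_eq_square)
  then have "q \<le> 5" using q_gt by simp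
  moreover have "q \<noteq> 4"
  proof
    assume "q = 4"
    then have "2 * card (centralizer k \<inter> K) = 9" using half[OF k] by simp
    then show False by presburger
  qed
  ultimately have q5: "q = 5" using q_gt by simp
  have "e [^] q = \<one>" using e by (simp add: U_def p_elements_def)
  then have e5: "e [^] (5::nat) = \<one>" by (simp only: q5)
  have e_pow: "e [^] (i::nat) \<noteq> \<one>" if "coprime i 5" for i
    using coprime_pow_eq_one[OF e_carrier _ e5 that] e by blast
  have cop: "coprime (2::nat) 5" "coprime (3::nat) 5" by (simp_all add: coprime_iff_gcd_eq_1 gcd_non_0_nat)
  have ee: "e \<otimes> e \<noteq> \<one>" "e \<otimes> e \<otimes> e \<noteq> \<one>"
    using e_pow[OF cop(1)] e_pow[OF cop(2)] e_carrier by (simp_all add: numeral_2_eq_2 numeral_3_eq_3)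
  have e2: "e [^] (2::nat) \<in> U P" "e [^] (2::nat) \<noteq> \<one>"
    using U_props(1)[OF P] e ee(1) e_carrier by (simp_all add: numeral_2_eq_2 subgroup.m_closed)
  obtain c where c: "c \<in> K" "conj c e = e [^] (2::nat)" using K_transitive[OF e2] by blast
  have cG: "c \<in> carrier G" using c K_carrier by auto
  have "c \<notin> Z"
  proof
    assume "c \<in> Z"
    then have "conj c e = e" using Z_commute[of c e] e_carrier cG by (simp add: conj_fix_iff)
    then have "e = e \<otimes> e" using c e_carrier by (simp add: numeral_2_eq_2)
    then show False using e e_carrier by simp
  qed
  \<comment> \<open>With q = 5, \<open>?N\<close> has order 8 and \<open>Z\<close> order 4, so
    \<open>e\<close> has two conjugates under \<open>?N\<close>. But 1, \<open>c\<close> and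
    \<open>c \<otimes> c\<close> conjugate \<open>e\<close> to its powers 1, 2 and 4, which differ
    because \<open>e\<close> has order 5.\<close>
  let ?N = "centralizer c \<inter> K"
  have cc: "conj (c \<otimes> c) e = e [^] (4::nat)"
  proof -
    have "conj (c \<otimes> c) e = conj c (conj c e)" using cG e_carrier by (simp add: conj_conj)
    also have "\<dots> = (e [^] (2::nat)) [^] (2::nat)" using cG e_carrier by (simp add: c(2) conj_pow)
    also have "\<dots> = e [^] (4::nat)" using e_carrier by (simp add: nat_pow_pow)
    finally show ?thesis .
  qed
  have card_N: "card ?N = card ((\<lambda>g. conj g e) ` ?N) * card Z"
    by (rule card_conj_e[OF sub[OF c(1)]]) (use Z_subset_K Z_subset_centralizer cG in blast)+
  have "card ?N = 8" using half[OF c(1) \<open>c \<notin> Z\<close>] q5 by simp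
  then have img2: "card ((\<lambda>g. conj g e) ` ?N) = 2" using card_N card_Z q5 by simp
  have "\<one> \<in> ?N" "c \<in> ?N" "c \<otimes> c \<in> ?N"
    using cG c(1) subgroup_K by (auto simp: centralizer_def subgroup.one_closed subgroup.m_closed m_assoc)
  then have "{e, e [^] (2::nat), e [^] (4::nat)} \<subseteq> (\<lambda>g. conj g e) ` ?N"
    using c(2) cc e_carrier
      by (auto simp: image_iff intro: bexI[of _ \<one>] bexI[of _ c] bexI[of _ "c \<otimes> c"])
  then have "card {e, e [^] (2::nat), e [^] (4::nat)} \<le> 2"
    using img2 finK by (metis card_mono finite_Int finite_imageI)
  moreover have "e \<noteq> e [^] (2::nat)" using e e_carrier by (simp add: numeral_2_eq_2)
  moreover have "e [^] (4::nat) = e \<otimes> (e \<otimes> e \<otimes> e)" "e [^] (4::nat) = e [^] (2::nat) \<otimes> (e \<otimes> e)"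
    using e_carrier by (simp_all add: numeral_eq_Suc m_assoc)
  then have "e \<noteq> e [^] (4::nat)" "e [^] (2::nat) \<noteq> e [^] (4::nat)"
    using ee e_carrier by (metis l_cancel_one' m_closed nat_pow_closed)+
  ultimately show ?thesis by simp
qed

end

section \<open>The field of coordinates and the action on the projective line\<close>

text \<open>The elements inverted by \<open>\<sigma>\<close> form, together with 0, an additive subgroup \<open>L\<close>. It contains all quotients
  of \<open>b\<close> by \<open>\<sigma> b\<close>, hence more than half of the field.\<close>

lemma multiplicative_involution_eq_inverse:
  fixes \<sigma> :: "'f::{field,finite} \<Rightarrow> 'f"
  assumes nz: "\<And>a. a \<noteq> 0 \<Longrightarrow> \<sigma> a \<noteq> 0"
    and mult: "\<And>a b. a \<noteq> 0 \<Longrightarrow> b \<noteq> 0 \<Longrightarrow> \<sigma> (a * b) = \<sigma> a * \<sigma> b"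
    and invol: "\<And>a. a \<noteq> 0 \<Longrightarrow> \<sigma> (\<sigma> a) = a"
    and few: "card {a. a \<noteq> 0 \<and> \<sigma> a = a} \<le> 2"
    and eq: "\<And>t. t \<noteq> 0 \<Longrightarrow> t \<noteq> 1 \<Longrightarrow> \<sigma> (1 - \<sigma> t) = 1 - \<sigma> (1 - t)"
    and "a \<noteq> 0"
  shows "\<sigma> a = inverse a"
proof -
  define L where "L = {a. a = 0 \<or> a * \<sigma> a = 1}"
  have one: "\<sigma> 1 = 1" using mult[of 1 1] nz[of 1] by simp
  have m1: "\<sigma> (- 1) = - 1"
  proof -
    have "\<sigma> (- 1) * \<sigma> (- 1) = 1" using mult[of "- 1" "- 1"] one by simp
    then have "(\<sigma> (- 1) - 1) * (\<sigma> (- 1) + 1) = 0" by (simp add: algebra_simps)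
    then consider "\<sigma> (- 1) = 1" | "\<sigma> (- 1) = - 1" by (auto simp: add_eq_0_iff2)
    then show ?thesis
    proof cases
      case 1
      then have "- 1 = (1::'f)" using invol[of "- 1"] one by simp
      then show ?thesis using 1 by simp
    qed
  qed
  have sinv: "\<sigma> (inverse b) = inverse (\<sigma> b)" if "b \<noteq> 0" for b
    using mult[of b "inverse b"] that one by (simp add: inverse_unique)
  have Lmult: "b * c \<in> L" if "b \<in> L" "c \<in> L" for b c
  proof (cases "b = 0 \<or> c = 0")
    case False
    then have "b * c * \<sigma> (b * c) = (b * \<sigma> b) * (c * \<sigma> c)" by (simp add: mult)
    moreover have "b * \<sigma> b = 1" "c * \<sigma> c = 1" using that False by (auto simp: L_def)
    ultimately have "b * c * \<sigma> (b * c) = 1" by simp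
    then show ?thesis by (simp only: L_def mem_Collect_eq simp_thms)
  qed (auto simp: L_def)
  have Linv: "inverse b \<in> L" if "b \<in> L" for b
  proof (cases "b = 0")
    case False
    then have "inverse b * \<sigma> (inverse b) = inverse (b * \<sigma> b)" by (simp add: sinv)
    moreover have "b * \<sigma> b = 1" using that False by (auto simp: L_def)
    ultimately have "inverse b * \<sigma> (inverse b) = 1" by simp
    then show ?thesis by (simp only: L_def mem_Collect_eq simp_thms)
  qed (simp add: L_def)
  have L1: "1 - t \<in> L" if t: "t \<in> L" for t
  proof (cases "t = 0 \<or> t = 1")
    case False
    then have st: "\<sigma> t = inverse t" using t by (auto simp: L_def inverse_unique)
    \<comment> \<open>For \<open>t\<close> inverted by \<open>\<sigma>\<close> the functional
      equation becomes - s t = 1 - s, that is, (1 - t) s = 1.\<close>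
    define s where "s = \<sigma> (1 - t)"
    have "1 - \<sigma> t = - 1 * ((1 - t) * inverse t)" using False by (simp add: st field_simps)
    moreover have "\<sigma> ((1 - t) * inverse t) = s * t"
      using False st invol[of t] mult[of "1 - t" "inverse t"] by (simp add: s_def)
    moreover have "(- 1 :: 'f) \<noteq> 0" "(1 - t) * inverse t \<noteq> 0" using False by auto
    note mult[OF this]
    ultimately have "\<sigma> (1 - \<sigma> t) = - 1 * (s * t)" by (simp only: m1)
    then have "- 1 * (s * t) = 1 - s" using eq[of t] False by (simp add: s_def)
    then have "(1 - t) * s = 1" by (simp add: algebra_simps)
    then show ?thesis by (simp add: L_def s_def)
  qed (auto simp: L_def one)
  have Ldiff: "b - c \<in> L" if b: "b \<in> L" and c: "c \<in> L" for b c
  proof (cases "b = 0")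
    case True
    have "- 1 \<in> L" by (simp add: L_def m1)
    then have "- 1 * c \<in> L" using c by (rule Lmult)
    then show ?thesis using True by simp
  next
    case False
    have "b * (1 - c * inverse b) \<in> L" using b c by (intro Lmult L1 Linv)
    moreover have "b * (1 - c * inverse b) = b - c" using False by (simp add: field_simps)
    ultimately show ?thesis by simp
  qed
  have zero: "0 \<in> L" by (simp add: L_def)
  let ?N = "UNIV - {0 :: 'f}"
  define g where "g b = b * inverse (\<sigma> b)" for b
  \<comment> \<open>Each fibre of \<open>g\<close> lies in a multiplicative coset of the fixed
    points of \<open>\<sigma>\<close>, so it has at most two elements.\<close>
  have fib: "card {b. b \<in> ?N \<and> g b = y} \<le> 2" if y: "y \<in> g ` ?N" for y
  proof -
    obtain c where c: "c \<noteq> 0" "y = g c" using y by auto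
    have "{b. b \<in> ?N \<and> g b = y} \<subseteq> (\<lambda>d. c * d) ` {a. a \<noteq> 0 \<and> \<sigma> a = a}"
    proof
      fix b assume "b \<in> {b. b \<in> ?N \<and> g b = y}"
      then have b: "b \<noteq> 0" "g b = y" by auto
      have "b * \<sigma> c = c * \<sigma> b" using b c nz by (simp add: g_def field_simps)
      then have "\<sigma> b * inverse (\<sigma> c) = b * inverse c" using b(1) c(1) nz by (simp add: field_simps)
      moreover have "\<sigma> (b * inverse c) = \<sigma> b * inverse (\<sigma> c)"
        using mult[of b "inverse c"] sinv b(1) c(1) by simp
      ultimately have "\<sigma> (b * inverse c) = b * inverse c" by (rule trans[rotated])
      moreover have "b = c * (b * inverse c)" using c by simp
      ultimately show "b \<in> (\<lambda>d. c * d) ` {a. a \<noteq> 0 \<and> \<sigma> a = a}" using b(1) c(1)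
        by (intro image_eqI[of _ _ "b * inverse c"]) (simp_all only: mem_Collect_eq mult_eq_0_iff inverse_nonzero_iff_nonzero simp_thms)
    qed
    then have "card {b. b \<in> ?N \<and> g b = y} \<le> card {a. a \<noteq> 0 \<and> \<sigma> a = a}"
      by (rule surj_card_le[rotated]) simp
    then show ?thesis using few by simp
  qed
  have "card ?N = (\<Sum>y\<in>g ` ?N. \<Sum>b\<in>{b. b \<in> ?N \<and> g b = y}. 1)"
    using sum.image_gen[of ?N "\<lambda>_. 1::nat" g] by simp
  also have "\<dots> \<le> (\<Sum>y\<in>g ` ?N. 2)" by (rule sum_mono) (use fib in simp)
  finally have "CARD('f) - 1 \<le> 2 * card (g ` ?N)" by (simp add: card_Diff_singleton)
  moreover have "g ` ?N \<subseteq> L - {0}"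
  proof (rule image_subsetI)
    fix b assume "b \<in> ?N"
    then have b: "b \<noteq> 0" by simp
    have "\<sigma> (g b) = \<sigma> b * inverse b" using b nz by (simp add: g_def mult sinv invol)
    moreover have "g b * (\<sigma> b * inverse b) = 1" using b nz by (simp add: g_def field_simps)
    moreover have "g b \<noteq> 0" using b nz by (simp add: g_def)
    ultimately show "g b \<in> L - {0}" by (simp add: L_def)
  qed
  then have "card (g ` ?N) \<le> card (L - {0})" by (intro card_mono) auto
  moreover have "card L = Suc (card (L - {0}))" using zero by (intro card.remove) auto
  moreover have "CARD('f) > 0" by simp
  ultimately have big: "CARD('f) + 1 \<le> 2 * card L" by linarith
  have "L = UNIV"
  proof (rule ccontr)
    assume "L \<noteq> UNIV"
    then obtain b where b: "b \<notin> L" by blast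
    \<comment> \<open>Two disjoint cosets of an additive subgroup with more than half of the
      elements do not fit into the field.\<close>
    have "L \<inter> (\<lambda>c. b + c) ` L = {}"
    proof (rule ccontr)
      assume "L \<inter> (\<lambda>c. b + c) ` L \<noteq> {}"
      then obtain c where "b + c \<in> L" "c \<in> L" by auto
      then show False using Ldiff[of "b + c" c] b by simp
    qed
    then have "card (L \<union> (\<lambda>c. b + c) ` L) = card L + card L"
      by (subst card_Un_disjoint) (auto simp: card_image)
    moreover have "card (L \<union> (\<lambda>c. b + c) ` L) \<le> CARD('f)" by (rule card_mono) auto
    ultimately show False using big by simp
  qed
  then have "a * \<sigma> a = 1" using \<open>a \<noteq> 0\<close> by (auto simp: L_def)
  then show ?thesis by (simp add: inverse_unique)
qed

text \<open>The geometry enters the rest of the proof through this interface: an action on the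
  projective line over \<open>'f\<close> with kernel \<open>Z\<close>, and p-elements
  \<open>x t\<close> over the translations. In \<open>fix_commute\<close> the stabilizer of 0 and
  infinity is abelian in \<open>G\<close> itself, which is stronger than commuting of the induced
  maps.\<close>

locale gl2_action = gl2_geometry G q p n for G (structure) and q p n +
  fixes x :: "'f::{field,finite} \<Rightarrow> 'a"
    and \<alpha> :: "'a \<Rightarrow> 'f option \<Rightarrow> 'f option"
  assumes card_f: "CARD('f) = q"
    and x_p: "\<And>t. x t \<in> p_elements" and x_add: "\<And>s t. x (s + t) = x s \<otimes> x t"
    and \<alpha>_x: "\<And>t. \<alpha> (x t) = map_option (\<lambda>s. t + s)"
    and \<alpha>_mult: "\<And>g h. g \<in> carrier G \<Longrightarrow> h \<in> carrier G \<Longrightarrow> \<alpha> (g \<otimes> h) = \<alpha> g \<circ> \<alpha> h"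
    and \<alpha>_id: "\<And>g. g \<in> carrier G \<Longrightarrow> \<alpha> g = id \<longleftrightarrow> g \<in> Z"
    and scale: "\<And>a. a \<noteq> 0 \<Longrightarrow> \<exists>k \<in> carrier G. \<alpha> k = map_option (\<lambda>s. a * s)"
    and fix_scale: "\<And>k. k \<in> carrier G \<Longrightarrow> \<alpha> k None = None \<Longrightarrow> \<alpha> k (Some 0) = Some 0 \<Longrightarrow>
      \<exists>a. a \<noteq> 0 \<and> \<alpha> k = map_option (\<lambda>s. a * s)"
    and fix_commute: "\<And>k l. k \<in> carrier G \<Longrightarrow> l \<in> carrier G \<Longrightarrow> \<alpha> k None = None \<Longrightarrow> \<alpha> k (Some 0) = Some 0 \<Longrightarrow>
      \<alpha> l None = None \<Longrightarrow> \<alpha> l (Some 0) = Some 0 \<Longrightarrow> k \<otimes> l = l \<otimes> k"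
    and inversion: "\<exists>n \<in> carrier G. \<alpha> n = (\<lambda>s. case s of None \<Rightarrow> Some 0 | Some t \<Rightarrow> if t = 0 then None else Some (- inverse t))"

section \<open>The field structure on \<open>U P\<close>\<close>

context gl2_frame
begin

text \<open>Multiplication by \<open>conj k e\<close> is conjugation by \<open>k\<close>, which does not depend on the choice of \<open>k\<close> in \<open>K\<close>.\<close>

definition smul :: "'a \<Rightarrow> 'a \<Rightarrow> 'a" where
  "smul a b = (if a = \<one> then \<one> else conj (SOME k. k \<in> K \<and> conj k e = a) b)"

definition root_field :: "'a ring" where
  "root_field = \<lparr>carrier = U P, monoid.mult = smul, one = e, zero = \<one>, add = (\<otimes>)\<rparr>"

lemma UP_carrier: "u \<in> U P \<Longrightarrow> u \<in> carrier G"
  by (rule U_carrier[OF P])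

lemma UP_closed: "u \<in> U P \<Longrightarrow> v \<in> U P \<Longrightarrow> u \<otimes> v \<in> U P" "\<one> \<in> U P" "u \<in> U P \<Longrightarrow> inv u \<in> U P"
  using U_props(1)[OF P] by (simp_all add: subgroup.m_closed subgroup.one_closed subgroup.m_inv_closed)

lemma UP_commute: "u \<in> U P \<Longrightarrow> v \<in> U P \<Longrightarrow> u \<otimes> v = v \<otimes> u"
  using point_props(5)[OF P] by (simp add: U_def)

lemma KC: "k \<in> K \<Longrightarrow> k \<in> carrier G"
  using K_carrier by auto

lemma K_conj_unique:
  assumes "k \<in> K" "l \<in> K" "conj k e = conj l e" "b \<in> carrier G"
  shows "conj k b = conj l b"
proof -
  have kl: "inv k \<otimes> l \<in> K" using assms subgroup_K by (simp add: subgroup_closed)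
  have "inv k \<otimes> l \<in> centralizer e" using assms KC e_carrier conj_eq_conj_iff by blast
  then have "conj (inv k \<otimes> l) e = e" using assms KC e_carrier by (simp add: centralizer_def conj_fix_iff)
  then have "inv k \<otimes> l \<in> Z" using K_fix_U[OF kl e] by simp
  then have "inv k \<otimes> l \<in> centralizer b" using Z_subset_centralizer assms(4) by blast
  then show ?thesis using assms KC conj_eq_conj_iff by blast
qed

lemma conj_K_nontrivial: "k \<in> K \<Longrightarrow> b \<in> U P \<Longrightarrow> b \<noteq> \<one> \<Longrightarrow> conj k b \<noteq> \<one>"
  using conj_eq_iff[of k b \<one>] KC UP_carrier by auto

lemma smul_conj: "k \<in> K \<Longrightarrow> b \<in> U P \<Longrightarrow> smul (conj k e) b = conj k b"
proof -
  assume k: "k \<in> K" and b: "b \<in> U P"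
  let ?l = "SOME l. l \<in> K \<and> conj l e = conj k e"
  have "?l \<in> K \<and> conj ?l e = conj k e" by (rule someI) (use k in blast)
  then have "conj ?l b = conj k b" using K_conj_unique[of ?l k b] k UP_carrier[OF b] by blast
  then show ?thesis using conj_K_nontrivial[OF k e] by (simp add: smul_def)
qed

lemma UP_cases:
  assumes "a \<in> U P"
  obtains "a = \<one>" | k where "k \<in> K" "a = conj k e" "a \<noteq> \<one>"
  using K_transitive[of a] assms by blast

lemma smul_one_left [simp]: "smul \<one> b = \<one>"
  by (simp add: smul_def)

lemma smul_closed: "a \<in> U P \<Longrightarrow> b \<in> U P \<Longrightarrow> smul a b \<in> U P"
  by (erule UP_cases[of a]) (simp_all add: UP_closed smul_conj K_conj_U)

lemma smul_one_right: "a \<in> U P \<Longrightarrow> smul a \<one> = \<one>"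
  by (erule UP_cases[of a]) (simp_all add: UP_closed smul_conj KC)

text \<open>The two products are the conjugates of \<open>e\<close> by \<open>k \<otimes> l\<close>
  and by \<open>l \<otimes> k\<close>, so the multiplication is commutative because \<open>K\<close>
  is.\<close>

lemma smul_commute:
  assumes a: "a \<in> U P" and b: "b \<in> U P"
  shows "smul a b = smul b a"
proof (cases rule: UP_cases[OF a])
  case 1
  then show ?thesis using b by (simp add: smul_one_right)
next
  case (2 k)
  note k = 2
  show ?thesis
  proof (cases rule: UP_cases[OF b])
    case 1
    then show ?thesis using a by (simp add: smul_one_right)
  next
    case (2 l)
    have "smul a b = conj (k \<otimes> l) e" using k 2 b e_carrier KC by (simp add: smul_conj conj_conj)
    moreover have "smul b a = conj (l \<otimes> k) e" using k 2 a e_carrier KC by (simp add: smul_conj conj_conj)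
    ultimately show ?thesis using K_commute[OF k(1) 2(1)] by simp
  qed
qed

lemma smul_assoc:
  assumes a: "a \<in> U P" and b: "b \<in> U P" and c: "c \<in> U P"
  shows "smul (smul a b) c = smul a (smul b c)"
proof (cases rule: UP_cases[OF a])
  case (2 k)
  note k = 2
  show ?thesis
  proof (cases rule: UP_cases[OF b])
    case 1
    then show ?thesis using a by (simp add: smul_one_right)
  next
    case (2 l)
    have kl: "k \<otimes> l \<in> K" using k 2 subgroup_K by (simp add: subgroup_closed)
    have "smul a b = conj (k \<otimes> l) e" using k 2 b e_carrier KC by (simp add: smul_conj conj_conj)
    then have "smul (smul a b) c = conj (k \<otimes> l) c" using kl c by (simp add: smul_conj)
    also have "\<dots> = conj k (conj l c)" using k 2 c KC UP_carrier by (simp add: conj_conj)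
    also have "\<dots> = smul a (smul b c)" using k 2 c by (simp add: smul_conj K_conj_U)
    finally show ?thesis .
  qed
qed simp

lemma smul_distrib:
  assumes a: "a \<in> U P" and b: "b \<in> U P" and c: "c \<in> U P"
  shows "smul a (b \<otimes> c) = smul a b \<otimes> smul a c"
  by (cases rule: UP_cases[OF a]) (use assms in \<open>simp_all add: smul_conj UP_closed conj_mult KC UP_carrier\<close>)

lemma one_in_K: "\<one> \<in> K"
  using subgroup_K by (rule subgroup.one_closed)

lemma smul_e: "b \<in> U P \<Longrightarrow> smul e b = b"
  using smul_conj[OF one_in_K, of b] e_carrier UP_carrier by simp

lemma field_root_field: "field root_field"
proof (rule cring.cring_fieldI)
  show "cring root_field"
  proof (rule cringI)
    show "abelian_group root_field"
    proof (rule abelian_groupI)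
      fix x assume "x \<in> carrier root_field"
      then show "\<exists>y \<in> carrier root_field. y \<oplus>\<^bsub>root_field\<^esub> x = \<zero>\<^bsub>root_field\<^esub>"
        using UP_closed UP_carrier by (intro bexI[of _ "inv x"]) (simp_all add: root_field_def)
    qed (simp_all add: root_field_def UP_closed UP_carrier m_assoc, simp_all add: UP_commute)
    show "comm_monoid root_field"
      by (rule comm_monoidI) (simp_all add: root_field_def smul_closed smul_assoc smul_e e, simp_all add: smul_commute)
    show "(x \<oplus>\<^bsub>root_field\<^esub> y) \<otimes>\<^bsub>root_field\<^esub> z = x \<otimes>\<^bsub>root_field\<^esub> z \<oplus>\<^bsub>root_field\<^esub> y \<otimes>\<^bsub>root_field\<^esub> z"
      if "x \<in> carrier root_field" "y \<in> carrier root_field" "z \<in> carrier root_field" for x y z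
      using that smul_distrib[of z x y] smul_commute[of z] UP_closed by (simp add: root_field_def)
  qed
  show "Units root_field = carrier root_field - {\<zero>\<^bsub>root_field\<^esub>}"
  proof (intro equalityI subsetI)
    fix a assume a: "a \<in> Units root_field"
    then obtain b where "a \<in> U P" "b \<in> U P" "smul b a = e" by (auto simp: Units_def root_field_def)
    then show "a \<in> carrier root_field - {\<zero>\<^bsub>root_field\<^esub>}" using e smul_one_right
      by (auto simp: root_field_def)
  next
    fix a assume "a \<in> carrier root_field - {\<zero>\<^bsub>root_field\<^esub>}"
    then have a: "a \<in> U P" "a \<noteq> \<one>" by (auto simp: root_field_def)
    then obtain k where k: "k \<in> K" "a = conj k e" using K_transitive by metis
    have ik: "inv k \<in> K" using k subgroup_K by (simp add: subgroup_closed)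
    let ?b = "conj (inv k) e"
    have b: "?b \<in> U P" using K_conj_U[OF ik e(1)] .
    have "smul ?b a = e" using ik a k KC e_carrier by (simp add: smul_conj)
    then show "a \<in> Units root_field"
      using a b smul_commute[OF a(1) b] by (auto simp: Units_def root_field_def)
  qed
qed

text \<open>Under the isomorphism of fields, conjugation by \<open>k\<close> becomes multiplication
  by the coordinate of \<open>conj k e\<close>; all nonzero scalars occur because \<open>K\<close>
  is transitive.\<close>

lemma coordinates_U:
  assumes "CARD('f::{field,finite}) = q"
  obtains x :: "'f::{field,finite} \<Rightarrow> 'a" where "bij_betw x UNIV (U P)" "\<And>s t. x (s + t) = x s \<otimes> x t"
    "\<And>k. k \<in> K \<Longrightarrow> \<exists>a. a \<noteq> 0 \<and> (\<forall>t. conj k (x t) = x (a * t))"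
    "\<And>a. a \<noteq> 0 \<Longrightarrow> \<exists>k \<in> K. \<forall>t. conj k (x t) = x (a * t)"
proof -
  have finR: "finite (carrier root_field)"
    using finite_subset_carrier UP_carrier by (auto simp: root_field_def)
  have cardR: "card (carrier root_field) = p ^ n" using U_props(2)[OF P]
    unfolding q_eq[symmetric] root_field_def by simp
  have cardf: "CARD('f) = p ^ n" using assms by (simp only: q_eq)
  obtain \<phi> :: "'a \<Rightarrow> 'f" where \<phi>': "bij_betw \<phi> (carrier root_field) UNIV"
    and add': "\<And>a b. a \<in> carrier root_field \<Longrightarrow> b \<in> carrier root_field \<Longrightarrow> \<phi> (a \<oplus>\<^bsub>root_field\<^esub> b) = \<phi> a + \<phi> b"
    and mult': "\<And>a b. a \<in> carrier root_field \<Longrightarrow> b \<in> carrier root_field \<Longrightarrow> \<phi> (a \<otimes>\<^bsub>root_field\<^esub> b) = \<phi> a * \<phi> b"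
    using finite_field_unique[OF field_root_field finR prime_p cardR cardf] by blast
  have \<phi>: "bij_betw \<phi> (U P) UNIV"
    and add: "\<And>a b. a \<in> U P \<Longrightarrow> b \<in> U P \<Longrightarrow> \<phi> (a \<otimes> b) = \<phi> a + \<phi> b"
    and mult: "\<And>a b. a \<in> U P \<Longrightarrow> b \<in> U P \<Longrightarrow> \<phi> (smul a b) = \<phi> a * \<phi> b"
    using \<phi>' add' mult' by (simp_all add: root_field_def)
  define x where "x = inv_into (U P) \<phi>"
  have x: "bij_betw x UNIV (U P)" unfolding x_def using \<phi> by (rule bij_betw_inv_into)
  have xU: "x t \<in> U P" for t using x by (auto simp: bij_betw_def)
  have \<phi>x: "\<phi> (x t) = t" for t unfolding x_def using \<phi> by (intro bij_betw_inv_into_right) auto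
  have x\<phi>: "x (\<phi> a) = a" if "a \<in> U P" for a unfolding x_def using \<phi> that
    by (intro bij_betw_inv_into_left)
  have "\<phi> \<one> = \<phi> \<one> + \<phi> \<one>" using add[of \<one> \<one>] UP_closed(2)
    by (simp only: r_one one_closed)
  then have \<phi>1: "\<phi> \<one> = 0" by (metis add_cancel_right_right)
  have nz: "\<phi> a \<noteq> 0" if "a \<in> U P" "a \<noteq> \<one>" for a
    using \<phi>1 \<phi> that UP_closed by (metis bij_betw_imp_inj_on inj_onD)
  have conj_x: "conj k (x t) = x (\<phi> (conj k e) * t)" if k: "k \<in> K" for k t
  proof -
    have "\<phi> (conj k (x t)) = \<phi> (conj k e) * t"
      using mult[of "conj k e" "x t"] k xU e K_conj_U by (simp add: smul_conj \<phi>x)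
    then show ?thesis using x\<phi>[of "conj k (x t)"] K_conj_U k xU by simp
  qed
  show ?thesis
  proof (rule that[OF x])
    fix s t
    show "x (s + t) = x s \<otimes> x t" using add[of "x s" "x t"] x\<phi>[of "x s \<otimes> x t"] xU UP_closed
      by (simp add: \<phi>x)
  next
    fix k assume k: "k \<in> K"
    show "\<exists>a. a \<noteq> 0 \<and> (\<forall>t. conj k (x t) = x (a * t))"
      using conj_x[OF k] nz[of "conj k e"] K_conj_U[OF k] e conj_K_nontrivial[OF k] by blast
  next
    fix a :: 'f assume a: "a \<noteq> 0"
    have "x a \<noteq> \<one>" using \<phi>x[of a] \<phi>1 a by auto
    then obtain k where k: "k \<in> K" "conj k e = x a" using K_transitive xU by blast
    then show "\<exists>k \<in> K. \<forall>t. conj k (x t) = x (a * t)" using conj_x[OF k(1)] \<phi>x by auto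
  qed
qed

text \<open>Conjugating two of the fixed points to \<open>P\<close> and \<open>Q\<close> reduces
  this to \<open>K_fix_third\<close>.\<close>

lemma three_fixed_points:
  assumes g: "g \<in> carrier G" and D: "D \<in> points" "act g D = D" and E: "E \<in> points" "act g E = E"
    and F: "F \<in> points" "act g F = F" and ne: "D \<noteq> E" "D \<noteq> F" "E \<noteq> F"
  shows "g \<in> Z"
proof (rule ccontr)
  assume "g \<notin> Z"
  obtain h where h: "h \<in> carrier G" "act h P = D" "act h Q = E" using pair_transitive[OF D(1) E(1) ne(1)]
    by blast
  have pull: "act (conj (inv h) g) (act (inv h) A) = act (inv h) A" if "A \<in> points" "act g A = A" for A
  proof -
    have "conj (inv h) g \<otimes> inv h = inv h \<otimes> g" using g h by (simp add: conj_def m_assoc)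
    then have "act (conj (inv h) g) (act (inv h) A) = act (inv h) (act g A)"
      using g h points_carrier[OF that(1)] by (simp add: act_act)
    then show ?thesis using that by simp
  qed
  have PQ_back: "act (inv h) D = P" "act (inv h) E = Q" using h act_inv_eq PC QC by auto
  then have "conj (inv h) g \<in> K" using pull[OF D] pull[OF E] g h by (auto simp: K_def)
  moreover have "act (inv h) F \<noteq> P" "act (inv h) F \<noteq> Q"
    using PQ_back ne h points_carrier D E F act_eq_iff[of "inv h" "inv h"] by force+
  ultimately have "conj (inv h) g \<in> Z"
    using K_fix_third[of _ "act (inv h) F"] pull[OF F] act_point[OF F(1)] h by auto
  moreover have "conj (inv h) g \<in> noncentral G"
    using noncentral_conj[of "inv h" g] g h \<open>g \<notin> Z\<close> by simp
  ultimately show False by simp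
qed

text \<open>An element \<open>w\<close> exchanging 0 and infinity and fixing 1 acts on the nonzero scalars by a multiplicative
  involution \<open>\<sigma>\<close>. If \<open>h\<close> acts as \<open>t \<mapsto> 1 - t\<close>, then \<open>w h w\<close> and \<open>h w h\<close> agree on 0, 1 and infinity,
  hence everywhere; this is the functional equation that identifies \<open>\<sigma>\<close> as inversion.\<close>

lemma action_coordinates:
  assumes "CARD('f::{field,finite}) = q"
  obtains x :: "'f::{field,finite} \<Rightarrow> 'a" and \<alpha> where "gl2_action G q p n x \<alpha>"
proof -
  obtain x :: "'f \<Rightarrow> 'a" where x: "bij_betw x UNIV (U P)"
    and x_add: "\<And>s t. x (s + t) = x s \<otimes> x t"
    and K_scale: "\<And>k. k \<in> K \<Longrightarrow> \<exists>a. a \<noteq> 0 \<and> (\<forall>t. conj k (x t) = x (a * t))"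
    and scale_K: "\<And>a. a \<noteq> 0 \<Longrightarrow> \<exists>k \<in> K. \<forall>t. conj k (x t) = x (a * t)"
    by (rule coordinates_U[OF assms]) (rule that)
  have xU: "x t \<in> U P" for t using x by (auto simp: bij_betw_def)
  have xC: "x t \<in> carrier G" for t using xU UP_carrier by blast
  have x0: "x 0 = \<one>" using x_add[of 0 0] xC[of 0] by simp
  define pt where "pt s = (case s of None \<Rightarrow> P | Some t \<Rightarrow> act (x t) Q)" for s
  have pt_simps [simp]: "pt None = P" "pt (Some t) = act (x t) Q" for t by (simp_all add: pt_def)
  have pt_points: "pt s \<in> points" for s using P Q act_point xC by (cases s) auto
  have xP: "act (x t) P = P" for t using act_self[OF P] xU by (auto simp: U_def)
  have pt0: "pt (Some 0) = Q" using QC by (simp add: x0)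
  have inj: "s = t" if eq: "pt s = pt t" for s t
  proof -
    have neP: "act (x u) Q \<noteq> P" for u
    proof
      assume "act (x u) Q = P"
      then have "act (x u) Q = act (x u) P" using xP by simp
      then show False using PQ xC PC QC by (simp add: act_eq_iff)
    qed
    have "u = v" if e: "act (x u) Q = act (x v) Q" for u v
    proof -
      have "act (inv (x v) \<otimes> x u) Q = Q" using e xC QC by (simp add: act_eq_iff)
      moreover have "inv (x v) \<otimes> x u \<in> U P" using xU UP_closed by simp
      ultimately have "inv (x v) \<otimes> x u = \<one>" using U_fix_unique[OF P Q] PQ by blast
      then have "x u = x v" using xC by (metis inv_mult_cancel(2) r_one)
      then show ?thesis using x by (simp add: bij_betw_def inj_eq)
    qed
    then show ?thesis using eq neP neP[symmetric] by (cases s; cases t) auto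
  qed
  have surj: "\<exists>s. pt s = D" if D: "D \<in> points" for D
  proof (cases "D = P")
    case True
    then show ?thesis using pt_simps(1) by blast
  next
    case False
    then obtain u where "u \<in> U P" "act u Q = D" using U_transitive[OF P Q _ D] PQ by blast
    moreover obtain t where "u = x t" using x \<open>u \<in> U P\<close> by (auto simp: bij_betw_def)
    ultimately show ?thesis using pt_simps(2) by blast
  qed
  define \<alpha> where "\<alpha> g s = (THE r. pt r = act g (pt s))" for g s
  have pt_\<alpha>: "pt (\<alpha> g s) = act g (pt s)" if g: "g \<in> carrier G" for g s
  proof -
    obtain r where r: "pt r = act g (pt s)" using surj act_point[OF pt_points g] by metis
    then show ?thesis unfolding \<alpha>_def by (rule theI) (rule inj, simp add: r)
  qed
  have \<alpha>_eq: "\<alpha> g s = r" if "g \<in> carrier G" "act g (pt s) = pt r" for g s r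
    using inj pt_\<alpha>[OF that(1), of s] that(2) by simp
  have ptC: "pt s \<subseteq> carrier G" for s using points_carrier pt_points by blast
  have \<alpha>_mult: "\<alpha> (g \<otimes> h) = \<alpha> g \<circ> \<alpha> h"
    if "g \<in> carrier G" "h \<in> carrier G" for g h
    using that ptC by (auto simp: fun_eq_iff pt_\<alpha> act_act intro!: \<alpha>_eq)
  have \<alpha>_Z: "\<alpha> z = id" if "z \<in> Z" for z
    using that Z_carrier act_center pt_points by (auto simp: fun_eq_iff intro!: \<alpha>_eq)
  have \<alpha>_one: "\<alpha> \<one> = id" by (rule \<alpha>_Z) (rule subgroup.one_closed[OF subgroup_center])
  have \<alpha>_inj: "r = s" if "g \<in> carrier G" "\<alpha> g r = \<alpha> g s" for g r s
    using that \<alpha>_mult[of "inv g" g] \<alpha>_one by (metis comp_apply id_apply inv_closed l_inv)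
  have three: "g \<in> Z" if g: "g \<in> carrier G" "\<alpha> g r = r" "\<alpha> g s = s" "\<alpha> g t = t"
    and ne: "r \<noteq> s" "r \<noteq> t" "s \<noteq> t" for g r s t
    using three_fixed_points[OF g(1) pt_points[of r] _ pt_points[of s] _ pt_points[of t]] pt_\<alpha>[OF g(1)] g ne inj by metis
  have \<alpha>_x: "\<alpha> (x t) = map_option (\<lambda>s. t + s)" for t
  proof
    fix s show "\<alpha> (x t) s = map_option (\<lambda>s. t + s) s"
      by (cases s) (auto intro!: \<alpha>_eq simp: xC xP x_add act_act QC)
  qed
  have \<alpha>_K: "\<alpha> k = map_option (\<lambda>s. a * s)"
    if k: "k \<in> K" "\<forall>t. conj k (x t) = x (a * t)" for k a
  proof
    fix s
    have "act k (act (x t) Q) = act (x (a * t)) Q" for t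
    proof -
      have "act k (act (x t) Q) = act (conj k (x t)) (act k Q)"
        using k(1) KC xC QC by (simp add: act_act conj_def m_assoc)
      then show ?thesis using k by (simp add: K_def)
    qed
    then show "\<alpha> k s = map_option (\<lambda>s. a * s) s"
      using k(1) by (cases s) (auto intro!: \<alpha>_eq simp: K_def)
  qed
  have fix_K: "k \<in> K" if "k \<in> carrier G" "\<alpha> k None = None" "\<alpha> k (Some 0) = Some 0" for k
    using that pt_\<alpha>[OF that(1), of None] pt_\<alpha>[OF that(1), of "Some 0"] pt0 by (simp add: K_def)
  have scale: "\<exists>k \<in> carrier G. \<alpha> k = map_option (\<lambda>s. a * s)" if "a \<noteq> 0" for a
    using scale_K[OF that] \<alpha>_K KC by blast
  have fix_scale: "\<exists>a. a \<noteq> 0 \<and> \<alpha> k = map_option (\<lambda>s. a * s)"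
    if "k \<in> carrier G" "\<alpha> k None = None" "\<alpha> k (Some 0) = Some 0" for k
    using K_scale[OF fix_K[OF that]] \<alpha>_K[OF fix_K[OF that]] by blast
  obtain w0 where w0: "w0 \<in> carrier G" "act w0 P = Q" "act w0 Q = P" using pair_transitive[OF Q P] PQ by blast
  have w0_None: "\<alpha> w0 None = Some 0" "\<alpha> w0 (Some 0) = None" using w0 pt0
    by (auto intro!: \<alpha>_eq)
  obtain b where b: "\<alpha> w0 (Some 1) = Some b" "b \<noteq> 0"
    using \<alpha>_inj[OF w0(1), of "Some 1" "Some 0"] \<alpha>_inj[OF w0(1), of "Some 1" None] w0_None
    by (cases "\<alpha> w0 (Some 1)") auto
  \<comment> \<open>Rescaling makes the exchange of 0 and infinity fix 1; its square then fixes
    three points and is central.\<close>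
  obtain k where k: "k \<in> carrier G" "\<alpha> k = map_option (\<lambda>s. inverse b * s)"
    using scale[of "inverse b"] b by auto
  define w where "w = k \<otimes> w0"
  have wC: "w \<in> carrier G" using k w0 by (simp add: w_def)
  have w: "\<alpha> w None = Some 0" "\<alpha> w (Some 0) = None" "\<alpha> w (Some 1) = Some 1"
    using k w0 w0_None b by (simp_all add: w_def \<alpha>_mult)
  define \<sigma> where "\<sigma> t = the (\<alpha> w (Some t))" for t
  have \<alpha>_w: "\<alpha> w (Some t) = Some (\<sigma> t)" "\<sigma> t \<noteq> 0" if "t \<noteq> 0" for t
    using \<alpha>_inj[OF wC, of "Some t" "Some 0"] \<alpha>_inj[OF wC, of "Some t" None] w that
    by (cases "\<alpha> w (Some t)"; auto simp: \<sigma>_def)+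
  have ww: "\<alpha> (w \<otimes> w) = id"
    by (rule \<alpha>_Z, rule three[of _ None "Some 0" "Some 1"]) (auto simp: wC \<alpha>_mult w)
  have invol: "\<sigma> (\<sigma> a) = a" if "a \<noteq> 0" for a
  proof -
    have "\<alpha> (w \<otimes> w) (Some a) = Some (\<sigma> (\<sigma> a))" using that wC \<alpha>_w
      by (simp add: \<alpha>_mult)
    then show ?thesis using ww by simp
  qed
  have \<sigma>1: "\<sigma> 1 = 1" by (simp add: \<sigma>_def w)
  have mult: "\<sigma> (a * b) = \<sigma> a * \<sigma> b" if a: "a \<noteq> 0" and b: "b \<noteq> 0" for a b
  proof -
    obtain k where k: "k \<in> carrier G" "\<alpha> k = map_option (\<lambda>s. a * s)" using scale[OF a] by blast
    let ?k = "w \<otimes> k \<otimes> w"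
    have kC: "?k \<in> carrier G" using k wC by simp
    have \<alpha>k: "\<alpha> ?k = \<alpha> w \<circ> \<alpha> k \<circ> \<alpha> w" using k wC
      by (simp add: \<alpha>_mult)
    \<comment> \<open>Like \<open>k\<close>, the product \<open>?k\<close> fixes 0 and infinity, so
      it scales by a constant, which evaluation at 1 identifies as
      \<open>\<sigma> a\<close>.\<close>
    obtain c where c: "\<alpha> ?k = map_option (\<lambda>s. c * s)" using fix_scale[OF kC]
      by (auto simp: \<alpha>k k w)
    have *: "\<alpha> ?k (Some t) = Some (\<sigma> (a * \<sigma> t))" if "t \<noteq> 0" for t
      using that a \<alpha>_w by (simp add: \<alpha>k k)
    have "c = \<sigma> a" using *[of 1] c \<sigma>1 by simp
    then have "\<sigma> (a * \<sigma> (\<sigma> b)) = \<sigma> a * \<sigma> b"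
      using *[of "\<sigma> b"] c \<alpha>_w b by simp
    then show ?thesis using invol b by simp
  qed
  have few: "card {a. a \<noteq> 0 \<and> \<sigma> a = a} \<le> 2"
  proof (rule ccontr)
    assume "\<not> ?thesis"
    then have "3 \<le> card {a. a \<noteq> 0 \<and> \<sigma> a = a}" by simp
    then obtain T where T: "T \<subseteq> {a. a \<noteq> 0 \<and> \<sigma> a = a}" "card T = 3"
      by (rule obtain_subset_with_card_n)
    then obtain r s t where "T = {r, s, t}" "r \<noteq> s" "s \<noteq> t" "r \<noteq> t" unfolding card_3_iff
      by auto
    then have "w \<in> Z" using T \<alpha>_w by (intro three[of w "Some r" "Some s" "Some t"]) (auto simp: wC)
    then show False using \<alpha>_Z w by simp
  qed
  obtain m where m: "m \<in> carrier G" "\<alpha> m = map_option (\<lambda>s. - 1 * s)" using scale[of "- 1"]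
    by auto
  define h where "h = x 1 \<otimes> m"
  have hC: "h \<in> carrier G" using m xC by (simp add: h_def)
  have \<alpha>_h: "\<alpha> h None = None" "\<alpha> h (Some t) = Some (1 - t)" for t
    using m xC by (simp_all add: h_def \<alpha>_mult \<alpha>_x)
  have braid: "\<alpha> (w \<otimes> h \<otimes> w) = \<alpha> (h \<otimes> w \<otimes> h)"
  proof -
    let ?a = "w \<otimes> h \<otimes> w" and ?b = "h \<otimes> w \<otimes> h"
    have C: "?a \<in> carrier G" "?b \<in> carrier G" using wC hC by auto
    have agree: "\<alpha> ?a s = \<alpha> ?b s" if "s = None \<or> s = Some 0 \<or> s = Some 1" for s
      using that wC hC by (auto simp: \<alpha>_mult \<alpha>_h w)
    have cancel: "\<alpha> (inv ?b) (\<alpha> ?b s) = s" for s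
      using \<alpha>_mult[of "inv ?b" ?b] C \<alpha>_one by (metis comp_apply id_apply inv_closed l_inv)
    have fixes3: "\<alpha> (inv ?b \<otimes> ?a) s = s" if "s = None \<or> s = Some 0 \<or> s = Some 1" for s
      using \<alpha>_mult[of "inv ?b" ?a] C agree[OF that] cancel[of s] by simp
    have "inv ?b \<otimes> ?a \<in> Z"
      by (rule three[of _ None "Some 0" "Some 1"]) (use C fixes3 in auto)
    then have "\<alpha> ?b \<circ> \<alpha> (inv ?b \<otimes> ?a) = \<alpha> ?b" using \<alpha>_Z by simp
    moreover have "\<alpha> ?b \<circ> \<alpha> (inv ?b \<otimes> ?a) = \<alpha> (?b \<otimes> (inv ?b \<otimes> ?a))" using C by (subst \<alpha>_mult) auto
    ultimately show ?thesis using C by (simp add: inv_mult_cancel)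
  qed
  have eq: "\<sigma> (1 - \<sigma> t) = 1 - \<sigma> (1 - t)" if t: "t \<noteq> 0" "t \<noteq> 1" for t
  proof -
    have "\<sigma> t \<noteq> 1" using invol[OF t(1)] \<sigma>1 t(2) by auto
    moreover have "\<alpha> w (\<alpha> h (\<alpha> w (Some t))) = \<alpha> h (\<alpha> w (\<alpha> h (Some t)))"
      using braid wC hC by (simp add: \<alpha>_mult fun_eq_iff)
    ultimately show ?thesis using t \<alpha>_w by (simp add: \<alpha>_h)
  qed
  have inverse: "\<sigma> a = inverse a" if "a \<noteq> 0" for a
    using multiplicative_involution_eq_inverse[OF \<alpha>_w(2) mult invol few eq that] by blast
  show ?thesis
  proof (rule that[of x \<alpha>], unfold_locales)
    show "CARD('f) = q" by (rule assms)
    show "x t \<in> p_elements" for t using xU by (auto simp: U_def)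
    show "\<alpha> g = id \<longleftrightarrow> g \<in> Z" if "g \<in> carrier G" for g
      using \<alpha>_Z three[OF that, of None "Some 0" "Some 1"] by auto
    show "k \<otimes> l = l \<otimes> k"
      if "k \<in> carrier G" "l \<in> carrier G" "\<alpha> k None = None" "\<alpha> k (Some 0) = Some 0"
      "\<alpha> l None = None" "\<alpha> l (Some 0) = Some 0" for k l
      using that fix_K K_commute by blast
    show "\<exists>n \<in> carrier G. \<alpha> n = (\<lambda>s. case s of None \<Rightarrow> Some 0 | Some t \<Rightarrow> if t = 0 then None else Some (- inverse t))"
    \<comment> \<open>\<open>w\<close> acts as inversion and \<open>m\<close> as negation; with the
      sign, the map comes from a matrix of determinant 1.\<close>
    proof (intro bexI[of _ "m \<otimes> w"] ext)
      fix s
      show "\<alpha> (m \<otimes> w) s = (case s of None \<Rightarrow> Some 0 | Some t \<Rightarrow> if t = 0 then None else Some (- inverse t))"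
        using m wC w \<alpha>_w inverse by (cases s) (auto simp: \<alpha>_mult)
    qed (use m wC in simp)
  qed (use x_add \<alpha>_x \<alpha>_mult scale fix_scale in blast)+
qed

end

section \<open>Moebius transformations and the Bruhat decomposition\<close>

text \<open>The projective line is the option type, with \<open>None\<close> as the point at infinity. The value of \<open>proj\<close> at (0, 0) is junk.\<close>

definition proj :: "'f::field \<times> 'f \<Rightarrow> 'f option" where
  "proj v = (if snd v = 0 then None else Some (fst v / snd v))"

definition rep :: "'f::field option \<Rightarrow> 'f \<times> 'f" where
  "rep s = (case s of None \<Rightarrow> (1, 0) | Some t \<Rightarrow> (t, 1))"

definition mob :: "'f::field ^ 2 ^ 2 \<Rightarrow> 'f option \<Rightarrow> 'f option" where
  "mob A s = proj (A $ 1 $ 1 * fst (rep s) + A $ 1 $ 2 * snd (rep s), A $ 2 $ 1 * fst (rep s) + A $ 2 $ 2 * snd (rep s))"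

lemma mob_mat2:
  "mob (mat2 a b c d) s = proj (a * fst (rep s) + b * snd (rep s), c * fst (rep s) + d * snd (rep s))"
  by (simp add: mob_def)

lemma proj_scale: "k \<noteq> 0 \<Longrightarrow> proj (k * u, k * v) = proj (u, v)"
  by (simp add: proj_def)

lemma rep_proj: "(u, v) \<noteq> (0, 0) \<Longrightarrow> \<exists>k. k \<noteq> 0 \<and> u = k * fst (rep (proj (u, v))) \<and> v = k * snd (rep (proj (u, v)))"
  by (cases "v = 0") (auto simp: proj_def rep_def)

lemma rep_nonzero: "rep s \<noteq> (0, 0)"
  by (simp add: rep_def split: option.split)

text \<open>\<open>B\<close> sends the representative of a point to a multiple \<open>k\<close> of
  another representative, and \<open>proj\<close> ignores \<open>k\<close>. Invertibility of
  \<open>B\<close> keeps the intermediate vector nonzero, away from the junk value.\<close>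

lemma mob_mult:
  fixes A B :: "'f::field ^ 2 ^ 2"
  assumes "invertible B"
  shows "mob (A ** B) = mob A \<circ> mob B"
proof
  fix s :: "'f option"
  obtain a b c d where A: "A = mat2 a b c d" by (rule mat2_cases)
  obtain a' b' c' d' where B: "B = mat2 a' b' c' d'" by (rule mat2_cases)
  obtain u v where uv: "rep s = (u, v)" by force
  define w z where "w = a' * u + b' * v" and "z = c' * u + d' * v"
  have "(w, z) \<noteq> (0, 0)"
  proof
    assume "(w, z) = (0, 0)"
    then have wz: "w = 0" "z = 0" by auto
    have "(a' * d' - b' * c') * u = d' * w - b' * z" "(a' * d' - b' * c') * v = a' * z - c' * w"
      by (simp_all add: w_def z_def algebra_simps)
    then have "u = 0" "v = 0" using assms wz by (simp_all add: B)
    then show False using rep_nonzero[of s] uv by simp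
  qed
  from rep_proj[OF this] obtain k where k: "k \<noteq> 0" "w = k * fst (rep (proj (w, z)))" "z = k * snd (rep (proj (w, z)))" by blast
  define w' z' where "w' = fst (rep (proj (w, z)))" and "z' = snd (rep (proj (w, z)))"
  have k': "w = k * w'" "z = k * z'" using k(2,3) by (simp_all only: w'_def z'_def)
  have "mob (A ** B) s = proj (a * w + b * z, c * w + d * z)"
    by (simp add: A B mob_mat2 uv w_def z_def algebra_simps)
  also have "\<dots> = proj (k * (a * w' + b * z'), k * (c * w' + d * z'))"
    unfolding k' by (simp add: algebra_simps)
  also have "\<dots> = proj (a * w' + b * z', c * w' + d * z')" using k(1) by (rule proj_scale)
  also have "\<dots> = (mob A \<circ> mob B) s" by (simp add: A B mob_mat2 uv w'_def z'_def w_def z_def)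
  finally show "mob (A ** B) s = (mob A \<circ> mob B) s" .
qed

lemma mob_special:
  fixes a :: "'f::field"
  shows "mob (mat2 1 t 0 1) = map_option (\<lambda>s. t + s)"
    "d \<noteq> 0 \<Longrightarrow> mob (mat2 a 0 0 d) = map_option (\<lambda>s. (a / d) * s)"
    "mob (mat2 0 (- 1) 1 0) = (\<lambda>s. case s of None \<Rightarrow> Some 0 | Some t \<Rightarrow> if t = 0 then None else Some (- inverse t))"
  by (auto simp: fun_eq_iff mob_mat2 rep_def proj_def add.commute inverse_eq_divide split: option.split)

lemma mob_eq_id_iff:
  fixes A :: "'f::field ^ 2 ^ 2"
  assumes "invertible A"
  shows "mob A = id \<longleftrightarrow> A \<in> scalar_matrices"
proof -
  obtain a b c d where A: "A = mat2 a b c d" by (rule mat2_cases)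
  show ?thesis
  proof
    assume "mob A = id"
    then have *: "mob A None = None" "mob A (Some 0) = Some 0" "mob A (Some 1) = Some 1" by simp_all
    then have "c = 0" by (auto simp: A mob_mat2 rep_def proj_def split: if_splits)
    moreover have "b = 0" "d \<noteq> 0" using * by (auto simp: A mob_mat2 rep_def proj_def split: if_splits)
    ultimately have "a = d" using * by (auto simp: A mob_mat2 rep_def proj_def split: if_splits)
    then show "A \<in> scalar_matrices" using \<open>b = 0\<close> \<open>c = 0\<close> \<open>d \<noteq> 0\<close>
      by (auto simp: A scalar_matrices_def mat_eq_mat2)
  next
    assume "A \<in> scalar_matrices"
    then obtain s where "s \<noteq> 0" "A = mat2 s 0 0 s" by (auto simp: scalar_matrices_def mat_eq_mat2)
    then show "mob A = id" by (simp add: mob_special option.map_id0[unfolded id_def] id_def)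
  qed
qed

lemma mob_one: "mob (mat 1 :: 'f::field ^ 2 ^ 2) = id"
  by (simp add: mat_eq_mat2 mob_special fun_eq_iff option.map_ident)

lemma mat_1_mat2: "(mat 1 :: 'f::zero_neq_one ^ 2 ^ 2) = mat2 1 0 0 1"
  by (rule mat_eq_mat2)

section \<open>Lifting matrices to the group\<close>

context gl2_action
begin

abbreviation GL2 :: "('f ^ 2 ^ 2) monoid" where
  "GL2 \<equiv> GL"

text \<open>A relation rather than a map: \<open>g\<close> determines \<open>A\<close> up to a
  nonzero scalar, and \<open>A\<close> determines \<open>g\<close> up to a central factor.\<close>

definition lifts :: "'a \<Rightarrow> 'f ^ 2 ^ 2 \<Rightarrow> bool" where
  "lifts g A \<longleftrightarrow> g \<in> carrier G \<and> invertible A \<and> \<alpha> g = mob A"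

lemma lifts_carrier: "lifts g A \<Longrightarrow> g \<in> carrier G"
  by (simp add: lifts_def)

lemma lifts_mult: "lifts g A \<Longrightarrow> lifts h B \<Longrightarrow> lifts (g \<otimes> h) (A ** B)"
  by (simp add: lifts_def \<alpha>_mult mob_mult invertible_mult)

lemma one_in_Z: "\<one> \<in> Z"
  by (rule subgroup.one_closed[OF subgroup_center])

lemma lifts_center_iff: "lifts g A \<Longrightarrow> g \<in> Z \<longleftrightarrow> A \<in> scalar_matrices"
  using \<alpha>_id[of g] mob_eq_id_iff[of A] by (simp add: lifts_def)

lemma \<alpha>_eqD:
  assumes "g \<in> carrier G" "h \<in> carrier G" "\<alpha> g = \<alpha> h"
  obtains z where "z \<in> Z" "h = g \<otimes> z"
proof -
  have "\<alpha> (inv g \<otimes> h) = \<alpha> (inv g \<otimes> g)"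
    using assms \<alpha>_mult[of "inv g" g] \<alpha>_mult[of "inv g" h] by simp
  also have "\<dots> = id" using assms(1) \<alpha>_id[of \<one>] one_in_Z by simp
  finally have "inv g \<otimes> h \<in> Z" using assms \<alpha>_id by simp
  then show ?thesis using assms by (intro that[of "inv g \<otimes> h"]) (simp_all add: inv_mult_cancel)
qed

lemma lifts_inv:
  assumes "lifts g A" "A ** B = mat 1"
  shows "lifts (inv g) B"
proof -
  have gC: "g \<in> carrier G" and iA: "invertible A" and e: "\<alpha> g = mob A" using assms
    by (auto simp: lifts_def)
  have "B ** A = mat 1" using assms(2) by (simp add: matrix_left_right_inverse)
  then have iB: "invertible B" using assms(2) unfolding invertible_def by blast
  have "mob B \<circ> mob A = id"
    using mob_mult[OF iA, of B] unfolding \<open>B ** A = mat 1\<close> mob_one by simp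
  moreover have "\<alpha> g \<circ> \<alpha> (inv g) = id"
    using \<alpha>_mult[of g "inv g"] \<alpha>_id[of \<one>] one_in_Z gC by simp
  ultimately have "\<alpha> (inv g) = mob B" using e by (metis comp_assoc comp_id id_comp)
  then show ?thesis using gC iB by (simp add: lifts_def)
qed

section \<open>Root elements, Weyl elements and the torus\<close>

lemma x_carrier [simp]: "x t \<in> carrier G"
  using x_p by (auto simp: p_elements_def)

lemma x_zero [simp]: "x 0 = \<one>"
  using x_add[of 0 0] x_carrier[of 0] by (metis add_0 l_cancel_one')

lemma x_minus: "x (- t) = inv (x t)"
  using x_add[of t "- t"] by (intro inv_equality[symmetric]) (simp_all flip: x_add)

lemma lifts_x: "lifts (x t) (mat2 1 t 0 1)"
  by (simp add: lifts_def mob_special \<alpha>_x)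

lemma lifts_scale:
  assumes "a \<noteq> 0"
  obtains k where "lifts k (mat2 a 0 0 1)"
  using scale[OF assms] assms by (auto simp: lifts_def mob_special)

text \<open>The matrix identity gives the relation up to a central factor. Both
  \<open>conj g u\<close> and \<open>v\<close> are p-elements, so that factor is 1; \<open>g\<close>
  may be any lift.\<close>

lemma p_element_conj_eq:
  assumes u: "u \<in> p_elements" "lifts u B" and v: "v \<in> p_elements" "lifts v C" and g: "lifts g A"
    and eq: "A ** B = C ** A"
  shows "g \<otimes> u = v \<otimes> g"
proof -
  have car: "u \<in> carrier G" "v \<in> carrier G" "g \<in> carrier G" using u v g by (auto simp: lifts_def)
  have "\<alpha> (g \<otimes> u) = \<alpha> (v \<otimes> g)"
    using lifts_mult[OF g u(2)] lifts_mult[OF v(2) g] eq by (simp add: lifts_def)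
  then obtain z where z: "z \<in> Z" "v \<otimes> g = g \<otimes> u \<otimes> z"
    using \<alpha>_eqD[of "g \<otimes> u" "v \<otimes> g"] car by auto
  have zC: "z \<in> carrier G" using z Z_carrier by auto
  have "v = v \<otimes> g \<otimes> inv g" using car by (simp add: m_assoc)
  also have "\<dots> = g \<otimes> u \<otimes> (z \<otimes> inv g)" using z car zC by (simp add: m_assoc)
  also have "\<dots> = conj g u \<otimes> z" using Z_commute[OF z(1), of "inv g"] car zC
    by (simp add: conj_def m_assoc)
  finally have "conj g u = v" using p_element_eq(1)[OF p_elements_conj[OF u(1) car(3)] v(1) z(1)] by simp
  then have "conj g u \<otimes> g = v \<otimes> g" by simp
  then show ?thesis using car by (simp add: conj_def m_assoc)
qed

text \<open>The lower unipotent elements are conjugates of the upper ones by a lift of the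
  inversion, which exchanges the two root groups and changes the sign of the parameter. Lifts differ
  by central factors, so the chosen one does not affect the conjugate.\<close>

definition y :: "'f \<Rightarrow> 'a" where
  "y t = conj (SOME n. n \<in> carrier G \<and> \<alpha> n = mob (mat2 0 (- 1) 1 0)) (x (- t))"

lemma y: "y t \<in> p_elements" "lifts (y t) (mat2 1 0 t 1)" "y (s + t) = y s \<otimes> y t"
proof -
  let ?n = "SOME n. n \<in> carrier G \<and> \<alpha> n = mob (mat2 0 (- 1) 1 0)"
  have n: "?n \<in> carrier G \<and> \<alpha> ?n = mob (mat2 0 (- 1) 1 0)"
    by (rule someI_ex) (use inversion in \<open>auto simp: mob_special\<close>)
  have ln: "lifts ?n (mat2 0 (- 1) 1 0)" using n by (simp add: lifts_def)
  show "y t \<in> p_elements" unfolding y_def using x_p n by (intro p_elements_conj) auto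
  have "lifts (inv ?n) (mat2 0 1 (- 1) 0)" by (rule lifts_inv[OF ln]) (simp add: mat_1_mat2)
  from lifts_mult[OF lifts_mult[OF ln lifts_x[of "- t"]] this]
  show "lifts (y t) (mat2 1 0 t 1)" by (simp add: y_def conj_def)
  have "- (s + t) = - s + - t" by simp
  then show "y (s + t) = y s \<otimes> y t" using n unfolding y_def by (simp only: x_add) (simp add: conj_mult)
qed

lemma y_carrier [simp]: "y t \<in> carrier G"
  using y(2) by (rule lifts_carrier)

lemma y_zero [simp]: "y 0 = \<one>"
  using y(3)[of 0 0] y_carrier[of 0] by (metis add_0 l_cancel_one')

lemma y_minus: "y (- t) = inv (y t)"
  using y(3)[of "- t" t] by (intro inv_equality[symmetric]) simp_all

text \<open>\<open>w\<close> and \<open>h\<close> are Steinberg's Weyl and torus elements. Spelled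
  out in root elements, they are specific lifts of their matrices, and conjugation by the torus just
  rescales the parameter of \<open>w\<close>.\<close>

definition w :: "'f \<Rightarrow> 'a" where
  "w t = x t \<otimes> y (- inverse t) \<otimes> x t"

definition h :: "'f \<Rightarrow> 'a" where
  "h t = w t \<otimes> w (- 1)"

lemma w_carrier [simp]: "w t \<in> carrier G" and h_carrier [simp]: "h t \<in> carrier G"
  by (simp_all add: w_def h_def)

lemma lifts_w: "t \<noteq> 0 \<Longrightarrow> lifts (w t) (mat2 0 t (- inverse t) 0)"
  using lifts_mult[OF lifts_mult[OF lifts_x[of t] y(2)[of "- inverse t"]] lifts_x[of t]]
  by (simp add: w_def)

lemma lifts_h: "t \<noteq> 0 \<Longrightarrow> lifts (h t) (mat2 t 0 0 (inverse t))"
  using lifts_mult[OF lifts_w[of t] lifts_w[of "- 1"]] by (simp add: h_def)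

lemma w_minus: "w (- t) = inv (w t)"
  by (simp add: w_def x_minus y_minus inv_mult_group m_assoc)

lemma w_cancel: "w t \<otimes> w (- t) = \<one>" "w (- t) \<otimes> w t = \<one>"
  by (simp_all add: w_minus)

lemma scale_x: "lifts k (mat2 a 0 0 1) \<Longrightarrow> conj k (x t) = x (a * t)"
  using p_element_conj_eq[OF x_p lifts_x x_p lifts_x, of k "mat2 a 0 0 1" t "a * t"] lifts_carrier[of k]
  by (simp add: conj_def inv_solve_right')

lemma scale_y:
  assumes "lifts k (mat2 a 0 0 1)"
  shows "conj k (y t) = y (t / a)"
proof -
  have "a \<noteq> 0" using assms by (simp add: lifts_def)
  then show ?thesis
    using p_element_conj_eq[OF y(1,2) y(1,2) assms, of t "t / a"] lifts_carrier[OF assms]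
    by (simp add: conj_def inv_solve_right')
qed

lemma scale_w: "lifts k (mat2 a 0 0 1) \<Longrightarrow> conj k (w t) = w (a * t)"
  using lifts_carrier[of k]
  by (simp add: w_def conj_mult scale_x scale_y divide_inverse mult.commute)

lemma diagonal_fixes: "lifts k (mat2 a 0 0 d) \<Longrightarrow> \<alpha> k None = None \<and> \<alpha> k (Some 0) = Some 0"
  by (auto simp: lifts_def mob_special)

lemma diagonal_commute:
  assumes "lifts k (mat2 a 0 0 d)" "lifts l (mat2 a' 0 0 d')"
  shows "k \<otimes> l = l \<otimes> k"
  using diagonal_fixes[OF assms(1)] diagonal_fixes[OF assms(2)] assms lifts_carrier
  by (intro fix_commute) auto

lemma h_inv: "inv (h t) = w 1 \<otimes> w (- t)"
  using w_minus[of "- 1"] w_minus[of t] by (simp add: h_def inv_mult_group)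

text \<open>The torus is abelian and scales the parameter of \<open>w\<close>: this makes \<open>h\<close> multiplicative.\<close>

lemma h_mult:
  assumes "a \<noteq> 0" "b \<noteq> 0"
  shows "h (a * b) = h a \<otimes> h b"
proof -
  obtain k where k: "lifts k (mat2 b 0 0 1)" using lifts_scale[OF assms(2)] .
  have kC: "k \<in> carrier G" using k by (rule lifts_carrier)
  have "k \<otimes> h a = h a \<otimes> k" using diagonal_commute[OF k lifts_h[OF assms(1)]] .
  then have "h a = conj k (h a)" using kC conj_fix_iff[of k "h a"] by simp
  also have "\<dots> = w (b * a) \<otimes> w (- b)" using kC by (simp add: h_def conj_mult scale_w[OF k])
  finally have ha: "h a = w (b * a) \<otimes> w (- b)" .
  have "h a \<otimes> h b = w (b * a) \<otimes> (w (- b) \<otimes> w b) \<otimes> w (- 1)"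
    unfolding ha h_def[of b] by (simp only: m_assoc w_carrier m_closed)
  then show ?thesis by (simp add: w_cancel h_def mult.commute[of b])
qed

lemma h_one: "h 1 = \<one>"
  by (simp add: h_def w_cancel)

lemma h_w: "a \<noteq> 0 \<Longrightarrow> b \<noteq> 0 \<Longrightarrow> h a \<otimes> w b = w (a * b)"
proof -
  assume ab: "a \<noteq> 0" "b \<noteq> 0"
  have w: "w c = h c \<otimes> w 1" for c using w_cancel(2)[of 1] by (simp add: h_def m_assoc)
  have "h a \<otimes> w b = h a \<otimes> h b \<otimes> w 1" by (subst w[of b]) (simp add: m_assoc)
  then show ?thesis using ab w[of "a * b"] by (simp add: h_mult)
qed

lemma w_w:
  assumes "a \<noteq> 0" "b \<noteq> 0"
  shows "w a \<otimes> w (- b) = h (a / b)"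
proof -
  have "w a = h (a / b) \<otimes> w b" using h_w[of "a / b" b] assms by simp
  then have "w a \<otimes> w (- b) = h (a / b) \<otimes> (w b \<otimes> w (- b))"
    by (simp only: m_assoc h_carrier w_carrier)
  then show ?thesis by (simp add: w_cancel)
qed

text \<open>The square of \<open>w 1\<close> lies over the scalar -1, so it is central; the torus
  element that conjugates \<open>w 1\<close> to \<open>w t\<close> leaves it fixed.\<close>

lemma w_square:
  assumes "t \<noteq> 0"
  shows "w t \<otimes> w t = w 1 \<otimes> w 1"
proof -
  obtain k where k: "lifts k (mat2 t 0 0 1)" using lifts_scale[OF assms] .
  have kC: "k \<in> carrier G" using k by (rule lifts_carrier)
  have "lifts (w 1 \<otimes> w 1) (mat2 (- 1) 0 0 (- 1))" using lifts_mult[OF lifts_w[of 1] lifts_w[of 1]] by simp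
  then have "w 1 \<otimes> w 1 \<in> Z" using lifts_center_iff by (force simp: scalar_matrices_def mat_eq_mat2)
  then have "conj k (w 1 \<otimes> w 1) = w 1 \<otimes> w 1" using Z_commute[of "w 1 \<otimes> w 1" k] kC
    by (simp add: conj_fix_iff)
  then show ?thesis using kC by (simp add: conj_mult scale_w[OF k])
qed

text \<open>Since all squares of Weyl elements agree, moving \<open>w 1\<close> past
  \<open>h b\<close> turns it into its inverse.\<close>

lemma w_h:
  assumes "a \<noteq> 0" "b \<noteq> 0"
  shows "w a \<otimes> h b = w (a / b)"
proof -
  have "w 1 \<otimes> h b = w 1 \<otimes> (w (- b) \<otimes> (w b \<otimes> w b)) \<otimes> w (- 1)"
    using w_cancel(2)[of b] by (simp add: h_def flip: m_assoc)
  also have "\<dots> = w 1 \<otimes> w (- b) \<otimes> w 1 \<otimes> (w 1 \<otimes> w (- 1))"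
    by (simp add: w_square[OF assms(2)] m_assoc)
  also have "\<dots> = inv (h b) \<otimes> w 1" by (simp add: w_cancel h_inv)
  also have "inv (h b) = h (inverse b)"
    using h_mult[of "inverse b" b] assms(2) h_one by (intro inv_equality) simp_all
  finally have e: "w 1 \<otimes> h b = h (inverse b) \<otimes> w 1" .
  have "w a \<otimes> h b = h a \<otimes> (w 1 \<otimes> h b)" using h_w[of a 1] assms by (simp flip: m_assoc)
  also have "\<dots> = h a \<otimes> w (inverse b)" unfolding e using assms h_w[of "inverse b" 1] by simp
  also have "\<dots> = w (a / b)" using assms h_w[of a "inverse b"] by (simp add: divide_inverse)
  finally show ?thesis .
qed

lemma h_x:
  assumes "a \<noteq> 0"
  shows "h a \<otimes> x t = x (a * a * t) \<otimes> h a"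
  by (rule p_element_conj_eq[OF x_p lifts_x x_p lifts_x lifts_h[OF assms]]) (simp add: assms)

text \<open>\<open>w a\<close> conjugates \<open>x t\<close> to a lower root element, and solving
  the definition of \<open>w\<close> for its middle factor rewrites that as an element of the big
  Bruhat cell.\<close>

lemma w_x:
  assumes "a \<noteq> 0" "t \<noteq> 0"
  shows "w a \<otimes> x t = x (- (a * a / t)) \<otimes> w (a * a / t) \<otimes> x (- (a * a / t)) \<otimes> w a"
proof -
  let ?s = "a * a / t"
  have s: "?s \<noteq> 0" using assms by simp
  have e: "w a \<otimes> x t = y (- inverse ?s) \<otimes> w a"
    by (rule p_element_conj_eq[OF x_p lifts_x y(1,2) lifts_w[OF assms(1)]]) (simp add: assms field_simps)
  have "x (- ?s) \<otimes> w ?s \<otimes> x (- ?s) = (inv (x ?s) \<otimes> x ?s) \<otimes> y (- inverse ?s) \<otimes> (x ?s \<otimes> inv (x ?s))"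
    by (simp only: x_minus w_def m_assoc x_carrier y_carrier inv_closed m_closed)
  also have "\<dots> = y (- inverse ?s)" by simp
  finally show ?thesis using e by simp
qed

text \<open>The Bruhat normal form of a matrix of determinant 1, factor by factor: upper triangular
  for \<open>c = 0\<close>, big cell otherwise. The entry left out is fixed by the
  determinant.\<close>

definition \<phi> :: "'f ^ 2 ^ 2 \<Rightarrow> 'a" where
  "\<phi> A = (let a = A $ 1 $ 1; b = A $ 1 $ 2; c = A $ 2 $ 1; d = A $ 2 $ 2 in
     if c = 0 then x (a * b) \<otimes> h a else x (a / c) \<otimes> w (- (1 / c)) \<otimes> x (d / c))"

lemma \<phi>_mat2: "\<phi> (mat2 a b c d) =
    (if c = 0 then x (a * b) \<otimes> h a else x (a / c) \<otimes> w (- (1 / c)) \<otimes> x (d / c))"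
  by (simp add: \<phi>_def Let_def)

lemma \<phi>_carrier [simp]: "\<phi> A \<in> carrier G"
  by (simp add: \<phi>_def Let_def)

lemma lifts_\<phi>:
  assumes "det A = 1"
  shows "lifts (\<phi> A) A"
proof -
  obtain a b c d where A: "A = mat2 a b c d" by (rule mat2_cases)
  have det: "a * d - b * c = 1" using assms by (simp add: A)
  show ?thesis
  proof (cases "c = 0")
    case True
    then have "a \<noteq> 0" "d = inverse a" using det by (auto simp: inverse_unique)
    then have e: "mat2 1 (a * b) 0 1 ** mat2 a 0 0 (inverse a) = A" using True by (simp add: A)
    have "lifts (x (a * b) \<otimes> h a) A"
      using lifts_mult[OF lifts_x[of "a * b"] lifts_h[OF \<open>a \<noteq> 0\<close>]] unfolding e .
    then show ?thesis using True by (simp add: A \<phi>_mat2)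
  next
    case False
    have "b = (a * d - 1) / c" using False det by (simp add: field_simps)
    then have "mat2 1 (a / c) 0 1 ** mat2 0 (- (1 / c)) (- inverse (- (1 / c))) 0 ** mat2 1 (d / c) 0 1 = A"
      using False by (simp add: A field_simps)
    moreover have "lifts (\<phi> A) (mat2 1 (a / c) 0 1 ** mat2 0 (- (1 / c)) (- inverse (- (1 / c))) 0 ** mat2 1 (d / c) 0 1)"
      unfolding A \<phi>_mat2 by (simp only: False if_False, intro lifts_mult lifts_x lifts_w) (simp add: False)
    ultimately show ?thesis by simp
  qed
qed

lemma \<phi>_x:
  assumes "det A = 1"
  shows "\<phi> (mat2 1 t 0 1 ** A) = x t \<otimes> \<phi> A"
proof -
  obtain a b c d where A: "A = mat2 a b c d" by (rule mat2_cases)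
  have det: "a * d - b * c = 1" using assms by (simp add: A)
  show ?thesis
  proof (cases "c = 0")
    case True
    then have "a * (b + t * d) = t + a * b" using det by (simp add: algebra_simps)
    then show ?thesis using True by (simp add: A \<phi>_mat2 x_add m_assoc)
  next
    case False
    then have "(a + t * c) / c = t + a / c" by (simp add: field_simps)
    then show ?thesis using False by (simp add: A \<phi>_mat2 x_add m_assoc)
  qed
qed

text \<open>The Weyl matrix swaps the rows, so \<open>a\<close> decides the cell of the product as
  \<open>c\<close> does that of \<open>A\<close>. If both are nonzero, \<open>w_x\<close> restores
  the normal form.\<close>

lemma \<phi>_w:
  assumes "det A = 1" and t: "t \<noteq> 0"
  shows "\<phi> (mat2 0 t (- inverse t) 0 ** A) = w t \<otimes> \<phi> A"
proof -
  obtain a b c d where A: "A = mat2 a b c d" by (rule mat2_cases)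
  have det: "a * d - b * c = 1" using assms by (simp add: A)
  have prod: "mat2 0 t (- inverse t) 0 ** A = mat2 (t * c) (t * d) (- (a / t)) (- (b / t))"
    by (simp add: A field_simps)
  show ?thesis
  proof (cases "c = 0")
    case True
    then have a: "a \<noteq> 0" using det by auto
    have "w t \<otimes> \<phi> A = w t \<otimes> (x (a * a * (b / a)) \<otimes> h a)" using a True
      by (simp add: A \<phi>_mat2)
    also have "\<dots> = w t \<otimes> (h a \<otimes> x (b / a))" by (simp only: h_x[OF a])
    also have "\<dots> = w (t / a) \<otimes> x (b / a)" using w_h[OF t a] by (simp flip: m_assoc)
    finally show ?thesis using a t True by (simp add: prod \<phi>_mat2)
  next
    case c: False
    have nn: "w t \<otimes> w (- (1 / c)) = h (t * c)" using w_w[OF t, of "1 / c"] c by simp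
    show ?thesis
    proof (cases "a = 0")
      case True
      have "w t \<otimes> \<phi> A = h (t * c) \<otimes> x (d / c)" using True c nn
        by (simp add: A \<phi>_mat2 flip: m_assoc)
      also have "\<dots> = x (t * c * (t * c) * (d / c)) \<otimes> h (t * c)" using t c by (intro h_x) simp
      also have "t * c * (t * c) * (d / c) = t * c * (t * d)" using c by simp
      finally show ?thesis using True by (simp add: prod \<phi>_mat2)
    next
      case a: False
      \<comment> \<open>The parameter that \<open>w_x\<close> produces for \<open>w t\<close> and
        \<open>x (a / c)\<close>.\<close>
      let ?s = "t * t / (a / c)"
      have "w t \<otimes> \<phi> A = (w t \<otimes> x (a / c)) \<otimes> w (- (1 / c)) \<otimes> x (d / c)"
        using c by (simp add: A \<phi>_mat2 m_assoc)
      also have "w t \<otimes> x (a / c) = x (- ?s) \<otimes> w ?s \<otimes> x (- ?s) \<otimes> w t" using a c t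
        by (intro w_x) simp_all
      also have "x (- ?s) \<otimes> w ?s \<otimes> x (- ?s) \<otimes> w t \<otimes> w (- (1 / c)) \<otimes> x (d / c)
          = x (- ?s) \<otimes> (w ?s \<otimes> (x (- ?s) \<otimes> h (t * c))) \<otimes> x (d / c)"
        by (simp add: m_assoc flip: nn)
      also have "x (- ?s) \<otimes> h (t * c) = h (t * c) \<otimes> x (- (1 / (a * c)))"
        using h_x[of "t * c" "- (1 / (a * c))"] a c t by (simp add: field_simps)
      also have "x (- ?s) \<otimes> (w ?s \<otimes> (h (t * c) \<otimes> x (- (1 / (a * c))))) \<otimes> x (d / c)
          = x (- ?s) \<otimes> (w ?s \<otimes> h (t * c)) \<otimes> (x (- (1 / (a * c))) \<otimes> x (d / c))"
        by (simp add: m_assoc)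
      also have "w ?s \<otimes> h (t * c) = w (t / a)" using w_h[of ?s "t * c"] a c t by (simp add: field_simps)
      also have "x (- (1 / (a * c))) \<otimes> x (d / c) = x (b / a)"
      proof -
        have "- (1 / (a * c)) + d / c = b / a" using a c det by (simp add: field_simps)
        then show ?thesis by (simp flip: x_add)
      qed
      finally show ?thesis using a c t by (simp add: prod \<phi>_mat2 mult.commute mult.left_commute)
    qed
  qed
qed

section \<open>Multiplicativity and injectivity of the Bruhat map\<close>

lemma \<phi>_one: "\<phi> (mat 1) = \<one>"
  by (simp add: mat_1_mat2 \<phi>_mat2 h_one)

text \<open>The left factors that respect all products are closed under multiplication and contain
  the upper unipotent and the Weyl matrices, which generate SL(2,q).\<close>

lemma \<phi>_mult:
  assumes "det A = 1" "det B = 1"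
  shows "\<phi> (A ** B) = \<phi> A \<otimes> \<phi> B"
proof -
  define T where "T = {S. det S = 1 \<and> (\<forall>M. det M = 1 \<longrightarrow> \<phi> (S ** M) = \<phi> S \<otimes> \<phi> M)}"
  have TT: "S ** S' \<in> T" if "S \<in> T" "S' \<in> T" for S S'
    using that by (auto simp: T_def det_mul m_assoc simp flip: matrix_mul_assoc)
  have X: "mat2 1 t 0 1 \<in> T" for t
    using \<phi>_x[of "mat 1" t] \<phi>_x by (simp add: T_def \<phi>_one)
  have N: "mat2 0 t (- inverse t) 0 \<in> T" if "t \<noteq> 0" for t
    using \<phi>_w[of "mat 1" t] \<phi>_w that by (simp add: T_def \<phi>_one)
  have low: "mat2 a b c d \<in> T" if "a * d - b * c = 1" "c \<noteq> 0" for a b c d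
  proof -
    have "b = (a * d - 1) / c" using that by (simp add: field_simps)
    then have "mat2 a b c d = mat2 1 (a / c) 0 1 ** mat2 0 (- (1 / c)) (- inverse (- (1 / c))) 0 ** mat2 1 (d / c) 0 1"
      using that by (simp add: field_simps)
    moreover have "\<dots> \<in> T" using that by (intro TT X N) simp
    ultimately show ?thesis by simp
  qed
  obtain a b c d where A: "A = mat2 a b c d" by (rule mat2_cases)
  have det: "a * d - b * c = 1" using assms by (simp add: A)
  have "A \<in> T"
  proof (cases "c = 0")
    case True
    \<comment> \<open>One Weyl factor moves the nonzero entry \<open>a\<close> to the lower left and
      leads back to the big cell.\<close>
    have "A = mat2 0 1 (- inverse 1) 0 ** mat2 (- c) (- d) a b" by (simp add: A)
    moreover have "\<dots> \<in> T" using det True by (intro TT N low) (auto simp: mult.commute)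
    ultimately show ?thesis by simp
  qed (use low det A in auto)
  then show ?thesis using assms(2) by (simp add: T_def)
qed


lemma det_mat2_inverse:
  fixes A :: "'f ^ 2 ^ 2"
  assumes "det A = 1"
  obtains B where "det B = 1" "A ** B = mat 1" "B ** A = mat 1"
proof -
  obtain a b c d where A: "A = mat2 a b c d" by (rule mat2_cases)
  have det: "a * d - b * c = 1" using assms by (simp add: A)
  show ?thesis
    by (rule that[of "mat2 d (- b) (- c) a"]) (use det in \<open>simp_all add: A mat_1_mat2 algebra_simps\<close>)
qed

text \<open>The bound q > 3 supplies a scalar outside 0 and the signs.\<close>

lemma field_elementE:
  obtains \<nu> :: 'f where "\<nu> \<noteq> 0" "\<nu> \<noteq> 1" "\<nu> \<noteq> - 1"
proof -
  have "\<not> (UNIV :: 'f set) \<subseteq> {0, 1, - 1}"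
  proof
    assume "(UNIV :: 'f set) \<subseteq> {0, 1, - 1}"
    then have "CARD('f) \<le> card {0, 1, - 1 :: 'f}" by (intro card_mono) auto
    also have "\<dots> \<le> 3" by (simp add: card_insert_if)
    finally show False using card_f q_gt by simp
  qed
  then show ?thesis using that by blast
qed

text \<open>If \<open>h (- 1)\<close> were 1, a lift \<open>k\<close> of diag(-1, 1) would commute
  with \<open>w 1\<close>, besides commuting with the torus. As \<open>k\<close> is noncentral,
  commuting passes through it, so the torus would commute with \<open>w 1\<close>; scaling
  \<open>w 1\<close> by \<open>\<nu>\<close> with \<nu>^2 different from 1 refutes this.\<close>

lemma h_minus_one:
  assumes "(- 1 :: 'f) \<noteq> 1"
  shows "h (- 1) \<noteq> \<one>"
proof
  assume h: "h (- 1) = \<one>"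
  have w1: "w (- 1) = w 1"
  proof -
    have "w (- 1) \<otimes> w (- 1) = w (- 1) \<otimes> w 1" using h w_cancel(2)[of 1] by (simp add: h_def)
    then show ?thesis using inv_mult_cancel(1)[of "w (- 1)"] w_carrier by metis
  qed
  obtain k where k: "lifts k (mat2 (- 1) 0 0 1)" using lifts_scale[of "- 1"] by auto
  have kC: "k \<in> carrier G" using k by (rule lifts_carrier)
  have "mat2 (- 1) 0 0 1 \<notin> (scalar_matrices :: ('f ^ 2 ^ 2) set)"
    using assms by (auto simp: scalar_matrices_def mat_eq_mat2)
  then have kN: "k \<in> noncentral G" using lifts_center_iff[OF k] kC by simp
  have "conj k (w 1) = w 1" using scale_w[OF k, of 1] w1 by simp
  then have kw: "k \<otimes> w 1 = w 1 \<otimes> k" using kC by (simp add: conj_fix_iff)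
  obtain \<nu> :: 'f where \<nu>: "\<nu> \<noteq> 0" "\<nu> \<noteq> 1" "\<nu> \<noteq> - 1"
    by (rule field_elementE)
  obtain l where l: "lifts l (mat2 \<nu> 0 0 1)" using lifts_scale[OF \<nu>(1)] .
  have lC: "l \<in> carrier G" using l by (rule lifts_carrier)
  have "l \<otimes> k = k \<otimes> l" using diagonal_commute[OF l k] .
  then have "l \<otimes> w 1 = w 1 \<otimes> l" using comm_trans[OF lC kN _ _ kw] by simp
  then have "conj l (w 1) = w 1" using lC by (simp add: conj_fix_iff)
  then have "w \<nu> = w 1" using scale_w[OF l, of 1] by simp
  then have "h \<nu> = \<one>" by (simp add: h_def w_cancel)
  then have "mat2 \<nu> 0 0 (inverse \<nu>) \<in> scalar_matrices"
    using lifts_center_iff[OF lifts_h[OF \<nu>(1)]] one_in_Z by simp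
  then have "\<nu> = inverse \<nu>" by (auto simp: scalar_matrices_def mat_eq_mat2)
  then have "\<nu> * \<nu> = 1" using \<nu>(1) by (metis right_inverse)
  then have "(\<nu> - 1) * (\<nu> + 1) = 0" by (simp add: algebra_simps)
  then show False using \<nu> by (auto simp: add_eq_0_iff2)
qed

lemma \<phi>_center:
  assumes "det A = 1" "\<phi> A \<in> Z"
  shows "A = mat 1 \<or> A = mat (- 1)"
proof -
  have "A \<in> scalar_matrices" using lifts_center_iff[OF lifts_\<phi>[OF assms(1)]] assms(2) by simp
  then obtain c where c: "A = mat2 c 0 0 c" by (auto simp: scalar_matrices_def mat_eq_mat2)
  then have "c * c = 1" using assms(1) by simp
  then have "(c - 1) * (c + 1) = 0" by (simp add: algebra_simps)
  then show ?thesis by (auto simp: c mat_eq_mat2 add_eq_0_iff2)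
qed

lemma \<phi>_eq_one:
  assumes "det A = 1" "\<phi> A = \<one>"
  shows "A = mat 1"
proof (rule ccontr)
  assume "A \<noteq> mat 1"
  then have A: "A = mat2 (- 1) 0 0 (- 1)" using \<phi>_center[OF assms(1)] assms(2) one_in_Z
    by (auto simp: mat_eq_mat2)
  then have "(- 1 :: 'f) \<noteq> 1" using \<open>A \<noteq> mat 1\<close> by (auto simp: mat_1_mat2)
  then show False using h_minus_one assms(2) by (simp add: A \<phi>_mat2)
qed

definition S :: "'a set" where
  "S = \<phi> ` {A. det A = 1}"

lemma subgroup_S: "subgroup S G"
proof (rule subgroupI)
  show "S \<subseteq> carrier G" "S \<noteq> {}" by (auto simp: S_def intro: exI[of _ "mat 1"])
  fix a b assume "a \<in> S"
  then obtain A where A: "det A = 1" "a = \<phi> A" by (auto simp: S_def)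
  obtain A' where A': "det A' = 1" "A' ** A = mat 1" using det_mat2_inverse[OF A(1)] by metis
  have "\<phi> A' \<otimes> \<phi> A = \<one>" using \<phi>_mult[OF A'(1) A(1)] A'(2) \<phi>_one by simp
  then have "inv a = \<phi> A'" using A(2) by (intro inv_equality) simp_all
  then show "inv a \<in> S" using A'(1) by (auto simp: S_def)
  assume "b \<in> S"
  then obtain B where B: "det B = 1" "b = \<phi> B" by (auto simp: S_def)
  have "a \<otimes> b = \<phi> (A ** B)" "det (A ** B) = 1" using A B by (simp_all add: \<phi>_mult det_mul)
  then show "a \<otimes> b \<in> S" by (auto simp: S_def)
qed

lemma inj_\<phi>: "inj_on \<phi> {A. det A = 1}"
proof (rule inj_onI, clarify)
  fix A B :: "'f ^ 2 ^ 2" assume AB: "det A = 1" "det B = 1" "\<phi> A = \<phi> B"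
  obtain B' where B': "det B' = 1" "B ** B' = mat 1" "B' ** B = mat 1" using det_mat2_inverse[OF AB(2)] .
  have "\<phi> (A ** B') = \<one>" using AB B' \<phi>_mult \<phi>_one by metis
  then have "A ** B' = mat 1" using AB B' by (intro \<phi>_eq_one) (simp add: det_mul)
  then have "A ** (B' ** B) = B" by (simp add: matrix_mul_assoc)
  then show "A = B" using B' by simp
qed

lemma PSL_decomposition:
  assumes A: "invertible (A :: 'f ^ 2 ^ 2)"
  obtains k B where "lifts k (mat2 (det A) 0 0 1)" "det B = 1" "A = mat2 (det A) 0 0 1 ** B"
proof -
  obtain a b c d where A': "A = mat2 a b c d" by (rule mat2_cases)
  have nz: "det A \<noteq> 0" using A by (simp add: invertible_det_nz)
  obtain k where "lifts k (mat2 (det A) 0 0 1)" using lifts_scale[OF nz] .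
  moreover have "det (mat2 (a / det A) (b / det A) c d) = 1"
  proof -
    have "a / det A * d - b / det A * c = det A / det A"
      unfolding times_divide_eq_left by (simp add: A' flip: diff_divide_distrib)
    then show ?thesis using nz by simp
  qed
  moreover have "A = mat2 (det A) 0 0 1 ** mat2 (a / det A) (b / det A) c d"
    using nz by (simp add: A')
  ultimately show ?thesis using that by blast
qed

lemma lifts_exists:
  assumes "invertible (A :: 'f ^ 2 ^ 2)"
  obtains g where "lifts g A"
proof -
  obtain k B where kB: "lifts k (mat2 (det A) 0 0 1)" "det B = 1" "A = mat2 (det A) 0 0 1 ** B"
    using PSL_decomposition[OF assms] .
  have "lifts (k \<otimes> \<phi> B) A" using lifts_mult[OF kB(1) lifts_\<phi>[OF kB(2)]] kB(3) by simp
  then show ?thesis by (rule that)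
qed

section \<open>The image of the action\<close>

lemma card_mob_GL: "card (mob ` carrier GL2) * (q - 1) = card (carrier GL2)"
proof -
  interpret GL: group GL2 by (rule group_GL)
  have "card (carrier GL2)
      = card (mob ` carrier GL2) * card (scalar_matrices :: ('f ^ 2 ^ 2) set)"
  proof (rule GL.card_image_subgroup)
    show "subgroup (carrier GL) GL2" by (rule GL.subgroup_self)
    show sub: "subgroup scalar_matrices GL2"
      using scalar_matrices_normal_GL by (rule normal_imp_subgroup)
    show "scalar_matrices \<subseteq> carrier GL2" using sub by (rule subgroup.subset)
    show "finite (carrier GL2)" by simp
    fix A B :: "'f ^ 2 ^ 2" assume AB: "A \<in> carrier GL" "B \<in> carrier GL"
    let ?A = "inv\<^bsub>GL\<^esub> A"
    have inv: "?A \<in> carrier GL" "?A ** A = mat 1" "A ** ?A = mat 1"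
      using GL.inv_closed[OF AB(1)] GL.l_inv[OF AB(1)] GL.r_inv[OF AB(1)] by simp_all
    have id: "mob ?A \<circ> mob A = id" "mob A \<circ> mob ?A = id"
      using mob_mult[of A ?A] mob_mult[of ?A A] inv AB by (simp_all add: mob_one)
    have "mob A = mob B \<longleftrightarrow> mob ?A \<circ> mob B = id"
      using id by (metis comp_assoc comp_id id_comp)
    also have "mob ?A \<circ> mob B = mob (?A ** B)" using AB by (simp add: mob_mult)
    also have "mob (?A ** B) = id \<longleftrightarrow> ?A ** B \<in> scalar_matrices"
      by (rule mob_eq_id_iff) (use inv AB in \<open>simp add: invertible_mult\<close>)
    finally show "mob A = mob B \<longleftrightarrow> ?A \<otimes>\<^bsub>GL\<^esub> B \<in> scalar_matrices"
      by simp
  qed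
  then show ?thesis by (simp add: card_scalar_matrices card_f)
qed

lemma card_\<alpha>_image: "card (\<alpha> ` carrier G) * (q - 1) = card (carrier G)"
proof -
  have "card (carrier G) = card (\<alpha> ` carrier G) * card Z"
  proof (rule card_image_subgroup[OF subgroup_self subgroup_center Z_carrier fin])
    fix g h assume gh: "g \<in> carrier G" "h \<in> carrier G"
    show "\<alpha> g = \<alpha> h \<longleftrightarrow> inv g \<otimes> h \<in> Z"
    proof
      assume "\<alpha> g = \<alpha> h"
      then obtain z where "z \<in> Z" "h = g \<otimes> z" using \<alpha>_eqD gh by blast
      then show "inv g \<otimes> h \<in> Z" using gh Z_carrier by (auto simp: inv_mult_cancel)
    next
      assume "inv g \<otimes> h \<in> Z"
      then have "\<alpha> (g \<otimes> (inv g \<otimes> h)) = \<alpha> g"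
        using gh \<alpha>_id[of "inv g \<otimes> h"] \<alpha>_mult[of g "inv g \<otimes> h"] by simp
      then show "\<alpha> g = \<alpha> h" using gh by (simp add: inv_mult_cancel)
    qed
  qed
  then show ?thesis by (simp add: card_Z)
qed

text \<open>Every matrix has a lift, which gives one inclusion. Both groups have the same order and
  kernels of order q - 1, so counting gives the other.\<close>

lemma \<alpha>_image: "\<alpha> ` carrier G = mob ` carrier GL2"
proof (rule card_subset_eq[symmetric])
  show "finite (\<alpha> ` carrier G)" by simp
  show "mob ` carrier GL2 \<subseteq> \<alpha> ` carrier G"
  proof (rule image_subsetI)
    fix A :: "'f ^ 2 ^ 2" assume "A \<in> carrier GL"
    then obtain g where "lifts g A" using lifts_exists by auto
    then show "mob A \<in> \<alpha> ` carrier G" unfolding lifts_def by (metis imageI)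
  qed
  have "card (carrier GL2) = card (carrier G)"
  proof -
    have "q^2 - q = q * (q - 1)" by (simp add: power2_eq_square right_diff_distrib')
    moreover have "q^2 - 1 = (q + 1) * (q - 1)" using q_gt by (cases q) (simp_all add: power2_eq_square)
    ultimately show ?thesis unfolding card_GL2 card_f card_G by (simp only: power2_eq_square mult_ac)
  qed
  then have "card (mob ` carrier GL2) * (q - 1) = card (\<alpha> ` carrier G) * (q - 1)"
    using card_mob_GL card_\<alpha>_image by simp
  then show "card (mob ` carrier GL2) = card (\<alpha> ` carrier G)"
    unfolding mult_cancel2 using q_gt by auto
qed

lemma obtain_lifts:
  assumes "g \<in> carrier G"
  obtains A where "lifts g A"
proof -
  have "\<alpha> g \<in> mob ` carrier GL2" using assms \<alpha>_image by blast
  then obtain A where "invertible A" "\<alpha> g = mob A" by auto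
  then show ?thesis using that assms unfolding lifts_def by blast
qed

text \<open>The central factor left over lifts the identity matrix, so it can be absorbed into the
  torus lift \<open>k\<close>.\<close>

lemma torus_decomposition:
  assumes g: "g \<in> carrier G"
  obtains k \<nu> s where "lifts k (mat2 \<nu> 0 0 1)" "s \<in> S" "g = k \<otimes> s"
proof -
  obtain A where A: "lifts g A" using obtain_lifts[OF g] .
  then have "invertible A" by (simp add: lifts_def)
  then obtain k B where kB: "lifts k (mat2 (det A) 0 0 1)" "det B = 1" "A = mat2 (det A) 0 0 1 ** B"
    by (rule PSL_decomposition)
  have l: "lifts (k \<otimes> \<phi> B) A" using lifts_mult[OF kB(1) lifts_\<phi>[OF kB(2)]] kB(3) by simp
  have kC: "k \<in> carrier G" using kB(1) by (rule lifts_carrier)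
  obtain z where z: "z \<in> Z" "g = k \<otimes> \<phi> B \<otimes> z"
    using \<alpha>_eqD[OF lifts_carrier[OF l] g] l A by (auto simp: lifts_def)
  have zC: "z \<in> carrier G" using z Z_carrier by auto
  have "invertible (mat 1 :: 'f ^ 2 ^ 2)" by (simp add: mat_1_mat2)
  then have "lifts z (mat 1)" using z zC \<alpha>_id by (simp add: lifts_def mob_one)
  from lifts_mult[OF kB(1) this] have "lifts (k \<otimes> z) (mat2 (det A) 0 0 1)" by (simp add: mat_1_mat2)
  moreover have "g = k \<otimes> z \<otimes> \<phi> B" using z kC zC Z_commute[OF z(1), of "\<phi> B"]
    by (simp add: m_assoc)
  moreover have "\<phi> B \<in> S" using kB(2) by (auto simp: S_def)
  ultimately show ?thesis using that by blast
qed

text \<open>Conjugation by diag(\<nu>, 1) only rescales the parameters of the Bruhat normal form, so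
  the result is the normal form of the conjugated matrix.\<close>

lemma conj_torus_S:
  assumes k: "lifts k (mat2 \<nu> 0 0 1)" and s: "s \<in> S"
  shows "conj k s \<in> S"
proof -
  have nu: "\<nu> \<noteq> 0" and kC: "k \<in> carrier G" using k by (auto simp: lifts_def)
  obtain A where A: "det A = 1" "s = \<phi> A" using s by (auto simp: S_def)
  obtain a b c d where abcd: "A = mat2 a b c d" by (rule mat2_cases)
  have det: "a * d - b * c = 1" using A by (simp add: abcd)
  have "conj k s = \<phi> (mat2 a (\<nu> * b) (c / \<nu>) d)"
  proof (cases "c = 0")
    case True
    then have "a \<noteq> 0" using det by auto
    have "conj k (h a) = h a" using diagonal_commute[OF k lifts_h[OF \<open>a \<noteq> 0\<close>]] kC
      by (simp add: conj_fix_iff)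
    then show ?thesis using True kC by (simp add: A(2) abcd \<phi>_mat2 conj_mult scale_x[OF k] mult.left_commute)
  next
    case False
    then show ?thesis using kC nu
      by (simp add: A(2) abcd \<phi>_mat2 conj_mult scale_x[OF k] scale_w[OF k] mult.commute[of \<nu>])
  qed
  moreover have "det (mat2 a (\<nu> * b) (c / \<nu>) d) = 1" using det nu by simp
  ultimately show ?thesis by (auto simp: S_def)
qed

section \<open>The derived subgroup\<close>

lemma S_carrier: "s \<in> S \<Longrightarrow> s \<in> carrier G"
  using subgroup.subset[OF subgroup_S] by blast

lemma conj_S:
  assumes g: "g \<in> carrier G" and s: "s \<in> S"
  shows "conj g s \<in> S"
proof -
  obtain k \<nu> r where k: "lifts k (mat2 \<nu> 0 0 1)" "r \<in> S" "g = k \<otimes> r"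
    using torus_decomposition[OF g] .
  have "conj r s = r \<otimes> s \<otimes> inv r" by (simp add: conj_def)
  then have "conj r s \<in> S" using k(2) s subgroup_S by (simp add: subgroup_closed)
  then have "conj k (conj r s) \<in> S" by (rule conj_torus_S[OF k(1)])
  then show ?thesis using k s lifts_carrier[OF k(1)] S_carrier by (simp add: conj_conj)
qed

text \<open>Modulo the normal subgroup \<open>S\<close>, every element is a lift of a diagonal
  matrix, and these lifts commute in \<open>G\<close>.\<close>

lemma derived_subset_S: "derived G (carrier G) \<subseteq> S"
  unfolding derived_def
proof (rule generate_subgroup_incl[OF _ subgroup_S], clarify)
  fix g g' assume g: "g \<in> carrier G" "g' \<in> carrier G"
  obtain k \<nu> r where k: "lifts k (mat2 \<nu> 0 0 1)" "r \<in> S" "g = k \<otimes> r"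
    using torus_decomposition[OF g(1)] .
  obtain k' \<nu>' r' where k': "lifts k' (mat2 \<nu>' 0 0 1)" "r' \<in> S" "g' = k' \<otimes> r'"
    using torus_decomposition[OF g(2)] .
  have car: "k \<in> carrier G" "k' \<in> carrier G" "r \<in> carrier G" "r' \<in> carrier G"
    using k k' lifts_carrier S_carrier by auto
  have kk: "k \<otimes> k' = k' \<otimes> k" using diagonal_commute[OF k(1) k'(1)] .
  \<comment> \<open>Collecting the torus lifts on the left gives both products the same torus part,
    so they differ by elements of \<open>S\<close>.\<close>
  define s1 s2 where "s1 = conj (inv k') r \<otimes> r'" and "s2 = conj (inv k) r' \<otimes> r"
  have s: "s1 \<in> S" "s2 \<in> S" using conj_S k k' car subgroup_S
    by (simp_all add: s1_def s2_def subgroup.m_closed)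
  have sC: "s1 \<in> carrier G" "s2 \<in> carrier G" using s S_carrier by auto
  have e1: "g \<otimes> g' = k \<otimes> k' \<otimes> s1"
    using car by (simp add: k(3) k'(3) s1_def conj_def m_assoc inv_mult_cancel)
  have e2: "g' \<otimes> g = k \<otimes> k' \<otimes> s2"
    using car by (simp add: kk k(3) k'(3) s2_def conj_def m_assoc inv_mult_cancel)
  have "g \<otimes> g' \<otimes> inv g \<otimes> inv g' = (g \<otimes> g') \<otimes> inv (g' \<otimes> g)"
    using g by (simp add: inv_mult_group m_assoc)
  also have "\<dots> = conj (k \<otimes> k') (s1 \<otimes> inv s2)" unfolding e1 e2 using car sC
    by (simp add: conj_def inv_mult_group m_assoc)
  also have "\<dots> \<in> S" using s subgroup_S car by (intro conj_S) (simp_all add: subgroup_closed)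
  finally show "g \<otimes> g' \<otimes> inv g \<otimes> inv g' \<in> S" .
qed

text \<open>A torus lift with scalar \<open>\<nu>\<close> other than 1 makes every root element a
  commutator: the parameter of the commutator with \<open>x s\<close> is (\<nu> - 1) s, and any
  \<open>t\<close> has this form. The Bruhat factors are products of root elements.\<close>

lemma S_subset_derived: "S \<subseteq> derived G (carrier G)"
proof -
  let ?D = "derived G (carrier G)"
  have D: "subgroup ?D G" by (rule derived_is_subgroup) simp
  have comm: "conj k g \<otimes> inv g \<in> ?D" if "k \<in> carrier G" "g \<in> carrier G" for k g
    using that unfolding derived_def conj_def by (auto intro!: generate.incl simp: m_assoc)
  obtain \<nu> :: 'f where \<nu>: "\<nu> \<noteq> 0" "\<nu> \<noteq> 1" by (rule field_elementE)
  obtain k where k: "lifts k (mat2 \<nu> 0 0 1)" using lifts_scale[OF \<nu>(1)] .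
  have kC: "k \<in> carrier G" using k by (rule lifts_carrier)
  have x: "x t \<in> ?D" for t
  proof -
    define s where "s = t / (\<nu> - 1)"
    have "t = s * (\<nu> - 1)" using \<nu> by (simp add: s_def)
    also have "\<dots> = \<nu> * s + - s" by (simp add: algebra_simps)
    finally have "x t = x (\<nu> * s + - s)" by simp
    also have "\<dots> = conj k (x s) \<otimes> inv (x s)" by (simp only: x_add x_minus scale_x[OF k])
    finally show ?thesis using comm[OF kC x_carrier] by metis
  qed
  have y: "y t \<in> ?D" for t
  proof -
    define r where "r = t / (1 - \<nu>)"
    have "t = r * (1 - \<nu>)" using \<nu> by (simp add: r_def)
    also have "\<dots> = r * \<nu> / \<nu> + - (r * \<nu>)" using \<nu> by (simp add: algebra_simps)
    finally have "y t = y (r * \<nu> / \<nu> + - (r * \<nu>))" by simp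
    also have "\<dots> = conj k (y (r * \<nu>)) \<otimes> inv (y (r * \<nu>))"
      by (simp only: y(3) y_minus scale_y[OF k])
    finally show ?thesis using comm[OF kC y_carrier] by metis
  qed
  have w: "w t \<in> ?D" for t unfolding w_def using x y D by (simp add: subgroup_closed)
  have "h t \<in> ?D" for t unfolding h_def using w D by (simp add: subgroup_closed)
  then have "\<phi> A \<in> ?D" for A unfolding \<phi>_def Let_def using x w D by (simp add: subgroup_closed)
  then show ?thesis by (auto simp: S_def)
qed

lemma derived_eq_S: "derived G (carrier G) = S"
  using derived_subset_S S_subset_derived by blast

lemma derived_iso_SL: "G\<lparr>carrier := derived G (carrier G)\<rparr> \<cong> (SL :: ('f ^ 2 ^ 2) monoid)"
proof -
  have "\<phi> \<in> iso (SL :: ('f ^ 2 ^ 2) monoid) (G\<lparr>carrier := S\<rparr>)"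
    unfolding iso_def hom_def bij_betw_def using \<phi>_mult inj_\<phi> by (auto simp: SL_def S_def)
  then have "(SL :: ('f ^ 2 ^ 2) monoid) \<cong> G\<lparr>carrier := S\<rparr>" by (auto simp: is_iso_def)
  moreover have "group (SL :: ('f ^ 2 ^ 2) monoid)"
  proof -
    interpret GL: group GL2 by (rule group_GL)
    have "subgroup {A. det A = 1} GL2"
    proof (rule GL.subgroupI)
      fix A B :: "'f ^ 2 ^ 2" assume A: "A \<in> {A. det A = 1}"
      then obtain B where B: "det B = 1" "B ** A = mat 1" using det_mat2_inverse[of A] by auto
      have "inv\<^bsub>GL\<^esub> A = B" using A B by (intro GL.inv_equality) (simp_all add: invertible_det_nz)
      then show "inv\<^bsub>GL\<^esub> A \<in> {A. det A = 1}" using B by simp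
    qed (auto simp: invertible_det_nz det_mul intro: exI[of _ "mat 1"])
    then show ?thesis unfolding SL_def by (rule GL.subgroup_imp_group)
  qed
  ultimately show ?thesis unfolding derived_eq_S using group.iso_sym by blast
qed

text \<open>Both sides are isomorphic to the same permutation group of the projective line, by the
  first isomorphism theorem.\<close>

lemma quotient_iso_PGL: "G Mod Z \<cong> (PGL :: ('f ^ 2 ^ 2) set monoid)"
proof -
  define T :: "('f option \<Rightarrow> 'f option) monoid"
    where "T = \<lparr>carrier = \<alpha> ` carrier G, monoid.mult = (\<circ>), one = id\<rparr>"
  have id1: "\<alpha> \<one> = id" using \<alpha>_id one_in_Z by simp
  have T: "group T"
  proof (rule groupI)
    fix a b assume a: "a \<in> carrier T"
    then obtain g where g: "g \<in> carrier G" "a = \<alpha> g" by (auto simp: T_def)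
    have "\<alpha> (inv g) \<circ> \<alpha> g = id" using \<alpha>_mult[of "inv g" g] g id1 by simp
    then show "\<exists>b \<in> carrier T. b \<otimes>\<^bsub>T\<^esub> a = \<one>\<^bsub>T\<^esub>" using g
      by (auto simp: T_def intro: bexI[of _ "inv g"])
    assume "b \<in> carrier T"
    then show "a \<otimes>\<^bsub>T\<^esub> b \<in> carrier T" using g
      by (auto simp: T_def simp flip: \<alpha>_mult)
  next
    show "\<one>\<^bsub>T\<^esub> \<in> carrier T" using id1
      by (auto simp: T_def image_iff intro: bexI[of _ \<one>])
  qed (auto simp: T_def comp_assoc)
  interpret \<alpha>: group_hom G T \<alpha>
    by (intro group_hom.intro group_axioms T group_hom_axioms.intro) (auto simp: hom_def T_def \<alpha>_mult)
  interpret mob: group_hom GL2 T mob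
    by (intro group_hom.intro group_GL T group_hom_axioms.intro) (auto simp: hom_def T_def \<alpha>_image mob_mult)
  have "kernel G T \<alpha> = Z" using \<alpha>_id Z_carrier by (auto simp: kernel_def T_def)
  then have 1: "G Mod Z \<cong> T" using \<alpha>.FactGroup_iso by (simp add: T_def)
  have "kernel GL2 T mob = scalar_matrices"
    using mob_eq_id_iff subgroup.subset[OF normal_imp_subgroup[OF scalar_matrices_normal_GL]]
    by (auto simp: kernel_def T_def)
  then have 2: "(PGL :: ('f ^ 2 ^ 2) set monoid) \<cong> T"
    unfolding PGL_def using mob.FactGroup_iso by (simp add: T_def \<alpha>_image)
  have "group (PGL :: ('f ^ 2 ^ 2) set monoid)" unfolding PGL_def
    by (rule normal.factorgroup_is_group[OF scalar_matrices_normal_GL])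
  from group.iso_sym[OF this 2] show ?thesis using 1 iso_trans by blast
qed

text \<open>In characteristic 2 the signs coincide, so \<open>S\<close> meets the center trivially.
  Every scalar is a square, so diag(\<tau>^2, 1) is a scalar multiple of diag(\<tau>, 1/\<tau>), and
  each torus lift is an element of \<open>S\<close> times a central one.\<close>

lemma even_direct_product:
  assumes "even q"
  shows "internal_direct_product G (derived G (carrier G)) Z"
proof -
  have "p = 2" using assms prime_p prime_dvd_power[of 2 p n] q_eq
    by (metis even_power two_is_prime_nat primes_dvd_imp_eq)
  have "(\<Sum>s\<in>(UNIV :: 'f set). s + 1) = (\<Sum>s\<in>UNIV. s)"
    by (rule sum.reindex_bij_witness[of _ "\<lambda>s. s - 1" "\<lambda>s. s + 1"]) auto
  then have "(of_nat (p ^ n) :: 'f) = 0" using card_f q_eq by (simp add: sum.distrib)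
  then have two: "(2 :: 'f) = 0" using \<open>p = 2\<close> by simp
  have neg: "- s = s" for s :: 'f using two by (metis add.commute add_eq_0_iff mult_2 mult_zero_left)
  have "inj (\<lambda>s :: 'f. s * s)"
  proof (rule injI)
    fix s t :: 'f assume "s * s = t * t"
    then have "(s - t) * (s + t) = 0" by (simp add: algebra_simps)
    then show "s = t" using neg[of t] by (auto simp: add_eq_0_iff2)
  qed
  then have sq: "surj (\<lambda>s :: 'f. s * s)" by (intro finite_UNIV_inj_surj) auto
  have "S \<inter> Z = {\<one>}"
  proof (intro equalityI subsetI)
    fix s assume s: "s \<in> S \<inter> Z"
    then obtain A where A: "det A = 1" "s = \<phi> A" by (auto simp: S_def)
    then have "A = mat 1" using \<phi>_center[of A] s neg[of 1] by auto
    then show "s \<in> {\<one>}" using A \<phi>_one by simp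
  qed (use subgroup.one_closed[OF subgroup_S] one_in_Z in auto)
  moreover have "S <#> Z = carrier G"
  proof (intro equalityI subsetI)
    fix g assume "g \<in> S <#> Z"
    then show "g \<in> carrier G" using S_carrier Z_carrier by (auto simp: set_mult_def)
  next
    fix g assume g: "g \<in> carrier G"
    obtain k \<nu> s where k: "lifts k (mat2 \<nu> 0 0 1)" "s \<in> S" "g = k \<otimes> s"
      using torus_decomposition[OF g] .
    have kC: "k \<in> carrier G" using k(1) by (rule lifts_carrier)
    obtain \<tau> where \<tau>: "\<nu> = \<tau> * \<tau>" using sq by (metis surjD)
    have "\<tau> \<noteq> 0" using k(1) \<tau> by (auto simp: lifts_def)
    then have "\<alpha> (h \<tau>) = \<alpha> k" using lifts_h[of \<tau>] k(1) \<tau>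
      by (auto simp: lifts_def mob_special divide_inverse)
    then obtain z where z: "z \<in> Z" "k = h \<tau> \<otimes> z" using \<alpha>_eqD[of "h \<tau>" k] kC by auto
    have zC: "z \<in> carrier G" using z Z_carrier by auto
    have "h \<tau> = \<phi> (mat2 \<tau> 0 0 (inverse \<tau>))" by (simp add: \<phi>_mat2)
    then have "h \<tau> \<in> S" using \<open>\<tau> \<noteq> 0\<close> by (auto simp: S_def)
    then have "h \<tau> \<otimes> s \<in> S" using k(2) subgroup_S by (simp add: subgroup_closed)
    moreover have "g = h \<tau> \<otimes> s \<otimes> z"
      using k z zC S_carrier Z_commute[OF z(1), of s] by (simp add: m_assoc)
    ultimately show "g \<in> S <#> Z" using z(1) by (auto simp: set_mult_def)
  qed
  moreover have "Z \<lhd> G"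
  proof (rule normal_invI[OF subgroup_center])
    fix g z assume gz: "g \<in> carrier G" "z \<in> Z"
    then have "z \<in> carrier G" using Z_carrier by blast
    then have "g \<otimes> z \<otimes> inv g = z" using gz by (simp add: m_assoc flip: Z_commute[OF gz(2,1)])
    then show "g \<otimes> z \<otimes> inv g \<in> Z" using gz(2) by simp
  qed
  ultimately show ?thesis
    unfolding internal_direct_product_def using derived_self_is_normal by (simp add: derived_eq_S)
qed

end

theorem theorem1p1:
  fixes G :: "('a, 'b) monoid_scheme"
    and q :: nat
  assumes "primepow q" and "q > 3"
    and "CARD('f::{field, finite}) = q"
    and "group G"
    and "digraph_iso (with_proj (noncommuting_graph G))
           (with_proj (noncommuting_graph (GL :: ('f ^ 2 ^ 2) monoid)))"
  shows "G Mod group_center G \<cong> (PGL :: ('f ^ 2 ^ 2) set monoid) \<and>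
         G\<lparr>carrier := derived G (carrier G)\<rparr> \<cong> (SL :: ('f ^ 2 ^ 2) monoid) \<and>
         card (group_center G) = q - 1 \<and>
         (even q \<longrightarrow> internal_direct_product G (derived G (carrier G)) (group_center G))"
proof -
  obtain p n where pn: "prime p" "q = p ^ n" using assms(1) by (auto simp: primepow_def)
  interpret gl2_type G q using gl2_type_if_graph_iso[OF assms(4,3,2,5)] .
  interpret gl2_geometry G q p n by unfold_locales (fact pn)+
  have two: "2 \<le> card points" using card_points q_gt by simp
  then obtain P Q where PQ: "P \<in> points" "Q \<in> points" "P \<noteq> Q"
    by (meson card_2_iff' obtain_subset_with_card_n subsetD)
  have "\<not> U P \<subseteq> {\<one>\<^bsub>G\<^esub>}"
  proof
    assume "U P \<subseteq> {\<one>\<^bsub>G\<^esub>}"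
    then have "card (U P) \<le> card {\<one>\<^bsub>G\<^esub>}" by (intro card_mono) auto
    then show False using U_props(2)[OF PQ(1)] q_gt by simp
  qed
  then obtain e where e: "e \<in> U P" "e \<noteq> \<one>\<^bsub>G\<^esub>" by blast
  interpret gl2_frame G q p n P Q e by unfold_locales (fact PQ e)+
  obtain x :: "'f \<Rightarrow> 'a" and \<alpha> where "gl2_action G q p n x \<alpha>"
    using action_coordinates[OF assms(3)] .
  then interpret gl2_action G q p n x \<alpha> .
  show ?thesis using quotient_iso_PGL derived_iso_SL card_Z even_direct_product by blast
qed

end
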